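(* Let $d\ge1$, $T>0$, $1<\gamma<\infty$. Let $(\nu,m,D)$ be a dissipative measure-valued solution of the isentropic Euler system on $(0,T)\times\mathbb T^d$ with initial data $(\rho_0,u_0)$, and let $(r,U)\in C^1([0,T]\times\mathbb T^d)$ with $r>0$ everywhere be a classical solution of $\partial_t(rU)+\operatorname{div}(rU\otimes U)+\nabla(r^\gamma)=0$, $\partial_t r+\operatorname{div}(rU)=0$ with initial data $(r_0,U_0)$. Then there is a constant $C>0$, depending only on $d$, $\gamma$ and the constant in condition (iii) of the definition of dissipative measure-valued solution, such that $$E_{\rm rel}(t)\le e^{CT\|\nabla U\|_{C([0,T]\times\mathbb T^d)}}E_{\rm rel}(0)\quad\text{for a.e. }t\in(0,T).$$
   Context: A Young measure on $X\subset\mathbb R^N$ with parameters in $(0,T)\times\mathbb T^d$ is a family $(\nu_{t,x})$ of Borel probability measures on $X$ with $(t,x)\mapsto\langle\nu_{t,x},f\rangle=\int f\,d\nu_{t,x}$ measurable for all $f\in C_0(X)$. A triple $(\nu,m,D)$ is a dissipative measure-valued solution of the isentropic Euler system (pressure $\rho^\gamma$) on $(0,T)\times\mathbb T^d$ with initial data $(\rho_0,u_0)$ if: (i) $\nu$ is a Young measure on $[0,\infty)\times\mathbb R^d$ (variables $(\rho,u)$); (ii) $m$ is a bounded $\mathbb R^{d\times d}$-valued Radon measure on $(0,T)\times\mathbb T^d$ with $m(dx\,dt)=m_t(dx)\otimes dt$, $(t\mapsto m_t)\in L^\infty((0,T);\mathcal M(\mathbb T^d;\mathbb R^{d\times d}))$;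 (iii) $D\in L^\infty(0,T)$, $D\ge0$, $|m_t|(\mathbb T^d)\le C\,D(t)$ for some $C>0$ and a.e. $t$; (iv) $\int_0^T\int\langle\nu_{t,x},\rho u\rangle\cdot\partial_t\varphi+\langle\nu_{t,x},\rho u\otimes u\rangle:\nabla\varphi+\langle\nu_{t,x},\rho^\gamma\rangle\operatorname{div}\varphi\,dx\,dt+\int_0^T\int\nabla\varphi:dm_t\,dt=-\int\rho_0u_0\cdot\varphi(0,\cdot)dx$ for all $\varphi\in C_c^\infty([0,T)\times\mathbb T^d;\mathbb R^d)$; (v) $\int_0^T\int\langle\nu_{t,x},\rho\rangle\partial_t\psi+\langle\nu_{t,x},\rho u\rangle\cdot\nabla\psi\,dx\,dt=-\int\rho_0\psi(0,\cdot)dx$ for all $\psi\in C_c^\infty([0,T)\times\mathbb T^d)$; (vi) $\int\frac12\langle\nu_{t,x},\rho|u|^2\rangle+\frac1{\gamma-1}\langle\nu_{t,x},\rho^\gamma\rangle dx+D(t)\le\int\frac12\rho_0|u_0|^2+\frac1{\gamma-1}\rho_0^\gamma dx$ for a.e. $t$; all integrals are assumed to exist. Relative energy: for a.e. $t\in(0,T)$, $E_{\rm rel}(t)=\int_{\mathbb T^d}\big\langle\nu_{t,x},\tfrac12\rho|u-U(t,x)|^2+\tfrac1{\gamma-1}(\rho^\gamma-r(t,x)^\gamma)-\tfrac{\gamma}{\gamma-1}r(t,x)^{\gamma-1}(\rho-r(t,x))\big\rangle dx+D(t)$, and $E_{\rm rel}(0)=\int_{\mathbb T^d}\tfrac12\rho_0|u_0-U_0|^2+\tfrac1{\gamma-1}(\rho_0^\gamma-r_0^\gamma)-\tfrac\gamma{\gamma-1}r_0^{\gamma-1}(\rho_0-r_0)\,dx$.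 *)

theory Defs
  imports "HOL-Analysis.Analysis"
begin

text \<open>The torus T^d is represented by the fundamental cell [0,1)^d; functions on
  [0,T] x T^d are functions on real x R^d which are 1-periodic in each space variable.\<close>

definition cell :: "(real ^ 'd) set" where
  "cell = {x. \<forall>i. 0 \<le> x $ i \<and> x $ i < 1}"

definition periodic_x :: "(real \<Rightarrow> real ^ 'd \<Rightarrow> 'b) \<Rightarrow> bool" where
  "periodic_x f \<longleftrightarrow> (\<forall>t x j. f t (x + axis j 1) = f t x)"

definition dT :: "(real \<Rightarrow> real ^ 'd \<Rightarrow> 'b::real_normed_vector) \<Rightarrow> real \<Rightarrow> real ^ 'd \<Rightarrow> 'b" where
  "dT f t x = vector_derivative (\<lambda>s. f s x) (at t)"

definition dTw :: "real set \<Rightarrow> (real \<Rightarrow> real ^ 'd \<Rightarrow> 'b::real_normed_vector) \<Rightarrow> real \<Rightarrow> real ^ 'd \<Rightarrow> 'b" where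
  "dTw S f t x = vector_derivative (\<lambda>s. f s x) (at t within S)"

definition dX :: "'d \<Rightarrow> (real \<Rightarrow> real ^ 'd \<Rightarrow> 'b::real_normed_vector) \<Rightarrow> real \<Rightarrow> real ^ 'd \<Rightarrow> 'b" where
  "dX j f t x = vector_derivative (\<lambda>h. f t (x + h *\<^sub>R axis j 1)) (at 0)"

fun Ck :: "nat \<Rightarrow> (real \<Rightarrow> real ^ 'd \<Rightarrow> 'b::real_normed_vector) \<Rightarrow> bool" where
  "Ck 0 f = continuous_on UNIV (\<lambda>z. f (fst z) (snd z))"
| "Ck (Suc k) f = (continuous_on UNIV (\<lambda>z. f (fst z) (snd z))
      \<and> (\<forall>t x. (\<lambda>s. f s x) differentiable (at t))
      \<and> (\<forall>t x j. (\<lambda>h. f t (x + h *\<^sub>R axis j 1)) differentiable (at 0))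
      \<and> Ck k (dT f) \<and> (\<forall>j. Ck k (dX j f)))"

definition smooth :: "(real \<Rightarrow> real ^ 'd \<Rightarrow> 'b::real_normed_vector) \<Rightarrow> bool" where
  "smooth f \<longleftrightarrow> (\<forall>k. Ck k f)"

definition test_fun :: "real \<Rightarrow> (real \<Rightarrow> real ^ 'd \<Rightarrow> 'b::real_normed_vector) \<Rightarrow> bool" where
  "test_fun T f \<longleftrightarrow> smooth f \<and> periodic_x f \<and> (\<exists>\<delta>>0. \<forall>t x. T - \<delta> \<le> t \<longrightarrow> f t x = 0)"

definition C1_on_torus :: "real \<Rightarrow> (real \<Rightarrow> real ^ 'd \<Rightarrow> 'b::real_normed_vector) \<Rightarrow> bool" where
  "C1_on_torus T f \<longleftrightarrow> periodic_x f
     \<and> continuous_on ({0..T} \<times> UNIV) (\<lambda>z. f (fst z) (snd z))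
     \<and> (\<forall>t\<in>{0..T}. \<forall>x. (\<lambda>s. f s x) differentiable (at t within {0..T}))
     \<and> (\<forall>t\<in>{0..T}. \<forall>x j. (\<lambda>h. f t (x + h *\<^sub>R axis j 1)) differentiable (at 0))
     \<and> continuous_on ({0..T} \<times> UNIV) (\<lambda>z. dTw {0..T} f (fst z) (snd z))
     \<and> (\<forall>j. continuous_on ({0..T} \<times> UNIV) (\<lambda>z. dX j f (fst z) (snd z)))"

definition grad_mat :: "(real \<Rightarrow> real ^ 'd \<Rightarrow> real ^ 'd) \<Rightarrow> real \<Rightarrow> real ^ 'd \<Rightarrow> real ^ 'd ^ 'd" where
  "grad_mat f t x = (\<chi> i j. dX j f t x $ i)"

definition divg :: "(real \<Rightarrow> real ^ 'd \<Rightarrow> real ^ 'd) \<Rightarrow> real \<Rightarrow> real ^ 'd \<Rightarrow> real" where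
  "divg f t x = (\<Sum>i\<in>UNIV. dX i f t x $ i)"

definition grad_s :: "(real \<Rightarrow> real ^ 'd \<Rightarrow> real) \<Rightarrow> real \<Rightarrow> real ^ 'd \<Rightarrow> real ^ 'd" where
  "grad_s f t x = (\<chi> j. dX j f t x)"

definition frob :: "real ^ 'd ^ 'd \<Rightarrow> real ^ 'd ^ 'd \<Rightarrow> real" where
  "frob A B = (\<Sum>i\<in>UNIV. \<Sum>j\<in>UNIV. A $ i $ j * B $ i $ j)"

definition tensor :: "real ^ 'd \<Rightarrow> real ^ 'd \<Rightarrow> real ^ 'd ^ 'd" where
  "tensor u v = (\<chi> i j. u $ i * v $ j)"

text \<open>The state space X = [0,\<infinity>) x R^d of variables (rho,u).\<close>

definition Xstate :: "(real \<times> (real ^ 'd)) set" where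
  "Xstate = {y. 0 \<le> fst y}"

definition C0_on :: "('a::metric_space) set \<Rightarrow> ('a \<Rightarrow> real) \<Rightarrow> bool" where
  "C0_on X f \<longleftrightarrow> continuous_on X f \<and>
     (\<forall>e>0. \<exists>K. compact K \<and> (\<forall>y\<in>X - K. \<bar>f y\<bar> \<le> e))"

definition young_measure :: "real \<Rightarrow> (real \<Rightarrow> real ^ 'd \<Rightarrow> (real \<times> (real ^ 'd)) measure) \<Rightarrow> bool" where
  "young_measure T \<nu> \<longleftrightarrow>
     (\<forall>t\<in>{0<..<T}. \<forall>x\<in>cell. emeasure (\<nu> t x) UNIV = 1 \<and> sets (\<nu> t x) = sets borel
                              \<and> emeasure (\<nu> t x) (UNIV - Xstate) = 0)
   \<and> (\<forall>f. C0_on Xstate f \<longrightarrow>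
        set_borel_measurable lborel ({0<..<T} \<times> cell)
          (\<lambda>z. \<integral>y. f y \<partial>(\<nu> (fst z) (snd z))))"

definition ypair :: "(real \<Rightarrow> real ^ 'd \<Rightarrow> (real \<times> (real ^ 'd)) measure) \<Rightarrow> real \<Rightarrow> real ^ 'd
     \<Rightarrow> (real \<times> (real ^ 'd) \<Rightarrow> 'b::{banach, second_countable_topology}) \<Rightarrow> 'b" where
  "ypair \<nu> t x f = (\<integral>y. f y \<partial>(\<nu> t x))"

text \<open>A bounded R^{dxd}-valued Borel measure m_t on T^d is represented in polar / density
  form m_t = \<theta>_t \<mu>_t, with \<mu>_t a finite nonnegative Borel measure concentrated on the cell and
  \<theta>_t \<in> L^1(\<mu>_t; R^{dxd}).  Its total variation is |m_t|(T^d) = \<integral> |\<theta>_t| d\<mu>_t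
  (Frobenius norm on matrices).\<close>

definition matrix_measure :: "(real ^ 'd) measure \<Rightarrow> (real ^ 'd \<Rightarrow> real ^ 'd ^ 'd) \<Rightarrow> bool" where
  "matrix_measure \<mu> \<theta> \<longleftrightarrow> finite_measure \<mu> \<and> sets \<mu> = sets borel
      \<and> emeasure \<mu> (UNIV - cell) = 0 \<and> integrable \<mu> \<theta>"

definition total_var :: "(real ^ 'd) measure \<Rightarrow> (real ^ 'd \<Rightarrow> real ^ 'd ^ 'd) \<Rightarrow> real" where
  "total_var \<mu> \<theta> = (\<integral>x. norm (\<theta> x) \<partial>\<mu>)"

definition mpair :: "(real ^ 'd) measure \<Rightarrow> (real ^ 'd \<Rightarrow> real ^ 'd ^ 'd) \<Rightarrow> (real ^ 'd \<Rightarrow> real ^ 'd ^ 'd) \<Rightarrow> real" where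
  "mpair \<mu> \<theta> g = (\<integral>x. frob (g x) (\<theta> x) \<partial>\<mu>)"

definition Linf_measure_family :: "real \<Rightarrow> (real \<Rightarrow> (real ^ 'd) measure) \<Rightarrow> (real \<Rightarrow> real ^ 'd \<Rightarrow> real ^ 'd ^ 'd) \<Rightarrow> bool" where
  "Linf_measure_family T \<mu> \<theta> \<longleftrightarrow>
     (\<forall>t\<in>{0<..<T}. matrix_measure (\<mu> t) (\<theta> t))
   \<and> (\<forall>g. continuous_on UNIV g \<and> (\<forall>x j. g (x + axis j 1) = g x) \<longrightarrow>
        set_borel_measurable lborel {0<..<T} (\<lambda>t. mpair (\<mu> t) (\<theta> t) g))
   \<and> (\<exists>B. AE t in lborel. t \<in> {0<..<T} \<longrightarrow> total_var (\<mu> t) (\<theta> t) \<le> B)"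

definition dmv_solution :: "real \<Rightarrow> real \<Rightarrow> real
    \<Rightarrow> (real \<Rightarrow> real ^ 'd \<Rightarrow> (real \<times> (real ^ 'd)) measure)
    \<Rightarrow> (real \<Rightarrow> (real ^ 'd) measure) \<Rightarrow> (real \<Rightarrow> real ^ 'd \<Rightarrow> real ^ 'd ^ 'd) \<Rightarrow> (real \<Rightarrow> real)
    \<Rightarrow> (real ^ 'd \<Rightarrow> real) \<Rightarrow> (real ^ 'd \<Rightarrow> real ^ 'd) \<Rightarrow> bool" where
  "dmv_solution \<gamma> Cm T \<nu> \<mu> \<theta> D \<rho>0 u0 \<longleftrightarrow>
     young_measure T \<nu>
   \<and> Linf_measure_family T \<mu> \<theta>
   \<comment> \<open>(iii)\<close>
   \<and> set_borel_measurable lborel {0<..<T} D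
   \<and> (\<exists>B. AE t in lborel. t \<in> {0<..<T} \<longrightarrow> \<bar>D t\<bar> \<le> B)
   \<and> (AE t in lborel. t \<in> {0<..<T} \<longrightarrow> 0 \<le> D t)
   \<and> (AE t in lborel. t \<in> {0<..<T} \<longrightarrow> total_var (\<mu> t) (\<theta> t) \<le> Cm * D t)
   \<comment> \<open>(iv) momentum\<close>
   \<and> (\<forall>\<phi> :: real \<Rightarrow> real ^ 'd \<Rightarrow> real ^ 'd. test_fun T \<phi> \<longrightarrow>
        (LINT z : {0<..<T} \<times> cell | lborel.
            ypair \<nu> (fst z) (snd z) (\<lambda>y. fst y *\<^sub>R snd y) \<bullet> dT \<phi> (fst z) (snd z)
          + frob (ypair \<nu> (fst z) (snd z) (\<lambda>y. fst y *\<^sub>R tensor (snd y) (snd y)))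
                 (grad_mat \<phi> (fst z) (snd z))
          + ypair \<nu> (fst z) (snd z) (\<lambda>y. fst y powr \<gamma>) * divg \<phi> (fst z) (snd z))
        + (LINT t : {0<..<T} | lborel. mpair (\<mu> t) (\<theta> t) (grad_mat \<phi> t))
        = - (LINT x : cell | lborel. (\<rho>0 x *\<^sub>R u0 x) \<bullet> \<phi> 0 x))
   \<comment> \<open>(v) continuity\<close>
   \<and> (\<forall>\<psi> :: real \<Rightarrow> real ^ 'd \<Rightarrow> real. test_fun T \<psi> \<longrightarrow>
        (LINT z : {0<..<T} \<times> cell | lborel.
            ypair \<nu> (fst z) (snd z) fst * dT \<psi> (fst z) (snd z)
          + ypair \<nu> (fst z) (snd z) (\<lambda>y. fst y *\<^sub>R snd y) \<bullet> grad_s \<psi> (fst z) (snd z))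
        = - (LINT x : cell | lborel. \<rho>0 x * \<psi> 0 x))
   \<comment> \<open>(vi) energy inequality\<close>
   \<and> (AE t in lborel. t \<in> {0<..<T} \<longrightarrow>
        (LINT x : cell | lborel. 1/2 * ypair \<nu> t x (\<lambda>y. fst y * (norm (snd y))\<^sup>2)
                               + 1/(\<gamma> - 1) * ypair \<nu> t x (\<lambda>y. fst y powr \<gamma>)) + D t
        \<le> (LINT x : cell | lborel. 1/2 * \<rho>0 x * (norm (u0 x))\<^sup>2 + 1/(\<gamma> - 1) * \<rho>0 x powr \<gamma>))"

text \<open>Standing assumption "all integrals are assumed to exist": the moments of \<nu> are
  \<nu>_{t,x}-integrable for a.e. (t,x) and integrable in (t,x); the initial data and
  initial energy are integrable.\<close>

definition integrals_exist :: "real \<Rightarrow> real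
    \<Rightarrow> (real \<Rightarrow> real ^ 'd \<Rightarrow> (real \<times> (real ^ 'd)) measure)
    \<Rightarrow> (real ^ 'd \<Rightarrow> real) \<Rightarrow> (real ^ 'd \<Rightarrow> real ^ 'd) \<Rightarrow> bool" where
  "integrals_exist \<gamma> T \<nu> \<rho>0 u0 \<longleftrightarrow>
     (AE z in lborel. z \<in> {0<..<T} \<times> cell \<longrightarrow>
        integrable (\<nu> (fst z) (snd z)) fst
      \<and> integrable (\<nu> (fst z) (snd z)) (\<lambda>y. fst y *\<^sub>R snd y)
      \<and> integrable (\<nu> (fst z) (snd z)) (\<lambda>y. fst y *\<^sub>R tensor (snd y) (snd y))
      \<and> integrable (\<nu> (fst z) (snd z)) (\<lambda>y. fst y * (norm (snd y))\<^sup>2)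
      \<and> integrable (\<nu> (fst z) (snd z)) (\<lambda>y. fst y powr \<gamma>))
   \<and> set_integrable lborel ({0<..<T} \<times> cell) (\<lambda>z. ypair \<nu> (fst z) (snd z) fst)
   \<and> set_integrable lborel ({0<..<T} \<times> cell) (\<lambda>z. ypair \<nu> (fst z) (snd z) (\<lambda>y. fst y *\<^sub>R snd y))
   \<and> set_integrable lborel ({0<..<T} \<times> cell)
        (\<lambda>z. ypair \<nu> (fst z) (snd z) (\<lambda>y. fst y *\<^sub>R tensor (snd y) (snd y)))
   \<and> set_integrable lborel ({0<..<T} \<times> cell)
        (\<lambda>z. ypair \<nu> (fst z) (snd z) (\<lambda>y. fst y * (norm (snd y))\<^sup>2))
   \<and> set_integrable lborel ({0<..<T} \<times> cell) (\<lambda>z. ypair \<nu> (fst z) (snd z) (\<lambda>y. fst y powr \<gamma>))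
   \<and> (\<forall>x\<in>cell. 0 \<le> \<rho>0 x)
   \<and> set_integrable lborel cell \<rho>0
   \<and> set_integrable lborel cell (\<lambda>x. \<rho>0 x *\<^sub>R u0 x)
   \<and> set_integrable lborel cell (\<lambda>x. \<rho>0 x * (norm (u0 x))\<^sup>2)
   \<and> set_integrable lborel cell (\<lambda>x. \<rho>0 x powr \<gamma>)"

definition classical_solution :: "real \<Rightarrow> real \<Rightarrow> (real \<Rightarrow> real ^ 'd \<Rightarrow> real)
    \<Rightarrow> (real \<Rightarrow> real ^ 'd \<Rightarrow> real ^ 'd) \<Rightarrow> bool" where
  "classical_solution \<gamma> T r U \<longleftrightarrow>
     C1_on_torus T r \<and> C1_on_torus T U \<and> (\<forall>t x. 0 < r t x)
   \<and> (\<forall>t\<in>{0..T}. \<forall>x. \<forall>i.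
        dTw {0..T} (\<lambda>s y. r s y * U s y $ i) t x
      + (\<Sum>j\<in>UNIV. dX j (\<lambda>s y. r s y * U s y $ i * U s y $ j) t x)
      + dX i (\<lambda>s y. r s y powr \<gamma>) t x = 0)
   \<and> (\<forall>t\<in>{0..T}. \<forall>x.
        dTw {0..T} r t x + (\<Sum>j\<in>UNIV. dX j (\<lambda>s y. r s y * U s y $ j) t x) = 0)"

definition grad_sup :: "real \<Rightarrow> (real \<Rightarrow> real ^ 'd \<Rightarrow> real ^ 'd) \<Rightarrow> real" where
  "grad_sup T U = (SUP z\<in>{0..T} \<times> UNIV. norm (grad_mat U (fst z) (snd z)))"

definition rel_density :: "real \<Rightarrow> real \<Rightarrow> real ^ 'd \<Rightarrow> real \<Rightarrow> real ^ 'd \<Rightarrow> real" where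
  "rel_density \<gamma> \<rho> u r U = 1/2 * \<rho> * (norm (u - U))\<^sup>2 + 1/(\<gamma> - 1) * (\<rho> powr \<gamma> - r powr \<gamma>)
      - \<gamma>/(\<gamma> - 1) * r powr (\<gamma> - 1) * (\<rho> - r)"

definition E_rel :: "real \<Rightarrow> (real \<Rightarrow> real ^ 'd \<Rightarrow> (real \<times> (real ^ 'd)) measure) \<Rightarrow> (real \<Rightarrow> real)
    \<Rightarrow> (real \<Rightarrow> real ^ 'd \<Rightarrow> real) \<Rightarrow> (real \<Rightarrow> real ^ 'd \<Rightarrow> real ^ 'd) \<Rightarrow> real \<Rightarrow> real" where
  "E_rel \<gamma> \<nu> D r U t = (LINT x : cell | lborel.
       ypair \<nu> t x (\<lambda>y. rel_density \<gamma> (fst y) (snd y) (r t x) (U t x))) + D t"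

definition E_rel0 :: "real \<Rightarrow> (real ^ 'd \<Rightarrow> real) \<Rightarrow> (real ^ 'd \<Rightarrow> real ^ 'd)
    \<Rightarrow> (real \<Rightarrow> real ^ 'd \<Rightarrow> real) \<Rightarrow> (real \<Rightarrow> real ^ 'd \<Rightarrow> real ^ 'd) \<Rightarrow> real" where
  "E_rel0 \<gamma> \<rho>0 u0 r U = (LINT x : cell | lborel. rel_density \<gamma> (\<rho>0 x) (u0 x) (r 0 x) (U 0 x))"

end

theory Submission
  imports Defs "HOL-Computational_Algebra.Polynomial"
begin

text \<open>
  Expanding the relative energy gives the energy of the measure-valued solution, minus the momentum
  tested against \<open>U\<close>, plus the density tested against
  \<open>P = |U|\<^sup>2/2 - \<gamma>/(\<gamma>-1) r\<^bsup>\<gamma>-1\<^esup>\<close>, plus the integral of \<open>r\<^bsup>\<gamma>\<^esup>\<close>. The weak formulations,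
  extended from smooth to \<open>C\<^sup>1\<close> test functions by mollification and localized in time, express the
  two tested terms at almost every time through time integrals. With the equations for \<open>(r,U)\<close> the
  resulting rate becomes, up to the divergence of \<open>r\<^bsup>\<gamma>\<^esup> U\<close>, the sum of
  \<open>-\<rho> (u-U)\<otimes>(u-U) : \<nabla>U\<close>, of \<open>-div U\<close> times the relative pressure, and of the pairing of \<open>-\<nabla>U\<close> with
  the defect measure. All three are bounded by \<open>sup |\<nabla>U|\<close> times the relative energy, and Gronwall's
  lemma concludes.
\<close>

text \<open>The measure-valued solution is controlled at almost every time only, and
  \<open>U\<close> and \<open>P\<close> are merely C^1 on the closed time interval, with one-sided
  time derivatives at its ends. Hence the relative energy is never differentiated. Each tested
  quantity is shown to agree, outside a null set of times, with an indefinite integral, and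
  Gronwall's lemma is applied in integral form. The form of \<open>P\<close> is forced: it collects
  the coefficients of \<rho> in the relative energy density. The density then becomes affine in the
  moments of \<nu>; the mass and momentum terms obey exact balances, and only the energy is left to
  an inequality, which has the right sign. The defect does no harm because \<open>D\<close> is
  itself a part of the relative energy, so that condition (iii) turns the pairing with the gradient
  of \<open>U\<close> into a multiple of \<open>D\<close>. Every term of the final rate is linear in
  the gradient of \<open>U\<close>, while all other derivatives of \<open>r\<close> and
  \<open>U\<close> cancel or form a divergence. This is why only the supremum of that gradient
  appears in the exponent.\<close>

section \<open>Smooth bump functions\<close>

text \<open>Finite orders are used because the closure rules are proved by induction on the order.
  Smoothness is this property for every \<open>k\<close>.\<close>

primrec diff_k :: "nat \<Rightarrow> (real \<Rightarrow> real) \<Rightarrow> bool" where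
  "diff_k 0 f \<longleftrightarrow> True"
| "diff_k (Suc k) f \<longleftrightarrow> (\<forall>s. f field_differentiable (at s)) \<and> diff_k k (deriv f)"

lemma diff_kI:
  assumes "\<And>s. (f has_real_derivative f' s) (at s)" "diff_k k f'"
  shows "diff_k (Suc k) f"
proof -
  have "deriv f = f'" using assms(1) by (auto intro!: ext DERIV_imp_deriv)
  then show ?thesis using assms by (auto simp: field_differentiable_def)
qed

lemma diff_kD:
  assumes "diff_k (Suc k) f"
  shows "(f has_real_derivative deriv f s) (at s)" "diff_k k (deriv f)"
  using assms by (auto simp: field_differentiable_derivI)

lemma diff_k_Suc: "diff_k (Suc k) f \<Longrightarrow> diff_k k f"
proof (induction k arbitrary: f)
  case (Suc k)
  then show ?case by (metis diff_k.simps(2))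
qed simp

lemma diff_k_add: "diff_k k f \<Longrightarrow> diff_k k g \<Longrightarrow> diff_k k (\<lambda>s. f s + g s)"
proof (induction k arbitrary: f g)
  case (Suc k)
  show ?case
    by (rule diff_kI[of _ "\<lambda>s. deriv f s + deriv g s"])
      (auto intro!: DERIV_add diff_kD[OF Suc.prems(1)] diff_kD[OF Suc.prems(2)] Suc.IH)
qed simp

lemma diff_k_mult: "diff_k k f \<Longrightarrow> diff_k k g \<Longrightarrow> diff_k k (\<lambda>s. f s * g s)"
proof (induction k arbitrary: f g)
  case (Suc k)
  show ?case
  proof (rule diff_kI[of _ "\<lambda>s. deriv f s * g s + f s * deriv g s"])
    show "((\<lambda>s. f s * g s) has_real_derivative deriv f s * g s + f s * deriv g s) (at s)" for s
      by (rule derivative_eq_intros diff_kD[OF Suc.prems(1)] diff_kD[OF Suc.prems(2)])+ simp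
    show "diff_k k (\<lambda>s. deriv f s * g s + f s * deriv g s)"
      using Suc diff_kD(2) diff_k_Suc by (intro diff_k_add Suc.IH) blast+
  qed
qed simp

text \<open>The factor \<open>c\<close> is carried along so that the induction closes: each
  differentiation multiplies it by \<open>a\<close>.\<close>

lemma diff_k_affine: "diff_k k f \<Longrightarrow> diff_k k (\<lambda>s. c * f (a * s + b))"
proof (induction k arbitrary: f c)
  case (Suc k)
  show ?case
  proof (rule diff_kI[of _ "\<lambda>s. (c * a) * deriv f (a * s + b)"])
    show "((\<lambda>s. c * f (a * s + b)) has_real_derivative (c * a) * deriv f (a * s + b)) (at s)" for s
      by (rule derivative_eq_intros DERIV_chain2[OF diff_kD(1)[OF Suc.prems]] | simp)+
    show "diff_k k (\<lambda>s. (c * a) * deriv f (a * s + b))"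
      by (rule Suc.IH) (rule diff_kD[OF Suc.prems])
  qed
qed simp

text \<open>\<open>flat 1\<close> is the classical flat function exp(-1/s), extended by 0. The
  polynomial in 1/s makes the family closed under differentiation.\<close>

definition flat :: "real poly \<Rightarrow> real \<Rightarrow> real" where
  "flat p s = (if s > 0 then poly p (inverse s) * exp (- inverse s) else 0)"

lemma poly_exp_tendsto_0: "((\<lambda>x::real. poly p x * exp (- x)) \<longlongrightarrow> 0) at_top"
proof (induction p)
  case (pCons a p)
  have *: "((\<lambda>x::real. x * (poly p x * exp (- x))) \<longlongrightarrow> 0) at_top" 
  proof -
    have "((\<lambda>x::real. (\<Sum>i\<le>degree p. coeff p i * (x ^ (Suc i) / exp x))) \<longlongrightarrow> (\<Sum>i\<le>degree p. coeff p i * 0)) at_top"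
      by (intro tendsto_sum tendsto_mult tendsto_const tendsto_power_div_exp_0)
    then show ?thesis
      by (simp add: poly_altdef sum_distrib_left sum_distrib_right exp_minus field_simps)
  qed
  have "((\<lambda>x::real. a * (x ^ 0 / exp x) + x * (poly p x * exp (- x))) \<longlongrightarrow> a * 0 + 0) at_top"
    by (intro tendsto_add tendsto_mult tendsto_const tendsto_power_div_exp_0 *)
  then show ?case by (simp add: exp_minus field_simps)
qed simp

text \<open>This is the difference quotient of \<open>flat p\<close> at the junction point 0.
  Division by \<open>s\<close> only adds one more power of 1/s to the polynomial, and the
  exponential beats every polynomial.\<close>

lemma flat_div_tendsto_0: "((\<lambda>s. flat p s / s) \<longlongrightarrow> 0) (at 0)"
proof -
  have "((\<lambda>s. poly (pCons 0 p) (inverse s) * exp (- inverse s)) \<longlongrightarrow> 0) (at_right (0::real))"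
    by (rule filterlim_compose[OF poly_exp_tendsto_0 filterlim_inverse_at_top_right])
  then have "((\<lambda>s. flat p s / s) \<longlongrightarrow> 0) (at_right 0)"
    by (rule Lim_transform_eventually)
      (auto simp: flat_def eventually_at_filter field_simps intro!: always_eventually)
  moreover have "((\<lambda>s. flat p s / s) \<longlongrightarrow> 0) (at_left 0)"
    by (rule Lim_transform_eventually[OF tendsto_const])
      (auto simp: flat_def eventually_at_filter intro!: always_eventually)
  ultimately show ?thesis by (simp add: filterlim_split_at)
qed

text \<open>The inner derivative -1/s^2 produces the two leading zero coefficients; the product rule
  gives \<open>p\<close> from the exponential and \<open>- pderiv p\<close> from the polynomial. At
  0 the claim is \<open>flat_div_tendsto_0\<close>.\<close>

lemma flat_deriv:
  "(flat p has_real_derivative flat (pCons 0 (pCons 0 (p - pderiv p))) s) (at s)"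
proof -
  let ?q = "pCons 0 (pCons 0 (p - pderiv p))"
  consider "s > 0" | "s < 0" | "s = 0" by linarith
  then show ?thesis
  proof cases
    case 1
    have "((\<lambda>s. poly p (inverse s) * exp (- inverse s)) has_real_derivative flat ?q s) (at s)"
      using 1 by (auto intro!: derivative_eq_intros DERIV_chain2[OF poly_DERIV]
          simp: flat_def power2_eq_square algebra_simps)
    then show ?thesis
      by (rule has_field_derivative_transform_within_open[of _ _ _ "{0<..}"])
        (use 1 in \<open>auto simp: flat_def\<close>)
  next
    case 2
    have "((\<lambda>s. 0) has_real_derivative flat ?q s) (at s)"
      using 2 by (auto simp: flat_def)
    then show ?thesis
      by (rule has_field_derivative_transform_within_open[of _ _ _ "{..<0}"])
        (use 2 in \<open>auto simp: flat_def\<close>)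
  next
    case 3
    then show ?thesis
      using flat_div_tendsto_0[of p] by (simp add: DERIV_def flat_def)
  qed
qed

lemma diff_k_flat: "diff_k k (flat p)"
  by (induction k arbitrary: p) (auto intro!: diff_kI flat_deriv simp del: diff_k.simps(2))

text \<open>All derivatives are returned as one sequence, so that mixed derivatives of product
  kernels can be named by indices. The support lies on the negative side because the kernel is later
  evaluated at \<open>- w\<close> with nonnegative coordinates of \<open>w\<close>.\<close>

lemma smooth_bump_exists:
  assumes "0 < \<epsilon>"
  obtains b :: "nat \<Rightarrow> real \<Rightarrow> real"
  where "\<And>n s. (b n has_real_derivative b (Suc n) s) (at s)"
    "\<And>n s. s \<notin> {-\<epsilon>..0} \<Longrightarrow> b n s = 0"
    "\<And>s. 0 \<le> b 0 s" "b 0 (-\<epsilon>/2) > 0"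
proof
  define f where "f s = flat 1 (s + \<epsilon>) * flat 1 (- s)" for s
  define b where "b n = (deriv ^^ n) f" for n
  have "diff_k k f" for k
    unfolding f_def
    using diff_k_mult[OF diff_k_affine[OF diff_k_flat, of k 1 1 1 \<epsilon>] diff_k_affine[OF diff_k_flat, of k 1 1 "-1" 0]]
    by simp
  then have k: "diff_k k (b n)" for k n
    by (induction n arbitrary: k) (auto simp: b_def dest: diff_kD(2))
  show der: "(b n has_real_derivative b (Suc n) s) (at s)" for n s
    using diff_kD(1)[OF k[of "Suc 0" n]] by (simp add: b_def)
  show "b n s = 0" if "s \<notin> {-\<epsilon>..0}" for n s
    using that
  proof (induction n arbitrary: s)
    case 0
    then show ?case by (auto simp: b_def f_def flat_def)
  next
    case (Suc n)
    \<comment> \<open>The complement of the closed interval is open, so vanishing there passes on to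
      the derivative.\<close>
    have "(b n has_real_derivative 0) (at s)"
      by (rule has_field_derivative_transform_within_open[of "\<lambda>_. 0" _ _ "- {-\<epsilon>..0}"])
        (use Suc in auto)
    then show ?case using der DERIV_unique by blast
  qed
  show "0 \<le> b 0 s" for s by (simp add: b_def f_def flat_def)
  show "b 0 (-\<epsilon>/2) > 0" using assms by (simp add: b_def f_def flat_def)
qed

section \<open>Mollification\<close>

text \<open>For \<open>\<kappa>\<close> supported in \<open>- cbox 0 e\<close> this is the convolution of \<open>\<kappa>\<close> and \<open>G\<close>. It only uses
  values of \<open>G\<close> at points \<open>p + w\<close> with \<open>w \<ge> 0\<close>, that is at later times, so a function given on
  \<open>t \<ge> 0\<close> needs no differentiable extension to \<open>t < 0\<close>.\<close>

definition moll :: "'n::euclidean_space \<Rightarrow> ('n \<Rightarrow> real) \<Rightarrow> ('n \<Rightarrow> 'b::banach) \<Rightarrow> 'n \<Rightarrow> 'b" where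
  "moll e \<kappa> G p = integral (cbox 0 e) (\<lambda>w. \<kappa> (- w) *\<^sub>R G (p + w))"

text \<open>The substitution moves the point \<open>p\<close> from \<open>G\<close> into the kernel.
  By the support condition any larger box may serve as domain, so that one box works for all nearby
  \<open>p\<close>, as differentiation under the integral sign requires.\<close>

lemma moll_eq_convolution:
  fixes \<kappa> :: "'n::euclidean_space \<Rightarrow> real" and G :: "'n \<Rightarrow> 'b::banach"
  assumes \<kappa>: "continuous_on UNIV \<kappa>" and G: "continuous_on UNIV G"
    and supp: "\<And>w. w \<notin> cbox 0 e \<Longrightarrow> \<kappa> (- w) = 0"
    and sub: "cbox p (p + e) \<subseteq> cbox c d"
  shows "moll e \<kappa> G p = integral (cbox c d) (\<lambda>z. \<kappa> (p - z) *\<^sub>R G z)"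
proof -
  let ?f = "\<lambda>z. \<kappa> (p - z) *\<^sub>R G z"
  have "continuous_on (cbox p (p + e)) ?f"
    by (intro continuous_intros continuous_on_compose2[OF \<kappa>] continuous_on_subset[OF G]) auto
  then have "(?f has_integral integral (cbox p (p + e)) ?f) (cbox p (p + e))"
    by (intro integrable_integral integrable_continuous)
  moreover have "?f z = 0" if "z \<notin> cbox p (p + e)" for z
  proof -
    have "z - p \<notin> cbox 0 e" using that by (auto simp: mem_box algebra_simps)
    from supp[OF this] show ?thesis by simp
  qed
  ultimately have "(?f has_integral integral (cbox p (p + e)) ?f) (cbox c d)"
    using sub by (rule has_integral_on_superset)
  then have "integral (cbox c d) ?f = integral (cbox p (p + e)) ?f"
    by (rule integral_unique)
  also have "\<dots> = integral (cbox (p - p) (p + e - p)) (\<lambda>w. ?f (w + p))"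
    by (rule integral_shift_cbox[symmetric])
  finally show ?thesis by (simp add: moll_def add.commute)
qed

lemma moll_continuous:
  assumes \<kappa>: "continuous_on UNIV \<kappa>" and G: "continuous_on UNIV G"
  shows "continuous_on UNIV (moll e \<kappa> G)"
  unfolding moll_def
  by (rule integral_continuous_on_param)
    (auto simp: case_prod_beta intro!: continuous_intros continuous_on_compose2[OF \<kappa>] continuous_on_compose2[OF G])

text \<open>The derivative falls entirely on the kernel, which is how a merely continuous
  \<open>G\<close> becomes smooth.\<close>

lemma moll_deriv_kernel:
  fixes \<kappa> :: "'n::euclidean_space \<Rightarrow> real" and G :: "'n \<Rightarrow> 'b::banach"
  assumes \<kappa>: "continuous_on UNIV \<kappa>" and \<kappa>': "continuous_on UNIV \<kappa>'" and G: "continuous_on UNIV G"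
    and supp: "\<And>w. w \<notin> cbox 0 e \<Longrightarrow> \<kappa> (- w) = 0" "\<And>w. w \<notin> cbox 0 e \<Longrightarrow> \<kappa>' (- w) = 0"
    and der: "\<And>w h. ((\<lambda>h. \<kappa> (w + h *\<^sub>R v)) has_real_derivative \<kappa>' (w + h *\<^sub>R v)) (at h)"
  shows "((\<lambda>h. moll e \<kappa> G (p + h *\<^sub>R v)) has_vector_derivative moll e \<kappa>' G p) (at 0)"
proof -
  let ?U = "{-1<..<1::real}"
  \<comment> \<open>One symmetric box contains all translated supports for |h| \<le> 1.\<close>
  have "compact ((\<lambda>q. p + fst q *\<^sub>R v + snd q) ` ({-1..1::real} \<times> cbox 0 e))"
    by (intro compact_continuous_image compact_Times compact_cbox compact_Icc continuous_intros)
  then obtain a where a: "(\<lambda>q. p + fst q *\<^sub>R v + snd q) ` ({-1..1::real} \<times> cbox 0 e) \<subseteq> cbox (-a) a"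
    by (metis compact_imp_bounded bounded_subset_cbox_symmetric)
  have sub: "cbox (p + h *\<^sub>R v) (p + h *\<^sub>R v + e) \<subseteq> cbox (-a) a" if "h \<in> ?U" for h
  proof
    fix z assume "z \<in> cbox (p + h *\<^sub>R v) (p + h *\<^sub>R v + e)"
    then have "z - (p + h *\<^sub>R v) \<in> cbox 0 e" by (auto simp: mem_box algebra_simps)
    then have "(h, z - (p + h *\<^sub>R v)) \<in> {-1..1} \<times> cbox 0 e" using that by simp
    from imageI[OF this, of "\<lambda>q. p + fst q *\<^sub>R v + snd q"] a
    show "z \<in> cbox (-a) a" by auto
  qed
  have eq: "moll e k G (p + h *\<^sub>R v) = integral (cbox (-a) a) (\<lambda>z. k (p + h *\<^sub>R v - z) *\<^sub>R G z)"
    if "h \<in> ?U" "k = \<kappa> \<or> k = \<kappa>'" for h k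
    using that sub by (intro moll_eq_convolution) (auto simp: \<kappa> \<kappa>' G supp)
  have D: "((\<lambda>h. integral (cbox (-a) a) (\<lambda>z. \<kappa> (p + h *\<^sub>R v - z) *\<^sub>R G z)) has_vector_derivative
      integral (cbox (-a) a) (\<lambda>z. \<kappa>' (p + 0 *\<^sub>R v - z) *\<^sub>R G z)) (at 0 within ?U)"
  proof (rule leibniz_rule_vector_derivative[where f = "\<lambda>h z. \<kappa> (p + h *\<^sub>R v - z) *\<^sub>R G z"
        and fx = "\<lambda>h z. \<kappa>' (p + h *\<^sub>R v - z) *\<^sub>R G z"])
    show "((\<lambda>h. \<kappa> (p + h *\<^sub>R v - z) *\<^sub>R G z) has_vector_derivative \<kappa>' (p + h *\<^sub>R v - z) *\<^sub>R G z)
        (at h within ?U)" for h z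
    proof -
      have "((\<lambda>h. \<kappa> (p - z + h *\<^sub>R v)) has_real_derivative \<kappa>' (p - z + h *\<^sub>R v)) (at h within ?U)"
        using der by (rule has_field_derivative_at_within)
      from has_vector_derivative_scaleR[OF this has_vector_derivative_const[of "G z"]]
      show ?thesis by (simp add: algebra_simps)
    qed
    show "(\<lambda>z. \<kappa> (p + h *\<^sub>R v - z) *\<^sub>R G z) integrable_on cbox (-a) a" for h
      by (intro integrable_continuous continuous_intros continuous_on_compose2[OF \<kappa>] continuous_on_subset[OF G]) auto
    show "continuous_on (?U \<times> cbox (-a) a) (\<lambda>(h, z). \<kappa>' (p + h *\<^sub>R v - z) *\<^sub>R G z)"
      by (auto simp: case_prod_beta intro!: continuous_intros continuous_on_compose2[OF \<kappa>'] continuous_on_compose2[OF G])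
  qed auto
  have "((\<lambda>h. moll e \<kappa> G (p + h *\<^sub>R v)) has_vector_derivative moll e \<kappa>' G p) (at 0 within ?U)"
    using D eq[of 0 \<kappa>']
    by (auto simp: eq[of _ \<kappa>] intro: has_vector_derivative_transform[rotated 2])
  then show ?thesis
    using at_within_open[of "0::real" ?U] by simp
qed

text \<open>Counterpart of \<open>moll_deriv_kernel\<close> with the derivative on \<open>G\<close>,
  which makes derivatives of mollifications converge to derivatives of \<open>G\<close>.
  Differentiability is asked only at shifts by points of the box; in the time direction at t > 0,
  with |h| < t, these involve positive times only.\<close>

lemma moll_deriv_fun:
  fixes \<kappa> :: "'n::euclidean_space \<Rightarrow> real" and G :: "'n \<Rightarrow> 'b::banach"
  assumes \<kappa>: "continuous_on UNIV \<kappa>" and G: "continuous_on UNIV G" and G': "continuous_on UNIV G'"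
    and "0 < \<delta>"
    and der: "\<And>w h. w \<in> cbox 0 e \<Longrightarrow> \<bar>h\<bar> < \<delta> \<Longrightarrow>
      ((\<lambda>h. G (p + h *\<^sub>R v + w)) has_vector_derivative G' (p + h *\<^sub>R v + w)) (at h)"
  shows "((\<lambda>h. moll e \<kappa> G (p + h *\<^sub>R v)) has_vector_derivative moll e \<kappa> G' p) (at 0)"
proof -
  let ?U = "{-\<delta><..<\<delta>}"
  have "((\<lambda>h. moll e \<kappa> G (p + h *\<^sub>R v)) has_vector_derivative moll e \<kappa> G' (p + 0 *\<^sub>R v)) (at 0 within ?U)"
    unfolding moll_def
  proof (rule leibniz_rule_vector_derivative[where f = "\<lambda>h w. \<kappa> (- w) *\<^sub>R G (p + h *\<^sub>R v + w)"
        and fx = "\<lambda>h w. \<kappa> (- w) *\<^sub>R G' (p + h *\<^sub>R v + w)"])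
    show "((\<lambda>h. \<kappa> (- w) *\<^sub>R G (p + h *\<^sub>R v + w)) has_vector_derivative \<kappa> (- w) *\<^sub>R G' (p + h *\<^sub>R v + w))
        (at h within ?U)" if "h \<in> ?U" "w \<in> cbox 0 e" for h w
      using has_vector_derivative_scaleR[OF DERIV_const[of "\<kappa> (- w)"]
          has_vector_derivative_at_within[OF der[of w h]]] that
      by auto
    show "(\<lambda>w. \<kappa> (- w) *\<^sub>R G (p + h *\<^sub>R v + w)) integrable_on cbox 0 e" for h
      by (intro integrable_continuous continuous_intros continuous_on_compose2[OF \<kappa>] continuous_on_compose2[OF G]) auto
    show "continuous_on (?U \<times> cbox 0 e) (\<lambda>(h, w). \<kappa> (- w) *\<^sub>R G' (p + h *\<^sub>R v + w))"
      by (auto simp: case_prod_beta intro!: continuous_intros continuous_on_compose2[OF \<kappa>] continuous_on_compose2[OF G'])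
  qed (use \<open>0 < \<delta>\<close> in auto)
  then show ?thesis
    using at_within_open[of "0::real" ?U] \<open>0 < \<delta>\<close> by simp
qed

text \<open>\<open>moll\<close> is here an average of total weight 1. The case
  \<open>y = F p\<close> gives convergence, the case \<open>y = 0\<close> gives uniform
  bounds.\<close>

lemma moll_average:
  fixes F :: "'n::euclidean_space \<Rightarrow> 'b::banach"
  assumes \<kappa>: "continuous_on UNIV \<kappa>" "\<And>w. 0 \<le> \<kappa> w" "integral (cbox 0 e) (\<lambda>w. \<kappa> (- w)) = 1"
    and F: "continuous_on UNIV F"
    and near: "\<And>w. w \<in> cbox 0 e \<Longrightarrow> norm (F (p + w) - y) \<le> \<eta>"
  shows "norm (moll e \<kappa> F p - y) \<le> \<eta>"
proof -
  have i1: "(\<lambda>w. \<kappa> (- w)) integrable_on cbox 0 e"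
    by (intro integrable_continuous continuous_on_compose2[OF \<kappa>(1)] continuous_intros) auto
  have i2: "(\<lambda>w. \<kappa> (- w) *\<^sub>R F (p + w)) integrable_on cbox 0 e"
    by (intro integrable_continuous continuous_intros continuous_on_compose2[OF \<kappa>(1)] continuous_on_compose2[OF F]) auto
  have k: "((\<lambda>w. \<kappa> (- w)) has_integral 1) (cbox 0 e)"
    using i1 \<kappa>(3) by (metis integrable_integral)
  have c: "((\<lambda>w. \<kappa> (- w) *\<^sub>R y) has_integral 1 *\<^sub>R y) (cbox 0 e)"
    by (rule has_integral_scaleR_left[OF k])
  have i3: "(\<lambda>w. \<kappa> (- w) *\<^sub>R (F (p + w) - y)) integrable_on cbox 0 e"
    using integrable_diff[OF i2 has_integral_integrable[OF c]] by (simp add: scaleR_diff_right)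
  have "moll e \<kappa> F p - y = integral (cbox 0 e) (\<lambda>w. \<kappa> (- w) *\<^sub>R (F (p + w) - y))"
    using integral_diff[OF i2 has_integral_integrable[OF c]] integral_unique[OF c]
    by (simp add: moll_def scaleR_diff_right)
  also have "norm \<dots> \<le> integral (cbox 0 e) (\<lambda>w. \<kappa> (- w) * \<eta>)"
    by (intro integral_norm_bound_integral i3 integrable_on_mult_left i1)
      (use near \<kappa>(2) in \<open>auto intro!: mult_left_mono\<close>)
  also have "\<dots> = \<eta>" using \<kappa>(3) by simp
  finally show ?thesis .
qed

text \<open>Time and space coordinates are treated uniformly: coordinate \<open>None\<close> is time.\<close>

definition crd :: "real \<times> (real ^ 'd) \<Rightarrow> 'd option \<Rightarrow> real" where
  "crd w i = (case i of None \<Rightarrow> fst w | Some j \<Rightarrow> snd w $ j)"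

definition dir :: "'d option \<Rightarrow> real \<times> (real ^ 'd)" where
  "dir i = (case i of None \<Rightarrow> (1, 0) | Some j \<Rightarrow> (0, axis j 1))"

text \<open>When \<open>b n\<close> is the n-th derivative of \<open>b 0\<close>, this is the
  partial derivative with multi-index \<open>\<alpha>\<close> of a product kernel, so all
  derivatives stay within one family.\<close>

definition mker :: "(nat \<Rightarrow> real \<Rightarrow> real) \<Rightarrow> ('d option \<Rightarrow> nat) \<Rightarrow> real \<times> (real ^ 'd) \<Rightarrow> real" where
  "mker b \<alpha> w = (\<Prod>i\<in>UNIV. b (\<alpha> i) (crd w i))"

lemma crd_dir: "crd (w + h *\<^sub>R dir i) k = crd w k + (if k = i then h else 0)"
  by (cases k; cases i) (simp_all add: crd_def dir_def axis_def)

lemma crd_uminus: "crd (- w) i = - crd w i"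
  by (cases i) (simp_all add: crd_def)

lemma mem_cbox_crd: "w \<in> cbox 0 (\<epsilon>, \<chi> j. \<epsilon>) \<longleftrightarrow> (\<forall>i. 0 \<le> crd w i \<and> crd w i \<le> \<epsilon>)"
proof -
  obtain s y where w: "w = (s, y)" by (cases w)
  have "w \<in> cbox 0 (\<epsilon>, \<chi> j. \<epsilon>) \<longleftrightarrow> s \<in> cbox 0 \<epsilon> \<and> y \<in> cbox 0 (\<chi> j. \<epsilon>)"
    unfolding w zero_prod_def cbox_Pair_iff ..
  also have "\<dots> \<longleftrightarrow> (0 \<le> crd w None \<and> crd w None \<le> \<epsilon>) \<and> (\<forall>j. 0 \<le> crd w (Some j) \<and> crd w (Some j) \<le> \<epsilon>)"
    by (simp add: w crd_def mem_box_cart)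
  also have "\<dots> \<longleftrightarrow> (\<forall>i. 0 \<le> crd w i \<and> crd w i \<le> \<epsilon>)"
    by (metis not_None_eq)
  finally show ?thesis .
qed

lemma continuous_crd: "continuous_on S (\<lambda>w. crd w i)"
  by (cases i) (auto simp: crd_def intro!: continuous_intros)

lemma mker_deriv:
  fixes w :: "real \<times> (real ^ 'd)"
  assumes "\<And>n s. (b n has_real_derivative b (Suc n) s) (at s)"
  shows "((\<lambda>h. mker b \<alpha> (w + h *\<^sub>R dir i)) has_real_derivative
    mker b (\<alpha>(i := Suc (\<alpha> i))) (w + h *\<^sub>R dir i)) (at h)"
proof -
  let ?R = "\<Prod>k\<in>UNIV-{i}. b (\<alpha> k) (crd w k)"
  have 1: "mker b \<beta> (w + h *\<^sub>R dir i) = b (\<beta> i) (crd w i + h) * ?R"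
    if "\<And>k. k \<noteq> i \<Longrightarrow> \<beta> k = \<alpha> k" for h \<beta>
    unfolding mker_def using that
    by (subst prod.remove[of UNIV i]) (auto simp: crd_dir intro!: prod.cong)
  have "((\<lambda>h. b (\<alpha> i) (crd w i + h) * ?R) has_real_derivative b (Suc (\<alpha> i)) (crd w i + h) * ?R) (at h)"
    by (rule derivative_eq_intros DERIV_chain2[OF assms] | simp)+
  then show ?thesis by (simp add: 1)
qed

lemma mker_continuous:
  assumes "\<And>n s. (b n has_real_derivative b (Suc n) s) (at s)"
  shows "continuous_on UNIV (mker b \<alpha> :: real \<times> (real ^ 'd) \<Rightarrow> real)"
proof -
  have "continuous_on UNIV (b n)" for n
    using assms by (intro DERIV_continuous_on) (auto intro: has_field_derivative_at_within)
  from continuous_on_compose2[OF this] show ?thesis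
    unfolding mker_def by (intro continuous_on_prod continuous_crd) (auto intro: continuous_crd)
qed

lemma mker_support:
  assumes "\<And>n s. s \<notin> {-\<epsilon>..0} \<Longrightarrow> b n s = 0" "w \<notin> cbox 0 (\<epsilon>, \<chi> j. \<epsilon>)"
  shows "mker b \<alpha> (- w) = 0"
proof -
  obtain i where "\<not> (0 \<le> crd w i \<and> crd w i \<le> \<epsilon>)" using assms(2) mem_cbox_crd by blast
  then have "b (\<alpha> i) (crd (- w) i) = 0" by (intro assms(1)) (auto simp: crd_uminus)
  then show ?thesis unfolding mker_def by (intro prod_zero) auto
qed

lemma has_vector_derivative_at_0_shift:
  "((\<lambda>h. f (a + h)) has_vector_derivative D) (at 0) \<longleftrightarrow> (f has_vector_derivative D) (at (a::real))"
proof
  assume "((\<lambda>h. f (a + h)) has_vector_derivative D) (at 0)"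
  moreover have "((\<lambda>s. s - a) has_vector_derivative 1) (at a)"
    by (auto intro!: derivative_eq_intros)
  ultimately show "(f has_vector_derivative D) (at a)"
    using vector_diff_chain_at[of "\<lambda>s. s - a" 1 a "\<lambda>h. f (a + h)" D] by (simp add: o_def)
next
  assume "(f has_vector_derivative D) (at a)"
  moreover have "((\<lambda>h. a + h) has_vector_derivative 1) (at 0)"
    by (auto intro!: derivative_eq_intros)
  ultimately show "((\<lambda>h. f (a + h)) has_vector_derivative D) (at 0)"
    using vector_diff_chain_at[of "\<lambda>h. a + h" 1 0 f D] by (simp add: o_def)
qed

text \<open>A derivative in coordinate \<open>i\<close> raises \<open>\<alpha> i\<close> by one;
  generalising over \<open>\<alpha>\<close> therefore closes the induction on the order.\<close>

lemma Ck_moll: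
  fixes G :: "real \<times> (real ^ 'd) \<Rightarrow> 'b::banach"
  assumes b: "\<And>n s. (b n has_real_derivative b (Suc n) s) (at s)" "\<And>n s. s \<notin> {-\<epsilon>..0} \<Longrightarrow> b n s = 0"
    and G: "continuous_on UNIV G"
  shows "Ck k (\<lambda>t x. moll (\<epsilon>, \<chi> j. \<epsilon>) (mker b \<alpha>) G (t, x))"
proof (induction k arbitrary: \<alpha>)
  case 0
  show ?case by (simp add: moll_continuous mker_continuous[of b, OF b(1)] G)
next
  case (Suc k)
  let ?M = "\<lambda>\<alpha> t x. moll (\<epsilon>, \<chi> j. \<epsilon>) (mker b \<alpha>) G (t, x)"
  have D: "((\<lambda>h. moll (\<epsilon>, \<chi> j. \<epsilon>) (mker b \<alpha>) G (p + h *\<^sub>R dir i)) has_vector_derivative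
      moll (\<epsilon>, \<chi> j. \<epsilon>) (mker b (\<alpha>(i := Suc (\<alpha> i)))) G p) (at 0)" for p i
    by (intro moll_deriv_kernel mker_continuous[of b, OF b(1)] mker_support[of \<epsilon> b, OF b(2)] G mker_deriv[of b, OF b(1)])
  have DT: "((\<lambda>s. ?M \<alpha> s x) has_vector_derivative ?M (\<alpha>(None := Suc (\<alpha> None))) t x) (at t)" for t x
    using D[of "(t, x)" None] has_vector_derivative_at_0_shift[of "\<lambda>s. ?M \<alpha> s x"] by (simp add: dir_def)
  have DX: "((\<lambda>h. ?M \<alpha> t (x + h *\<^sub>R axis j 1)) has_vector_derivative ?M (\<alpha>(Some j := Suc (\<alpha> (Some j)))) t x) (at 0)" for t x j
    using D[of "(t, x)" "Some j"] by (simp add: dir_def)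
  have "dT (?M \<alpha>) = ?M (\<alpha>(None := Suc (\<alpha> None)))"
    unfolding dT_def by (intro ext vector_derivative_at DT)
  moreover have "dX j (?M \<alpha>) = ?M (\<alpha>(Some j := Suc (\<alpha> (Some j))))" for j
    unfolding dX_def by (intro ext vector_derivative_at DX)
  ultimately show ?case
    using differentiableI_vector[OF DT] differentiableI_vector[OF DX] Suc.IH
    by (simp add: moll_continuous mker_continuous[of b, OF b(1)] G del: fun_upd_apply)
qed

lemma mollifier_exists:
  assumes "0 < \<epsilon>"
  obtains b :: "nat \<Rightarrow> real \<Rightarrow> real"
  where "\<And>n s. (b n has_real_derivative b (Suc n) s) (at s)"
    "\<And>n s. s \<notin> {-\<epsilon>..0} \<Longrightarrow> b n s = 0"
    "\<And>w. 0 \<le> mker b (\<lambda>_. 0) (w :: real \<times> (real ^ 'd))"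
    "integral (cbox 0 (\<epsilon>, \<chi> j. \<epsilon>)) (\<lambda>w. mker b (\<lambda>_. 0) (- w :: real \<times> (real ^ 'd))) = 1"
proof -
  obtain b where b: "\<And>n s. (b n has_real_derivative b (Suc n) s) (at s)"
    "\<And>n s. s \<notin> {-\<epsilon>..0} \<Longrightarrow> b n s = 0" "\<And>s. 0 \<le> b 0 s" "b 0 (-\<epsilon>/2) > 0"
    using smooth_bump_exists[OF assms] by metis
  let ?e = "(\<epsilon>, \<chi> j. \<epsilon>) :: real \<times> (real ^ 'd)"
  let ?f = "\<lambda>w. mker b (\<lambda>_. 0) (- w :: real \<times> (real ^ 'd))"
  define N where "N = integral (cbox 0 ?e) ?f"
  have cont: "continuous_on (cbox 0 ?e) ?f"
    by (intro continuous_on_compose2[OF mker_continuous[of b, OF b(1)]] continuous_intros) auto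
  have nn: "0 \<le> mker b (\<lambda>_. 0) (w :: real \<times> (real ^ 'd))" for w
    unfolding mker_def by (intro prod_nonneg) (simp add: b(3))
  have crd2: "crd (- ((1/2::real) *\<^sub>R ?e)) i = - \<epsilon> / 2" for i
    by (cases i) (simp_all add: crd_def)
  have crd2': "crd ((1/2::real) *\<^sub>R ?e) i = \<epsilon> / 2" for i
    by (cases i) (simp_all add: crd_def)
  have mid: "(1/2::real) *\<^sub>R ?e \<in> cbox 0 ?e"
    using assms unfolding mem_cbox_crd by (auto simp only: crd2') 
  have pos: "?f ((1/2::real) *\<^sub>R ?e) > 0"
    unfolding mker_def by (intro prod_pos) (simp only: crd2 b(4))
  have "box (0::real \<times> (real ^ 'd)) ?e \<noteq> {}"
  proof -
    have "(1/2::real) *\<^sub>R ?e \<in> box 0 ?e"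
      using assms unfolding mem_box by (auto simp: Basis_prod_def Basis_vec_def inner_axis)
    then show ?thesis by auto
  qed
  \<comment> \<open>A continuous nonnegative integrand that is positive at the midpoint of the box
    cannot have integral 0.\<close>
  then have "N \<noteq> 0"
    unfolding N_def using integral_cbox_eq_0_iff[OF cont] nn mid pos
    by (metis less_irrefl)
  moreover have "0 \<le> N"
    unfolding N_def by (intro integral_nonneg integrable_continuous cont) (simp add: nn)
  ultimately have N: "0 < N" by simp
  define m where "m = CARD('d option)"
  \<comment> \<open>Each of the \<open>m\<close> factors of the kernel (all space coordinates and
    time) receives the factor \<open>c\<close>, so the integral is multiplied by the m-th power of
    \<open>c\<close>.\<close>
  define c where "c = root m (1 / N)"
  have m: "m > 0" by (simp add: m_def)
  have c: "c ^ m * N = 1" "0 \<le> c"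
    using N m by (auto simp: c_def)
  have scale: "mker (\<lambda>n s. c * b n s) \<alpha> w = c ^ m * mker b \<alpha> w" for \<alpha> and w :: "real \<times> (real ^ 'd)"
    by (simp add: mker_def prod.distrib m_def)
  show thesis
  proof
    show "((\<lambda>s. c * b n s) has_real_derivative c * b (Suc n) s) (at s)" for n s
      by (rule DERIV_cmult[OF b(1)])
    show "c * b n s = 0" if "s \<notin> {-\<epsilon>..0}" for n s using b(2)[OF that] by simp
    show "0 \<le> mker (\<lambda>n s. c * b n s) (\<lambda>_. 0) (w :: real \<times> (real ^ 'd))" for w
      unfolding scale using nn c by simp
    show "integral (cbox 0 ?e) (\<lambda>w. mker (\<lambda>n s. c * b n s) (\<lambda>_. 0) (- w :: real \<times> (real ^ 'd))) = 1"
      unfolding scale using c N_def by simp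
  qed
qed

section \<open>Approximation of periodic C^1 functions by smooth test functions\<close>

lemma cell_subset_cbox: "cell \<subseteq> cbox (0::real ^ 'd) (\<chi> j. 1)"
  by (auto simp: cell_def mem_box_cart less_imp_le)

text \<open>Mollification commutes with differentiation and averages over later times only. Hence
  vanishing from T - \<delta> on is inherited, and time derivatives are compared at positive times,
  where \<open>g\<close> is differentiable. The common bound \<open>B\<close> is what dominated
  convergence will use.\<close>

lemma C1_smooth_approximation:
  fixes g gt :: "real \<Rightarrow> real ^ 'd \<Rightarrow> 'b::euclidean_space" and gx :: "'d \<Rightarrow> real \<Rightarrow> real ^ 'd \<Rightarrow> 'b"
  assumes per: "periodic_x g"
    and cont: "continuous_on UNIV (\<lambda>z. g (fst z) (snd z))" "continuous_on UNIV (\<lambda>z. gt (fst z) (snd z))"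
      "\<And>j. continuous_on UNIV (\<lambda>z. gx j (fst z) (snd z))"
    and gt: "\<And>t x. 0 < t \<Longrightarrow> ((\<lambda>s. g s x) has_vector_derivative gt t x) (at t)"
    and gx: "\<And>t x j. ((\<lambda>h. g t (x + h *\<^sub>R axis j 1)) has_vector_derivative gx j t x) (at 0)"
    and van: "0 < \<delta>" "\<And>t x. T - \<delta> \<le> t \<Longrightarrow> g t x = 0"
  obtains \<phi> :: "nat \<Rightarrow> real \<Rightarrow> real ^ 'd \<Rightarrow> 'b" and B
  where "\<And>n. test_fun T (\<phi> n)"
    "\<And>t x. (\<lambda>n. \<phi> n t x) \<longlonglongrightarrow> g t x"
    "\<And>t x. 0 < t \<Longrightarrow> (\<lambda>n. dT (\<phi> n) t x) \<longlonglongrightarrow> gt t x"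
    "\<And>t x j. (\<lambda>n. dX j (\<phi> n) t x) \<longlonglongrightarrow> gx j t x"
    "\<And>n t x. t \<in> {0..T} \<Longrightarrow> x \<in> cell \<Longrightarrow> norm (\<phi> n t x) \<le> B"
    "\<And>n t x. t \<in> {0<..T} \<Longrightarrow> x \<in> cell \<Longrightarrow> norm (dT (\<phi> n) t x) \<le> B"
    "\<And>n t x j. t \<in> {0..T} \<Longrightarrow> x \<in> cell \<Longrightarrow> norm (dX j (\<phi> n) t x) \<le> B"
proof -
  define \<epsilon> where "\<epsilon> n = 1 / real (Suc n)" for n
  have \<epsilon>: "0 < \<epsilon> n" "\<epsilon> n \<le> 1" for n by (auto simp: \<epsilon>_def)
  have "\<exists>b. (\<forall>m s. (b m has_real_derivative b (Suc m) s) (at s)) \<and> (\<forall>m s. s \<notin> {-\<epsilon> n..0} \<longrightarrow> b m s = 0)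
    \<and> (\<forall>w. 0 \<le> mker b (\<lambda>_. 0) (w :: real \<times> (real ^ 'd))) \<and>
    integral (cbox 0 (\<epsilon> n, \<chi> j. \<epsilon> n)) (\<lambda>w. mker b (\<lambda>_. 0) (- w :: real \<times> (real ^ 'd))) = 1" for n
    using mollifier_exists[OF \<epsilon>(1)[of n]] by metis
  then obtain b where b: "\<And>n m s. (b n m has_real_derivative b n (Suc m) s) (at s)"
    "\<And>n m s. s \<notin> {-\<epsilon> n..0} \<Longrightarrow> b n m s = 0"
    "\<And>n w. 0 \<le> mker (b n) (\<lambda>_. 0) (w :: real \<times> (real ^ 'd))"
    "\<And>n. integral (cbox 0 (\<epsilon> n, \<chi> j. \<epsilon> n)) (\<lambda>w. mker (b n) (\<lambda>_. 0) (- w :: real \<times> (real ^ 'd))) = 1"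
    by metis
  define e :: "nat \<Rightarrow> real \<times> (real ^ 'd)" where "e n = (\<epsilon> n, \<chi> j. \<epsilon> n)" for n
  define \<kappa> :: "nat \<Rightarrow> real \<times> (real ^ 'd) \<Rightarrow> real" where "\<kappa> n = mker (b n) (\<lambda>_. 0)" for n
  define M where "M n F = moll (e n) (\<kappa> n) (F :: real \<times> (real ^ 'd) \<Rightarrow> 'b)" for n F
  have \<kappa>: "continuous_on UNIV (\<kappa> n)" "\<And>w. 0 \<le> \<kappa> n w" "integral (cbox 0 (e n)) (\<lambda>w. \<kappa> n (- w)) = 1" for n
    using b mker_continuous[of "b n", OF b(1)] by (auto simp: \<kappa>_def e_def)
  define G where "G = (\<lambda>z. g (fst z) (snd z))"
  have G: "continuous_on UNIV G" using cont by (simp add: G_def)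
  define \<phi> where "\<phi> n t x = M n G (t, x)" for n t x
  have small: "w \<in> cbox 0 (e n) \<Longrightarrow> norm w \<le> \<epsilon> n * norm (e 0)" for n w
  proof -
    assume w: "w \<in> cbox 0 (e n)"
    have "norm w \<le> norm (e n)"
      using w by (intro norm_le_componentwise) (auto simp: mem_box abs_of_nonneg)
    also have "e n = \<epsilon> n *\<^sub>R e 0"
      by (simp add: e_def vec_eq_iff \<epsilon>_def)
    finally show ?thesis using \<epsilon>[of n] by simp
  qed
  have \<epsilon>0: "(\<lambda>n. \<epsilon> n * norm (e 0)) \<longlonglongrightarrow> 0"
    using tendsto_mult[OF LIMSEQ_inverse_real_of_nat tendsto_const[of "norm (e 0)"]]
    by (simp add: \<epsilon>_def inverse_eq_divide)
  have conv: "(\<lambda>n. M n F p) \<longlonglongrightarrow> F p" if F: "continuous_on UNIV F" for F p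
  proof (rule LIMSEQ_I)
    fix r :: real assume "0 < r"
    then obtain d where d: "d > 0" "\<And>q. dist q p < d \<Longrightarrow> dist (F q) (F p) < r / 2"
      using F unfolding continuous_on_iff by (metis UNIV_I half_gt_zero)
    have "eventually (\<lambda>n. \<epsilon> n * norm (e 0) < d) sequentially"
      using \<epsilon>0 d(1) by (rule order_tendstoD)
    then obtain n0 where n0: "\<And>n. n \<ge> n0 \<Longrightarrow> \<epsilon> n * norm (e 0) < d"
      by (auto simp: eventually_sequentially)
    have "norm (M n F p - F p) \<le> r / 2" if "n \<ge> n0" for n
      unfolding M_def
    proof (rule moll_average[OF \<kappa> F])
      fix w assume "w \<in> cbox 0 (e n)"
      then have "dist (p + w) p < d" using small[of w n] n0[OF that] by (simp add: dist_norm)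
      from d(2)[OF this] show "norm (F (p + w) - F p) \<le> r / 2" by (simp add: dist_norm)
    qed
    then show "\<exists>no. \<forall>n\<ge>no. norm (M n F p - F p) < r"
      using \<open>0 < r\<close> by (intro exI[of _ n0]) (force)
  qed
  have bdd: "\<exists>B. \<forall>n t x. t \<in> {0..T} \<longrightarrow> x \<in> cell \<longrightarrow> norm (M n F (t, x)) \<le> B" if F: "continuous_on UNIV F" for F
  proof -
    \<comment> \<open>As \<open>\<epsilon> n \<le> 1\<close>, this compact set contains all points
      over which \<open>F\<close> is averaged, uniformly in \<open>n\<close>.\<close>
    let ?K = "{0..T+1} \<times> cbox (0::real ^ 'd) (\<chi> j. 2)"
    have "compact (F ` ?K)"
      by (intro compact_continuous_image compact_Times compact_cbox compact_Icc continuous_on_subset[OF F]) auto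
    then obtain B where B: "\<And>z. z \<in> ?K \<Longrightarrow> norm (F z) \<le> B"
      by (metis compact_imp_bounded bounded_iff imageI)
    have "norm (M n F (t, x) - 0) \<le> B" if tx: "t \<in> {0..T}" "x \<in> cell" for n t x
      unfolding M_def
    proof (rule moll_average[OF \<kappa> F])
      fix w assume "w \<in> cbox 0 (e n)"
      then have w: "\<forall>i. 0 \<le> crd w i \<and> crd w i \<le> \<epsilon> n" by (simp add: e_def mem_cbox_crd)
      have "0 \<le> fst w \<and> fst w \<le> \<epsilon> n" using w[rule_format, of None] by (simp add: crd_def)
      moreover have "0 \<le> snd w $ j \<and> snd w $ j \<le> \<epsilon> n" for j using w[rule_format, of "Some j"] by (simp add: crd_def)
      moreover have "0 \<le> x $ j \<and> x $ j < 1" for j using tx(2) by (simp add: cell_def)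
      ultimately have "0 \<le> t + fst w \<and> t + fst w \<le> T + 1" "\<And>j. 0 \<le> x $ j + snd w $ j \<and> x $ j + snd w $ j \<le> 2"
        using tx(1) \<epsilon>(2)[of n] by (auto intro: add_nonneg_nonneg) (smt (verit))+
      then have "(t, x) + w \<in> ?K" by (cases w) (simp add: mem_box_cart)
      from B[OF this] show "norm (F ((t, x) + w) - 0) \<le> B" by simp
    qed
    then show ?thesis by auto
  qed
  have dT_eq: "dT (\<phi> n) t x = M n (\<lambda>z. gt (fst z) (snd z)) (t, x)" if "0 < t" for n t x
  proof -
    have "((\<lambda>h. M n G ((t, x) + h *\<^sub>R (1, 0))) has_vector_derivative M n (\<lambda>z. gt (fst z) (snd z)) (t, x)) (at 0)"
      unfolding M_def
    proof (rule moll_deriv_fun[OF \<kappa>(1) G cont(2) that])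
      fix w :: "real \<times> (real ^ 'd)" and h assume w: "w \<in> cbox 0 (e n)" and "\<bar>h\<bar> < t"
      then have "0 \<le> crd w None" unfolding e_def mem_cbox_crd by blast
      then have pos: "0 < t + h + fst w" using \<open>\<bar>h\<bar> < t\<close> by (simp add: crd_def)
      have "((\<lambda>s. g s (x + snd w)) has_vector_derivative gt (t + h + fst w) (x + snd w)) (at (t + h + fst w))"
        by (rule gt[OF pos])
      then have "((\<lambda>k. g (t + h + fst w + k) (x + snd w)) has_vector_derivative gt (t + h + fst w) (x + snd w)) (at 0)"
        using has_vector_derivative_at_0_shift[of "\<lambda>s. g s (x + snd w)"] by simp
      then show "((\<lambda>h. G ((t, x) + h *\<^sub>R (1, 0) + w)) has_vector_derivative
          gt (fst ((t, x) + h *\<^sub>R (1, 0) + w)) (snd ((t, x) + h *\<^sub>R (1, 0) + w))) (at h)"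
        using has_vector_derivative_at_0_shift[of "\<lambda>h. G ((t, x) + h *\<^sub>R (1, 0) + w)" h]
        by (simp add: G_def algebra_simps)
    qed
    then have "((\<lambda>s. \<phi> n s x) has_vector_derivative M n (\<lambda>z. gt (fst z) (snd z)) (t, x)) (at t)"
      using has_vector_derivative_at_0_shift[of "\<lambda>s. \<phi> n s x" t] by (simp add: \<phi>_def)
    then show ?thesis unfolding dT_def by (rule vector_derivative_at)
  qed
  have dX_eq: "dX j (\<phi> n) t x = M n (\<lambda>z. gx j (fst z) (snd z)) (t, x)" for n t x j
  proof -
    have "((\<lambda>h. M n G ((t, x) + h *\<^sub>R (0, axis j 1))) has_vector_derivative M n (\<lambda>z. gx j (fst z) (snd z)) (t, x)) (at 0)"
      unfolding M_def
    proof (rule moll_deriv_fun[OF \<kappa>(1) G cont(3) zero_less_one])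
      fix w :: "real \<times> (real ^ 'd)" and h :: real
      have "((\<lambda>k. g (t + fst w) (x + h *\<^sub>R axis j 1 + snd w + k *\<^sub>R axis j 1)) has_vector_derivative
          gx j (t + fst w) (x + h *\<^sub>R axis j 1 + snd w)) (at 0)"
        by (rule gx)
      then show "((\<lambda>h. G ((t, x) + h *\<^sub>R (0, axis j 1) + w)) has_vector_derivative
          gx j (fst ((t, x) + h *\<^sub>R (0, axis j 1) + w)) (snd ((t, x) + h *\<^sub>R (0, axis j 1) + w))) (at h)"
        using has_vector_derivative_at_0_shift[of "\<lambda>h. G ((t, x) + h *\<^sub>R (0, axis j 1) + w)" h]
        by (simp add: G_def algebra_simps)
    qed
    then show ?thesis unfolding dX_def \<phi>_def by (intro vector_derivative_at) simp
  qed
  have test: "test_fun T (\<phi> n)" for n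
    unfolding test_fun_def
  proof (intro conjI)
    show "smooth (\<phi> n)"
      unfolding smooth_def \<phi>_def M_def \<kappa>_def e_def
      using Ck_moll[of "b n" "\<epsilon> n" G _ "\<lambda>_. 0", OF b(1) b(2) G] by blast
    show "periodic_x (\<phi> n)"
    proof -
      have "g s (x + axis j 1 + y) = g s (x + y)" for s x y j
        using per[unfolded periodic_x_def, rule_format, of s "x + y" j] by (metis add.assoc add.commute)
      then show ?thesis by (simp add: periodic_x_def \<phi>_def M_def moll_def G_def)
    qed
    have "\<phi> n t x = 0" if "T - \<delta> \<le> t" for t x
    proof -
      have "\<phi> n t x = integral (cbox 0 (e n)) (\<lambda>w. 0)"
        unfolding \<phi>_def M_def moll_def
      proof (rule integral_cong)
        fix w assume "w \<in> cbox 0 (e n)"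
        then have "0 \<le> crd w None" unfolding e_def mem_cbox_crd by blast
        then have "T - \<delta> \<le> fst ((t, x) + w)" using that by (simp add: crd_def)
        then show "\<kappa> n (- w) *\<^sub>R G ((t, x) + w) = 0" by (simp add: G_def van(2))
      qed
      then show ?thesis by simp
    qed
    then show "\<exists>\<delta>>0. \<forall>t x. T - \<delta> \<le> t \<longrightarrow> \<phi> n t x = 0" using van(1) by blast
  qed
  obtain B1 where B1: "\<And>n t x. t \<in> {0..T} \<Longrightarrow> x \<in> cell \<Longrightarrow> norm (\<phi> n t x) \<le> B1"
    using bdd[OF G] unfolding \<phi>_def by blast
  obtain B2 where B2: "\<And>n t x. t \<in> {0..T} \<Longrightarrow> x \<in> cell \<Longrightarrow> norm (M n (\<lambda>z. gt (fst z) (snd z)) (t, x)) \<le> B2"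
    using bdd[OF cont(2)] by blast
  obtain B3 where B3: "\<And>j n t x. t \<in> {0..T} \<Longrightarrow> x \<in> cell \<Longrightarrow> norm (M n (\<lambda>z. gx j (fst z) (snd z)) (t, x)) \<le> B3 j"
    using bdd[OF cont(3)] by metis
  define B where "B = Max (insert B1 (insert B2 (range B3)))"
  have B: "B1 \<le> B" "B2 \<le> B" "B3 j \<le> B" for j unfolding B_def by (intro Max_ge; simp)+
  show thesis
  proof
    show "test_fun T (\<phi> n)" for n by (rule test)
    show "(\<lambda>n. \<phi> n t x) \<longlonglongrightarrow> g t x" for t x
      using conv[OF G, of "(t, x)"] by (simp add: \<phi>_def G_def)
    show "(\<lambda>n. dT (\<phi> n) t x) \<longlonglongrightarrow> gt t x" if "0 < t" for t x
      using conv[OF cont(2), of "(t, x)"] by (simp add: dT_eq[OF that])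
    show "(\<lambda>n. dX j (\<phi> n) t x) \<longlonglongrightarrow> gx j t x" for t x j
      using conv[OF cont(3), of j "(t, x)"] by (simp add: dX_eq)
    show "norm (\<phi> n t x) \<le> B" if "t \<in> {0..T}" "x \<in> cell" for n t x
      using B1[OF that] B(1) by (rule order_trans)
    show "norm (dT (\<phi> n) t x) \<le> B" if "t \<in> {0<..T}" "x \<in> cell" for n t x
      using B2[of t x n] that B(2) dT_eq[of t n x] by auto
    show "norm (dX j (\<phi> n) t x) \<le> B" if "t \<in> {0..T}" "x \<in> cell" for n t x j
      using order_trans[OF B3[OF that] B(3)] by (simp add: dX_eq)
  qed
qed

section \<open>Weak balance laws with continuously differentiable test functions\<close>

lemma continuous_slice:
  assumes "continuous_on UNIV (\<lambda>z. G (fst z) (snd z))"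
  shows "continuous_on UNIV (\<lambda>x. G t x)"
  using continuous_on_compose2[OF assms, of UNIV "\<lambda>x. (t, x)"]
  by (simp add: continuous_on_Pair)

lemma bounded_on_slab:
  fixes G :: "real \<Rightarrow> real ^ 'd \<Rightarrow> 'b::real_normed_vector"
  assumes "continuous_on ({a..b} \<times> UNIV) (\<lambda>z. G (fst z) (snd z))"
  obtains B where "0 \<le> B" "\<And>t x. t \<in> {a..b} \<Longrightarrow> x \<in> cell \<Longrightarrow> norm (G t x) \<le> B"
proof -
  have "compact ((\<lambda>z. G (fst z) (snd z)) ` ({a..b} \<times> cbox (0::real ^ 'd) (\<chi> j. 1)))"
    by (intro compact_continuous_image continuous_on_subset[OF assms] compact_Times) auto
  then obtain B where "\<And>z. z \<in> {a..b} \<times> cbox (0::real ^ 'd) (\<chi> j. 1) \<Longrightarrow> norm (G (fst z) (snd z)) \<le> B"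
    by (metis (no_types, lifting) compact_imp_bounded bounded_iff imageI)
  then have "norm (G t x) \<le> max B 0" if "t \<in> {a..b}" "x \<in> cell" for t x
    using that cell_subset_cbox by (force simp: le_max_iff_disj)
  then show thesis by (intro that[of "max B 0"]) auto
qed

lemma cell_measurable [measurable]: "(cell :: (real ^ 'd) set) \<in> sets borel"
proof -
  have eq: "cell = (\<Inter>i. {x :: real ^ 'd. 0 \<le> x $ i} \<inter> {x. x $ i < 1})"
    by (auto simp: cell_def)
  have "{x :: real ^ 'd. 0 \<le> x $ i} \<inter> {x. x $ i < 1} \<in> sets borel" for i
    by (intro sets.Int borel_closed borel_open closed_Collect_le open_Collect_less continuous_intros)
  then show ?thesis unfolding eq by (intro sets.finite_INT) auto
qed

text \<open>The common form of the momentum equation (\<open>'b = real ^ 'd\<close>) and of the continuity equation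
  (\<open>'b = real\<close>, \<open>\<Theta> = 0\<close>): \<open>V\<close> is the transported quantity, \<open>W j\<close> its flux in direction \<open>j\<close>, and
  \<open>\<Theta> j t\<close> the density with respect to \<open>\<mu> t\<close> of column \<open>j\<close> of the defect measure.\<close>

locale weak_balance =
  fixes T :: real
    and V :: "real \<times> (real ^ 'd) \<Rightarrow> 'b::euclidean_space"
    and W :: "'d \<Rightarrow> real \<times> (real ^ 'd) \<Rightarrow> 'b"
    and \<mu> :: "real \<Rightarrow> (real ^ 'd) measure"
    and \<Theta> :: "'d \<Rightarrow> real \<Rightarrow> real ^ 'd \<Rightarrow> 'b"
    and V0 :: "real ^ 'd \<Rightarrow> 'b"
  assumes T: "0 < T"
    and V: "set_integrable lborel ({0<..<T} \<times> cell) V"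
    and W: "\<And>j. set_integrable lborel ({0<..<T} \<times> cell) (W j)"
    and V0: "set_integrable lborel cell V0"
    and \<mu>_sets: "\<And>t. t \<in> {0<..<T} \<Longrightarrow> sets (\<mu> t) = sets borel"
    and \<mu>_cell: "\<And>t. t \<in> {0<..<T} \<Longrightarrow> AE x in \<mu> t. x \<in> cell"
    and \<Theta>_int: "\<And>t j. t \<in> {0<..<T} \<Longrightarrow> integrable (\<mu> t) (\<Theta> j t)"
    and \<Theta>_bounded: "\<exists>B. AE t in lborel. t \<in> {0<..<T} \<longrightarrow> (\<forall>j. (\<integral>x. norm (\<Theta> j t x) \<partial>\<mu> t) \<le> B)"
    and \<Theta>_measurable: "\<And>G. (\<And>j. continuous_on UNIV (G j)) \<Longrightarrow> (\<And>j x k. G j (x + axis k 1) = G j x) \<Longrightarrow>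
      set_borel_measurable lborel {0<..<T} (\<lambda>t. \<integral>x. (\<Sum>j\<in>UNIV. G j x \<bullet> \<Theta> j t x) \<partial>\<mu> t)"
    and weak: "\<And>\<phi>. test_fun T \<phi> \<Longrightarrow>
      (LINT z : {0<..<T} \<times> cell | lborel.
          V z \<bullet> dT \<phi> (fst z) (snd z) + (\<Sum>j\<in>UNIV. W j z \<bullet> dX j \<phi> (fst z) (snd z)))
        + (LINT t : {0<..<T} | lborel. \<integral>x. (\<Sum>j\<in>UNIV. dX j \<phi> t x \<bullet> \<Theta> j t x) \<partial>\<mu> t)
        = - (LINT x : cell | lborel. V0 x \<bullet> \<phi> 0 x)"
begin

definition defect :: "real \<Rightarrow> ('d \<Rightarrow> real ^ 'd \<Rightarrow> 'b) \<Rightarrow> real" where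
  "defect t G = (\<integral>x. (\<Sum>j\<in>UNIV. G j x \<bullet> \<Theta> j t x) \<partial>\<mu> t)"

lemma defect_integrable:
  assumes t: "t \<in> {0<..<T}" and G: "\<And>j. continuous_on UNIV (G j)"
    and B: "\<And>j x. x \<in> cell \<Longrightarrow> norm (G j x) \<le> B"
  shows "integrable (\<mu> t) (\<lambda>x. \<Sum>j\<in>UNIV. G j x \<bullet> \<Theta> j t x)"
    and "\<bar>defect t G\<bar> \<le> B * (\<Sum>j\<in>UNIV. \<integral>x. norm (\<Theta> j t x) \<partial>\<mu> t)"
proof -
  note \<mu>_sets[OF t, measurable_cong]
  have [measurable]: "\<Theta> j t \<in> borel_measurable (\<mu> t)" for j
    using \<Theta>_int[OF t] by (rule borel_measurable_integrable)
  have [measurable]: "G j \<in> borel_measurable (\<mu> t)" for j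
    using borel_measurable_continuous_onI[OF G] by simp
  have dom: "integrable (\<mu> t) (\<lambda>x. B * (\<Sum>j\<in>UNIV. norm (\<Theta> j t x)))"
    by (intro integrable_mult_right Bochner_Integration.integrable_sum integrable_norm \<Theta>_int t)
  have le: "AE x in \<mu> t. norm (\<Sum>j\<in>UNIV. G j x \<bullet> \<Theta> j t x) \<le> B * (\<Sum>j\<in>UNIV. norm (\<Theta> j t x))"
    using \<mu>_cell[OF t]
  proof eventually_elim
    case (elim x)
    show ?case
      unfolding sum_distrib_left
      by (intro order_trans[OF norm_sum] sum_mono)
        (use B[OF elim] in \<open>simp add: order_trans[OF Cauchy_Schwarz_ineq2] mult_right_mono\<close>)
  qed
  show i: "integrable (\<mu> t) (\<lambda>x. \<Sum>j\<in>UNIV. G j x \<bullet> \<Theta> j t x)"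
    by (rule Bochner_Integration.integrable_bound[OF dom])
      (measurable, use le in \<open>eventually_elim, simp\<close>)
  have "\<bar>defect t G\<bar> \<le> (\<integral>x. norm (\<Sum>j\<in>UNIV. G j x \<bullet> \<Theta> j t x) \<partial>\<mu> t)"
    unfolding defect_def using integral_norm_bound[of "\<mu> t" "\<lambda>x. \<Sum>j\<in>UNIV. G j x \<bullet> \<Theta> j t x"] by simp
  also have "\<dots> \<le> (\<integral>x. B * (\<Sum>j\<in>UNIV. norm (\<Theta> j t x)) \<partial>\<mu> t)"
    by (intro integral_mono_AE integrable_norm i dom le)
  also have "\<dots> = B * (\<Sum>j\<in>UNIV. \<integral>x. norm (\<Theta> j t x) \<partial>\<mu> t)"
    by (simp add: Bochner_Integration.integral_sum integrable_norm \<Theta>_int[OF t])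
  finally show "\<bar>defect t G\<bar> \<le> B * (\<Sum>j\<in>UNIV. \<integral>x. norm (\<Theta> j t x) \<partial>\<mu> t)" .
qed

lemma defect_tendsto:
  assumes t: "t \<in> {0<..<T}" and G: "\<And>n j. continuous_on UNIV (G n j)" "\<And>j. continuous_on UNIV (H j)"
    and B: "\<And>n j x. x \<in> cell \<Longrightarrow> norm (G n j x) \<le> B"
    and lim: "\<And>j x. (\<lambda>n. G n j x) \<longlonglongrightarrow> H j x"
  shows "(\<lambda>n. defect t (G n)) \<longlonglongrightarrow> defect t H"
proof -
  note \<mu>_sets[OF t, measurable_cong]
  have [measurable]: "\<Theta> j t \<in> borel_measurable (\<mu> t)" for j
    using \<Theta>_int[OF t] by (rule borel_measurable_integrable)
  have [measurable]: "G n j \<in> borel_measurable (\<mu> t)" "H j \<in> borel_measurable (\<mu> t)" for n j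
    using borel_measurable_continuous_onI[OF G(1)] borel_measurable_continuous_onI[OF G(2)] by simp_all
  show ?thesis
    unfolding defect_def
  proof (rule integral_dominated_convergence)
    show "integrable (\<mu> t) (\<lambda>x. B * (\<Sum>j\<in>UNIV. norm (\<Theta> j t x)))"
      by (intro integrable_mult_right Bochner_Integration.integrable_sum integrable_norm \<Theta>_int t)
    show "AE x in \<mu> t. norm (\<Sum>j\<in>UNIV. G n j x \<bullet> \<Theta> j t x) \<le> B * (\<Sum>j\<in>UNIV. norm (\<Theta> j t x))" for n
      using \<mu>_cell[OF t]
    proof eventually_elim
      case (elim x)
      show ?case
        unfolding sum_distrib_left
        by (intro order_trans[OF norm_sum] sum_mono)
          (use B[OF elim] in \<open>simp add: order_trans[OF Cauchy_Schwarz_ineq2] mult_right_mono\<close>)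
    qed
  qed (auto intro!: AE_I2 tendsto_intros lim)
qed

lemma defect_measurable:
  fixes G :: "'d \<Rightarrow> real \<Rightarrow> real ^ 'd \<Rightarrow> 'b"
  assumes G: "\<And>j. continuous_on UNIV (\<lambda>z. G j (fst z) (snd z))" and per: "\<And>j. periodic_x (G j)"
  shows "set_borel_measurable lborel {0<..<T} (\<lambda>t. defect t (\<lambda>j. G j t))"
proof -
  \<comment> \<open>Freezing the time of \<open>G\<close> at \<open>\<tau> n t\<close> reduces the claim to countably many time-independent fields.\<close>
  define \<tau> where "\<tau> n t = real_of_int \<lfloor>real (Suc n) * t\<rfloor> / real (Suc n)" for n t
  have \<tau>: "\<bar>\<tau> n t - t\<bar> \<le> 1 / real (Suc n)" for n t
  proof -
    have "\<tau> n t - t = (real_of_int \<lfloor>real (Suc n) * t\<rfloor> - real (Suc n) * t) / real (Suc n)"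
      unfolding \<tau>_def by (simp add: diff_divide_distrib del: of_nat_Suc)
    moreover have "\<bar>real_of_int \<lfloor>real (Suc n) * t\<rfloor> - real (Suc n) * t\<bar> \<le> 1" by linarith
    ultimately show ?thesis by (simp add: divide_right_mono del: of_nat_Suc)
  qed
  have \<tau>_lim: "(\<lambda>n. \<tau> n t) \<longlonglongrightarrow> t" for t
  proof -
    have "(\<lambda>n. \<tau> n t - t) \<longlonglongrightarrow> 0"
      by (rule Lim_null_comparison[OF always_eventually LIMSEQ_inverse_real_of_nat])
        (use \<tau> in \<open>simp add: inverse_eq_divide\<close>)
    then show ?thesis by (rule LIM_zero_cancel)
  qed
  have "\<exists>B. \<forall>t\<in>{-1..T+1}. \<forall>x\<in>cell. norm (G j t x) \<le> B" for j
    using bounded_on_slab[OF continuous_on_subset[OF G[of j]], of "-1" "T+1"] by (metis subset_UNIV)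
  then obtain Bj where Bj: "\<And>j t x. t \<in> {-1..T+1} \<Longrightarrow> x \<in> cell \<Longrightarrow> norm (G j t x) \<le> Bj j" by metis
  define B where "B = Max (range Bj)"
  have B: "norm (G j t x) \<le> B" if "t \<in> {-1..T+1}" "x \<in> cell" for j t x
    unfolding B_def by (rule order_trans[OF Bj[OF that] Max_ge]) auto
  have "(\<lambda>n. indicator {0<..<T} t *\<^sub>R defect t (\<lambda>j. G j (\<tau> n t))) \<longlonglongrightarrow>
      indicator {0<..<T} t *\<^sub>R defect t (\<lambda>j. G j t)" for t
  proof (cases "t \<in> {0<..<T}")
    case True
    have "(\<lambda>n. defect t (\<lambda>j. G j (\<tau> n t))) \<longlonglongrightarrow> defect t (\<lambda>j. G j t)"
    proof (rule defect_tendsto[OF True, where B = B])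
      show "norm (G j (\<tau> n t) x) \<le> B" if "x \<in> cell" for n j x
      proof (rule B[OF _ that])
        have "\<bar>\<tau> n t - t\<bar> \<le> 1" by (rule order_trans[OF \<tau>]) simp
        then show "\<tau> n t \<in> {-1..T+1}" using True by (simp add: abs_le_iff)
      qed
      show "(\<lambda>n. G j (\<tau> n t) x) \<longlonglongrightarrow> G j t x" for j x
        using continuous_on_tendsto_compose[OF G[of j] tendsto_Pair[OF \<tau>_lim tendsto_const]] by simp
    qed (auto intro!: continuous_slice G)
    then show ?thesis using True by simp
  qed simp
  moreover have "(\<lambda>t. indicator {0<..<T} t *\<^sub>R defect t (\<lambda>j. G j (\<tau> n t))) \<in> borel_measurable lborel" for n
  proof -
    have 1: "(\<lambda>t. indicator {0<..<T} t *\<^sub>R defect t (\<lambda>j. G j (real_of_int i / real (Suc n)))) \<in> borel_measurable lborel" for i :: int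
      unfolding defect_def
      by (rule \<Theta>_measurable[unfolded set_borel_measurable_def])
        (use per in \<open>auto intro!: continuous_slice G simp: periodic_x_def\<close>)
    have "(\<lambda>t. \<lfloor>real (Suc n) * t\<rfloor>) \<in> measurable lborel (count_space UNIV)" by simp
    from measurable_compose_countable[OF 1 this] show ?thesis by (simp add: \<tau>_def)
  qed
  ultimately show ?thesis
    unfolding set_borel_measurable_def by (rule borel_measurable_LIMSEQ_real)
qed

text \<open>The smooth approximants satisfy the weak formulation, and dominated convergence passes
  to the limit in each term. The dominating functions are \<open>B\<close> times norms of
  \<open>V\<close>, \<open>W j\<close> and \<open>V0\<close>; for the defect it is a constant
  supplied by \<open>\<Theta>_bounded\<close>.\<close>

lemma weak_C1:
  fixes g gt :: "real \<Rightarrow> real ^ 'd \<Rightarrow> 'b" and gx :: "'d \<Rightarrow> real \<Rightarrow> real ^ 'd \<Rightarrow> 'b"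
  assumes per: "periodic_x g"
    and cont: "continuous_on UNIV (\<lambda>z. g (fst z) (snd z))" "continuous_on UNIV (\<lambda>z. gt (fst z) (snd z))"
      "\<And>j. continuous_on UNIV (\<lambda>z. gx j (fst z) (snd z))"
    and gt: "\<And>t x. 0 < t \<Longrightarrow> ((\<lambda>s. g s x) has_vector_derivative gt t x) (at t)"
    and gx: "\<And>t x j. ((\<lambda>h. g t (x + h *\<^sub>R axis j 1)) has_vector_derivative gx j t x) (at 0)"
    and van: "0 < \<delta>" "\<And>t x. T - \<delta> \<le> t \<Longrightarrow> g t x = 0"
  shows "(LINT z : {0<..<T} \<times> cell | lborel.
          V z \<bullet> gt (fst z) (snd z) + (\<Sum>j\<in>UNIV. W j z \<bullet> gx j (fst z) (snd z)))
        + (LINT t : {0<..<T} | lborel. defect t (\<lambda>j. gx j t))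
        = - (LINT x : cell | lborel. V0 x \<bullet> g 0 x)"
proof -
  obtain \<phi> B where \<phi>: "\<And>n. test_fun T (\<phi> n)"
    "\<And>t x. (\<lambda>n. \<phi> n t x) \<longlonglongrightarrow> g t x"
    "\<And>t x. 0 < t \<Longrightarrow> (\<lambda>n. dT (\<phi> n) t x) \<longlonglongrightarrow> gt t x"
    "\<And>t x j. (\<lambda>n. dX j (\<phi> n) t x) \<longlonglongrightarrow> gx j t x"
    "\<And>n t x. t \<in> {0..T} \<Longrightarrow> x \<in> cell \<Longrightarrow> norm (\<phi> n t x) \<le> B"
    "\<And>n t x. t \<in> {0<..T} \<Longrightarrow> x \<in> cell \<Longrightarrow> norm (dT (\<phi> n) t x) \<le> B"
    "\<And>n t x j. t \<in> {0..T} \<Longrightarrow> x \<in> cell \<Longrightarrow> norm (dX j (\<phi> n) t x) \<le> B"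
    using C1_smooth_approximation[OF per cont gt gx van] by blast
  let ?S = "{0<..<T} \<times> (cell :: (real ^ 'd) set)"
  obtain Bm where Bm: "AE t in lborel. t \<in> {0<..<T} \<longrightarrow> (\<forall>j. (\<integral>x. norm (\<Theta> j t x) \<partial>\<mu> t) \<le> Bm)"
    using \<Theta>_bounded by blast
  have sm: "Ck 1 (\<phi> n)" for n using \<phi>(1)[of n] by (simp add: test_fun_def smooth_def)
  have c\<phi>: "continuous_on UNIV (\<lambda>z. \<phi> n (fst z) (snd z))" "continuous_on UNIV (\<lambda>z. dT (\<phi> n) (fst z) (snd z))"
    "continuous_on UNIV (\<lambda>z. dX j (\<phi> n) (fst z) (snd z))" for n j
    using sm[of n] by simp_all
  have perX: "periodic_x (dX j (\<phi> n))" for j n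
  proof -
    have p: "\<phi> n t (x + axis k 1) = \<phi> n t x" for t x k
      using \<phi>(1)[of n] by (simp add: test_fun_def periodic_x_def)
    have "\<phi> n t (x + axis k 1 + h *\<^sub>R axis j 1) = \<phi> n t (x + h *\<^sub>R axis j 1)" for t x h k
      using p[of t "x + h *\<^sub>R axis j 1" k] by (simp add: algebra_simps)
    then show ?thesis by (simp add: periodic_x_def dX_def)
  qed
  note [measurable] = borel_measurable_continuous_onI[OF c\<phi>(1)] borel_measurable_continuous_onI[OF c\<phi>(2)]
    borel_measurable_continuous_onI[OF c\<phi>(3)] borel_measurable_continuous_onI[OF cont(1)]
    borel_measurable_continuous_onI[OF cont(2)] borel_measurable_continuous_onI[OF cont(3)]
  have [measurable]: "(\<lambda>z. indicator ?S z *\<^sub>R V z) \<in> borel_measurable borel"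
    "(\<lambda>z. indicator ?S z *\<^sub>R W j z) \<in> borel_measurable borel"
    "(\<lambda>x. indicator cell x *\<^sub>R V0 x) \<in> borel_measurable borel" for j
    using V W[of j] V0 unfolding set_integrable_def by (auto dest: borel_measurable_integrable)
  have A: "(\<lambda>n. LINT z : ?S | lborel. V z \<bullet> dT (\<phi> n) (fst z) (snd z) + (\<Sum>j\<in>UNIV. W j z \<bullet> dX j (\<phi> n) (fst z) (snd z)))
    \<longlonglongrightarrow> (LINT z : ?S | lborel. V z \<bullet> gt (fst z) (snd z) + (\<Sum>j\<in>UNIV. W j z \<bullet> gx j (fst z) (snd z)))"
    unfolding set_lebesgue_integral_def
  proof (rule integral_dominated_convergence)
    let ?w = "\<lambda>z. B * (norm (indicator ?S z *\<^sub>R V z) + (\<Sum>j\<in>UNIV. norm (indicator ?S z *\<^sub>R W j z)))"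
    show "integrable lborel ?w"
      using V W unfolding set_integrable_def
      by (intro integrable_mult_right Bochner_Integration.integrable_add Bochner_Integration.integrable_sum integrable_norm)
    \<comment> \<open>\<open>V\<close> and \<open>W j\<close> are known to be measurable only after
      multiplication by the indicator of the slab, so the indicator is moved onto them.\<close>
    have split: "indicator ?S z *\<^sub>R (V z \<bullet> a + (\<Sum>j\<in>UNIV. W j z \<bullet> b j)) =
      (indicator ?S z *\<^sub>R V z) \<bullet> a + (\<Sum>j\<in>UNIV. (indicator ?S z *\<^sub>R W j z) \<bullet> b j)" for z a b
      by (simp add: algebra_simps sum_distrib_left)
    show "(\<lambda>z. indicator ?S z *\<^sub>R (V z \<bullet> gt (fst z) (snd z) + (\<Sum>j\<in>UNIV. W j z \<bullet> gx j (fst z) (snd z)))) \<in> borel_measurable lborel"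
      unfolding split by measurable
    show "(\<lambda>z. indicator ?S z *\<^sub>R (V z \<bullet> dT (\<phi> n) (fst z) (snd z) + (\<Sum>j\<in>UNIV. W j z \<bullet> dX j (\<phi> n) (fst z) (snd z)))) \<in> borel_measurable lborel" for n
      unfolding split by measurable
    show "AE z in lborel. (\<lambda>n. indicator ?S z *\<^sub>R (V z \<bullet> dT (\<phi> n) (fst z) (snd z) + (\<Sum>j\<in>UNIV. W j z \<bullet> dX j (\<phi> n) (fst z) (snd z))))
      \<longlonglongrightarrow> indicator ?S z *\<^sub>R (V z \<bullet> gt (fst z) (snd z) + (\<Sum>j\<in>UNIV. W j z \<bullet> gx j (fst z) (snd z)))"
    proof (rule AE_I2)
      fix z :: "real \<times> (real ^ 'd)"
      show "(\<lambda>n. indicator ?S z *\<^sub>R (V z \<bullet> dT (\<phi> n) (fst z) (snd z) + (\<Sum>j\<in>UNIV. W j z \<bullet> dX j (\<phi> n) (fst z) (snd z))))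
        \<longlonglongrightarrow> indicator ?S z *\<^sub>R (V z \<bullet> gt (fst z) (snd z) + (\<Sum>j\<in>UNIV. W j z \<bullet> gx j (fst z) (snd z)))"
      proof (cases "z \<in> ?S")
        case True
        then have "0 < fst z" by auto
        then show ?thesis by (intro tendsto_intros \<phi>)
      qed simp
    qed
    show "AE z in lborel. norm (indicator ?S z *\<^sub>R (V z \<bullet> dT (\<phi> n) (fst z) (snd z) + (\<Sum>j\<in>UNIV. W j z \<bullet> dX j (\<phi> n) (fst z) (snd z)))) \<le> ?w z" for n
    proof (rule AE_I2)
      fix z :: "real \<times> (real ^ 'd)"
      show "norm (indicator ?S z *\<^sub>R (V z \<bullet> dT (\<phi> n) (fst z) (snd z) + (\<Sum>j\<in>UNIV. W j z \<bullet> dX j (\<phi> n) (fst z) (snd z)))) \<le> ?w z"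
      proof (cases "z \<in> ?S")
        case True
        then have tz: "fst z \<in> {0<..T}" "fst z \<in> {0..T}" "snd z \<in> cell" by auto
        have 1: "norm (V z \<bullet> dT (\<phi> n) (fst z) (snd z)) \<le> B * norm (V z)"
          using Cauchy_Schwarz_ineq2[of "V z" "dT (\<phi> n) (fst z) (snd z)"]
            mult_left_mono[OF \<phi>(6)[OF tz(1) tz(3), of n], of "norm (V z)"] by (simp add: mult.commute)
        have 2: "norm (\<Sum>j\<in>UNIV. W j z \<bullet> dX j (\<phi> n) (fst z) (snd z)) \<le> (\<Sum>j\<in>UNIV. B * norm (W j z))"
        proof (intro order_trans[OF norm_sum] sum_mono)
          fix j
          show "norm (W j z \<bullet> dX j (\<phi> n) (fst z) (snd z)) \<le> B * norm (W j z)"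
            using Cauchy_Schwarz_ineq2[of "W j z" "dX j (\<phi> n) (fst z) (snd z)"]
              mult_left_mono[OF \<phi>(7)[OF tz(2) tz(3), of j n], of "norm (W j z)"] by (simp add: mult.commute)
        qed
        show ?thesis
          using order_trans[OF norm_triangle_ineq add_mono[OF 1 2]] True
          by (simp add: distrib_left sum_distrib_left)
      qed simp
    qed
  qed
  have B: "(\<lambda>n. LINT t : {0<..<T} | lborel. defect t (\<lambda>j. dX j (\<phi> n) t)) \<longlonglongrightarrow>
    (LINT t : {0<..<T} | lborel. defect t (\<lambda>j. gx j t))"
    unfolding set_lebesgue_integral_def
  proof (rule integral_dominated_convergence)
    let ?w = "\<lambda>t. indicator {0<..<T} t *\<^sub>R (\<bar>B\<bar> * (\<Sum>j\<in>(UNIV::'d set). Bm))"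
    show "integrable lborel ?w"
      by (intro integrable_scaleR_left) (auto intro!: integrable_real_indicator simp: emeasure_lborel_Ioo T less_imp_le)
    have conv: "(\<lambda>n. indicator {0<..<T} t *\<^sub>R defect t (\<lambda>j. dX j (\<phi> n) t)) \<longlonglongrightarrow> indicator {0<..<T} t *\<^sub>R defect t (\<lambda>j. gx j t)" for t
    proof (cases "t \<in> {0<..<T}")
      case True
      then have "t \<in> {0..T}" by auto
      with True show ?thesis
        by (auto intro!: defect_tendsto[where B = B] \<phi> continuous_slice c\<phi> cont)
    qed simp
    then show "AE t in lborel. (\<lambda>n. indicator {0<..<T} t *\<^sub>R defect t (\<lambda>j. dX j (\<phi> n) t)) \<longlonglongrightarrow> indicator {0<..<T} t *\<^sub>R defect t (\<lambda>j. gx j t)"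
      by simp
    show m: "(\<lambda>t. indicator {0<..<T} t *\<^sub>R defect t (\<lambda>j. dX j (\<phi> n) t)) \<in> borel_measurable lborel" for n
      using defect_measurable[OF c\<phi>(3)[of _ n] perX] by (simp add: set_borel_measurable_def)
    show "(\<lambda>t. indicator {0<..<T} t *\<^sub>R defect t (\<lambda>j. gx j t)) \<in> borel_measurable lborel"
      by (rule borel_measurable_LIMSEQ_real[OF conv m])
    show "AE t in lborel. norm (indicator {0<..<T} t *\<^sub>R defect t (\<lambda>j. dX j (\<phi> n) t)) \<le> ?w t" for n
      using Bm
    proof eventually_elim
      case (elim t)
      show ?case
      proof (cases "t \<in> {0<..<T}")
        case True
        then have t: "t \<in> {0..T}" by auto
        have "\<bar>defect t (\<lambda>j. dX j (\<phi> n) t)\<bar> \<le> \<bar>B\<bar> * (\<Sum>j\<in>UNIV. \<integral>x. norm (\<Theta> j t x) \<partial>\<mu> t)"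
          by (rule defect_integrable(2)[OF True continuous_slice[OF c\<phi>(3)] order_trans[OF \<phi>(7)[OF t] abs_ge_self]])
        also have "\<dots> \<le> \<bar>B\<bar> * (\<Sum>j\<in>(UNIV::'d set). Bm)"
          using elim True by (intro mult_left_mono sum_mono) auto
        finally show ?thesis using True by simp
      qed simp
    qed
  qed
  have C: "(\<lambda>n. LINT x : cell | lborel. V0 x \<bullet> \<phi> n 0 x) \<longlonglongrightarrow> (LINT x : cell | lborel. V0 x \<bullet> g 0 x)"
    unfolding set_lebesgue_integral_def
  proof (rule integral_dominated_convergence)
    let ?w = "\<lambda>x. B * norm (indicator cell x *\<^sub>R V0 x)"
    show "integrable lborel ?w"
      using V0 unfolding set_integrable_def by (intro integrable_mult_right integrable_norm)
    have split: "indicator cell x *\<^sub>R (V0 x \<bullet> a) = (indicator cell x *\<^sub>R V0 x) \<bullet> a" for x a by simp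
    have [measurable]: "g 0 \<in> borel_measurable borel" "\<phi> n 0 \<in> borel_measurable borel" for n
      by (rule borel_measurable_continuous_onI[OF continuous_slice[OF cont(1)]]
          borel_measurable_continuous_onI[OF continuous_slice[OF c\<phi>(1)]])+
    show "(\<lambda>x. indicator cell x *\<^sub>R (V0 x \<bullet> g 0 x)) \<in> borel_measurable lborel"
      "(\<lambda>x. indicator cell x *\<^sub>R (V0 x \<bullet> \<phi> n 0 x)) \<in> borel_measurable lborel" for n
      unfolding split by measurable
    show "AE x in lborel. (\<lambda>n. indicator cell x *\<^sub>R (V0 x \<bullet> \<phi> n 0 x)) \<longlonglongrightarrow> indicator cell x *\<^sub>R (V0 x \<bullet> g 0 x)"
      by (intro AE_I2 tendsto_intros \<phi>)
    show "AE x in lborel. norm (indicator cell x *\<^sub>R (V0 x \<bullet> \<phi> n 0 x)) \<le> ?w x" for n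
    proof (rule AE_I2)
      fix x :: "real ^ 'd"
      show "norm (indicator cell x *\<^sub>R (V0 x \<bullet> \<phi> n 0 x)) \<le> ?w x"
      proof (cases "x \<in> cell")
        case True
        have "norm (\<phi> n 0 x) \<le> B" using \<phi>(5)[of 0 x n] True T by simp
        then show ?thesis
          using True Cauchy_Schwarz_ineq2[of "V0 x" "\<phi> n 0 x"] mult_left_mono[of "norm (\<phi> n 0 x)" B "norm (V0 x)"]
          by (simp add: mult.commute)
      qed simp
    qed
  qed
  show ?thesis
    using LIMSEQ_unique[OF tendsto_add[OF A B, unfolded defect_def weak[OF \<phi>(1)]] tendsto_minus[OF C]]
    unfolding defect_def .
qed

end

section \<open>Localization in time\<close>

text \<open>The positive and the negative part of \<open>F\<close> are densities of two finite
  measures that agree on all half-lines, hence coincide. Densities are unique up to null sets, and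
  the two parts of a number agree only if it is 0.\<close>

lemma AE_zero_if_tail_integrals_zero:
  fixes F :: "real \<Rightarrow> real"
  assumes F: "integrable lborel F" and z: "\<And>x. (LINT t:{x<..}|lborel. F t) = 0"
  shows "AE t in lborel. F t = 0"
proof -
  have [measurable]: "F \<in> borel_measurable borel" using F by auto
  define P where "P t = ennreal (max (F t) 0)" for t
  define N where "N t = ennreal (max (- F t) 0)" for t
  have [measurable]: "P \<in> borel_measurable borel" "N \<in> borel_measurable borel"
    unfolding P_def N_def by measurable
  have ind: "integrable lborel (\<lambda>t. indicator {x<..} t * F t)" for x
    using integrable_mult_indicator[OF _ F, of "{x<..}"] by simp
  have e1: "emeasure (density lborel P) {x<..} = ennreal (\<integral>t. max (indicator {x<..} t * F t) 0 \<partial>lborel)" for x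
  proof -
    have "emeasure (density lborel P) {x<..} = (\<integral>\<^sup>+t. ennreal (max (indicator {x<..} t * F t) 0) \<partial>lborel)"
      by (subst emeasure_density) (auto intro!: nn_integral_cong simp: P_def split: split_indicator)
    also have "\<dots> = ennreal (\<integral>t. max (indicator {x<..} t * F t) 0 \<partial>lborel)"
      by (intro nn_integral_eq_integral integrable_max ind) auto
    finally show ?thesis .
  qed
  have e2: "emeasure (density lborel N) {x<..} = ennreal (\<integral>t. max (- (indicator {x<..} t * F t)) 0 \<partial>lborel)" for x
  proof -
    have "emeasure (density lborel N) {x<..} = (\<integral>\<^sup>+t. ennreal (max (- (indicator {x<..} t * F t)) 0) \<partial>lborel)"
      by (subst emeasure_density) (auto intro!: nn_integral_cong simp: N_def split: split_indicator)
    also have "\<dots> = ennreal (\<integral>t. max (- (indicator {x<..} t * F t)) 0 \<partial>lborel)"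
      by (intro nn_integral_eq_integral integrable_max integrable_minus ind) auto
    finally show ?thesis .
  qed
  have "(\<integral>t. max (indicator {x<..} t * F t) 0 \<partial>lborel) = (\<integral>t. max (- (indicator {x<..} t * F t)) 0 \<partial>lborel)" for x
  proof -
    have "(\<integral>t. max (indicator {x<..} t * F t) 0 \<partial>lborel) - (\<integral>t. max (- (indicator {x<..} t * F t)) 0 \<partial>lborel)
      = (\<integral>t. max (indicator {x<..} t * F t) 0 - max (- (indicator {x<..} t * F t)) 0 \<partial>lborel)"
      by (intro Bochner_Integration.integral_diff[symmetric] integrable_max integrable_minus ind) auto
    also have "\<dots> = (\<integral>t. indicator {x<..} t * F t \<partial>lborel)"
      by (intro Bochner_Integration.integral_cong) (auto simp: max_def)
    also have "\<dots> = 0" using z[of x] by (simp add: set_lebesgue_integral_def)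
    finally show ?thesis by simp
  qed
  then have "density lborel P = density lborel N"
    by (intro measure_eqI_lessThan) (simp_all add: e1 e2)
  then have "AE t in lborel. P t = N t"
    by (intro sigma_finite_measure.density_unique[OF lborel.sigma_finite_measure_axioms]) auto
  then show ?thesis
  proof eventually_elim
    case (elim t)
    then show ?case by (auto simp: P_def N_def max_def split: if_splits)
  qed
qed

text \<open>The fundamental lemma for test functions that vanish near \<open>T\<close> and are
  unrestricted near 0. Trapezoids of this kind converge to the indicator of the times beyond
  \<open>x\<close>, which reduces the claim to tail integrals.\<close>

lemma AE_zero_if_test_integrals_zero:
  fixes F :: "real \<Rightarrow> real"
  assumes F: "set_integrable lborel {0<..<T} F"
    and z: "\<And>\<omega> \<delta>. continuous_on UNIV \<omega> \<Longrightarrow> 0 < \<delta> \<Longrightarrow> (\<And>t. T - \<delta> \<le> t \<Longrightarrow> \<omega> t = 0) \<Longrightarrow>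
      (LINT t:{0<..<T}|lborel. \<omega> t * F t) = 0"
  shows "AE t in lborel. t \<in> {0<..<T} \<longrightarrow> F t = 0"
proof -
  define H where "H t = indicator {0<..<T} t * F t" for t
  have H: "integrable lborel H" using F by (simp add: set_integrable_def H_def[abs_def])
  have [measurable]: "H \<in> borel_measurable borel" using H by auto
  have "(LINT t:{x<..}|lborel. H t) = 0" for x
  proof -
    define c where "c s = min 1 (max 0 s)" for s :: real
    \<comment> \<open>The first factor rises from 0 at \<open>x\<close> to 1 at x + 1/n; the second
      falls from 1 at T - 2/n to 0 at T - 1/n.\<close>
    define \<omega> where "\<omega> n t = c (real n * (t - x)) * c (real n * (T - t) - 1)" for n :: nat and t
    have "(\<lambda>n. \<integral>t. \<omega> n t * H t \<partial>lborel) \<longlonglongrightarrow> (\<integral>t. indicator {x<..} t * H t \<partial>lborel)"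
    proof (rule integral_dominated_convergence)
      show "integrable lborel (\<lambda>t. \<bar>H t\<bar>)" using H by (rule integrable_abs)
      show "AE t in lborel. (\<lambda>n. \<omega> n t * H t) \<longlonglongrightarrow> indicator {x<..} t * H t"
      proof (rule AE_I2)
        fix t
        consider "t \<notin> {0<..<T}" | "t \<in> {0<..<T}" "t \<le> x" | "t \<in> {0<..<T}" "x < t" by linarith
        then show "(\<lambda>n. \<omega> n t * H t) \<longlonglongrightarrow> indicator {x<..} t * H t"
        proof cases
          case 1
          then show ?thesis by (simp add: H_def)
        next
          case 2
          then have "real n * (t - x) \<le> 0" for n by (intro mult_nonneg_nonpos) auto
          then have "c (real n * (t - x)) = 0" for n by (simp add: c_def)
          then show ?thesis using 2 by (simp add: \<omega>_def)
        next
          case 3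
          have ev: "eventually (\<lambda>n. 2 < real n * r) sequentially" if "0 < r" for r
          proof -
            have "filterlim (\<lambda>n. real n * r) at_top sequentially"
              by (intro filterlim_at_top_mult_tendsto_pos[OF tendsto_const that] filterlim_real_sequentially)
            then show ?thesis by (simp add: filterlim_at_top_dense)
          qed
          have "eventually (\<lambda>n. \<omega> n t * H t = indicator {x<..} t * H t) sequentially"
          proof -
            have "eventually (\<lambda>n. 2 < real n * (t - x)) sequentially" "eventually (\<lambda>n. 2 < real n * (T - t)) sequentially"
              using 3 by (auto intro!: ev)
            then show ?thesis
            proof eventually_elim
              case (elim n)
              then have "c (real n * (t - x)) = 1" "c (real n * (T - t) - 1) = 1" by (auto simp: c_def)
              then show ?case using 3 by (simp add: \<omega>_def)
            qed
          qed
          then show ?thesis by (rule tendsto_eventually)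
        qed
      qed
      show "AE t in lborel. norm (\<omega> n t * H t) \<le> \<bar>H t\<bar>" for n
      proof (rule AE_I2)
        fix t
        have "\<bar>\<omega> n t\<bar> \<le> 1" by (auto simp: \<omega>_def c_def abs_mult intro!: mult_le_one)
        then show "norm (\<omega> n t * H t) \<le> \<bar>H t\<bar>" by (simp add: abs_mult mult_left_le_one_le)
      qed
    qed (simp_all add: \<omega>_def c_def)
    moreover have "(\<integral>t. \<omega> n t * H t \<partial>lborel) = 0" if "n > 0" for n
    proof -
      have "(LINT t:{0<..<T}|lborel. \<omega> n t * F t) = 0"
      proof (rule z)
        show "continuous_on UNIV (\<omega> n)" unfolding \<omega>_def c_def by (intro continuous_intros)
        show "0 < 1 / real n" using that by simp
        show "\<omega> n t = 0" if t: "T - 1 / real n \<le> t" for t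
        proof -
          have "real n * (T - t) \<le> real n * (1 / real n)" using t by (intro mult_left_mono) auto
          then have "real n * (T - t) - 1 \<le> 0" using \<open>n > 0\<close> by simp
          then show ?thesis by (simp add: \<omega>_def c_def)
        qed
      qed
      then show ?thesis by (simp add: set_lebesgue_integral_def H_def algebra_simps)
    qed
    then have "(\<lambda>n. \<integral>t. \<omega> n t * H t \<partial>lborel) \<longlonglongrightarrow> 0"
      by (intro tendsto_eventually) (auto simp: eventually_sequentially intro!: exI[of _ 1])
    ultimately show ?thesis
      by (simp add: set_lebesgue_integral_def LIMSEQ_unique)
  qed
  from AE_zero_if_tail_integrals_zero[OF H this] show ?thesis
    by eventually_elim (auto simp: H_def)
qed

section \<open>Fubini arguments on the space-time slab and functions on a closed time
  interval\<close>

lemma integrable_lborel_product: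
  fixes f g :: "real \<Rightarrow> real"
  assumes f: "integrable lborel f" and g: "integrable lborel g"
  shows "integrable (lborel \<Otimes>\<^sub>M lborel) (\<lambda>z. f (fst z) * g (snd z))"
proof (rule lborel_pair.Fubini_integrable)
  have [measurable]: "f \<in> borel_measurable borel" "g \<in> borel_measurable borel" using f g by auto
  show "(\<lambda>z. f (fst z) * g (snd z)) \<in> borel_measurable (lborel \<Otimes>\<^sub>M lborel)" by measurable
  show "integrable lborel (\<lambda>x. \<integral>y. norm (f (fst (x, y)) * g (snd (x, y))) \<partial>lborel)"
    using f by (simp add: abs_mult)
  show "AE x in lborel. integrable lborel (\<lambda>y. f (fst (x, y)) * g (snd (x, y)))"
    using g by simp
qed

text \<open>Fubini on the triangle 0 < t < s < T. This replaces the product rule, since the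
  indefinite integral of a merely integrable \<open>b\<close> need not be differentiable
  everywhere.\<close>

lemma integration_by_parts_indefinite:
  fixes b \<omega> :: "real \<Rightarrow> real"
  assumes b: "set_integrable lborel {0<..<T} b" and \<omega>: "continuous_on UNIV \<omega>"
  shows "set_integrable lborel {0<..<T} (\<lambda>s. \<omega> s * (LINT t:{0<..<s}|lborel. b t))"
    and "(LINT t:{0<..<T}|lborel. (LINT s:{t<..<T}|lborel. \<omega> s) * b t)
      = (LINT s:{0<..<T}|lborel. \<omega> s * (LINT t:{0<..<s}|lborel. b t))"
proof -
  define f where "f s = indicator {0<..<T} s * \<omega> s" for s
  define g where "g t = indicator {0<..<T} t * b t" for t
  have "set_integrable lborel {0<..<T} \<omega>"
    by (rule set_integrable_subset[OF borel_integrable_compact[of "{0..T}", folded set_integrable_def]])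
      (auto intro: continuous_on_subset[OF \<omega>])
  then have f: "integrable lborel f" by (simp add: set_integrable_def f_def[abs_def])
  have g: "integrable lborel g" using b by (simp add: set_integrable_def g_def[abs_def])
  have [measurable]: "f \<in> borel_measurable borel" "g \<in> borel_measurable borel" using f g by auto
  define h where "h s t = (if t < s then f s * g t else 0)" for s t
  have m: "(\<lambda>z. h (fst z) (snd z)) \<in> borel_measurable (lborel \<Otimes>\<^sub>M lborel)"
    unfolding h_def by measurable
  have h: "integrable (lborel \<Otimes>\<^sub>M lborel) (case_prod h)"
    using Bochner_Integration.integrable_bound[OF integrable_lborel_product[OF f g] m]
    unfolding case_prod_beta' by (auto simp: h_def)
  have 1: "(\<integral>t. h s t \<partial>lborel) = indicator {0<..<T} s *\<^sub>R (\<omega> s * (LINT t:{0<..<s}|lborel. b t))" for s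
  proof (cases "s \<in> {0<..<T}")
    case True
    have "(\<integral>t. h s t \<partial>lborel) = (\<integral>t. \<omega> s * (indicator {0<..<s} t * b t) \<partial>lborel)"
      using True by (intro Bochner_Integration.integral_cong) (auto simp: h_def f_def g_def split: split_indicator)
    then show ?thesis using True by (simp add: set_lebesgue_integral_def)
  qed (simp add: h_def f_def cong: if_cong)
  have 2: "(\<integral>s. h s t \<partial>lborel) = indicator {0<..<T} t *\<^sub>R ((LINT s:{t<..<T}|lborel. \<omega> s) * b t)" for t
  proof (cases "t \<in> {0<..<T}")
    case True
    have "(\<integral>s. h s t \<partial>lborel) = (\<integral>s. (indicator {t<..<T} s * \<omega> s) * b t \<partial>lborel)"
      using True by (intro Bochner_Integration.integral_cong) (auto simp: h_def f_def g_def split: split_indicator)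
    then show ?thesis using True by (simp add: set_lebesgue_integral_def)
  qed (simp add: h_def g_def cong: if_cong)
  show "set_integrable lborel {0<..<T} (\<lambda>s. \<omega> s * (LINT t:{0<..<s}|lborel. b t))"
    using lborel_pair.integrable_fst'[OF h] unfolding set_integrable_def by (simp add: 1)
  show "(LINT t:{0<..<T}|lborel. (LINT s:{t<..<T}|lborel. \<omega> s) * b t)
      = (LINT s:{0<..<T}|lborel. \<omega> s * (LINT t:{0<..<s}|lborel. b t))"
    using lborel_pair.Fubini_integral[OF h] unfolding set_lebesgue_integral_def[of _ "{0<..<T}"] by (simp add: 1 2)
qed

lemma slab_Fubini:
  fixes F :: "real \<times> (real ^ 'd) \<Rightarrow> 'b::{banach, second_countable_topology}"
  assumes F: "set_integrable lborel ({0<..<T} \<times> cell) F"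
  shows "set_integrable lborel {0<..<T} (\<lambda>t. LINT x:cell|lborel. F (t, x))"
    and "(LINT z:{0<..<T} \<times> cell|lborel. F z) = (LINT t:{0<..<T}|lborel. LINT x:cell|lborel. F (t, x))"
    and "AE t in lborel. t \<in> {0<..<T} \<longrightarrow> set_integrable lborel cell (\<lambda>x. F (t, x))"
proof -
  define H where "H = (\<lambda>z. indicator ({0<..<T} \<times> cell) z *\<^sub>R F z)"
  have H: "integrable (lborel \<Otimes>\<^sub>M lborel) H"
    using F unfolding set_integrable_def H_def lborel_prod .
  have eq: "(\<integral>x. H (t, x) \<partial>lborel) = indicator {0<..<T} t *\<^sub>R (LINT x:cell|lborel. F (t, x))" for t
    by (cases "t \<in> {0<..<T}") (simp_all add: H_def indicator_times set_lebesgue_integral_def)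
  show "set_integrable lborel {0<..<T} (\<lambda>t. LINT x:cell|lborel. F (t, x))"
    using lborel_pair.integrable_fst'[OF H] unfolding set_integrable_def eq .
  show "(LINT z:{0<..<T} \<times> cell|lborel. F z) = (LINT t:{0<..<T}|lborel. LINT x:cell|lborel. F (t, x))"
    using lborel_pair.integral_fst'[OF H, symmetric] unfolding eq lborel_prod
    by (simp add: set_lebesgue_integral_def H_def)
  show "AE t in lborel. t \<in> {0<..<T} \<longrightarrow> set_integrable lborel cell (\<lambda>x. F (t, x))"
    using lborel_pair.AE_integrable_fst'[OF H]
    by eventually_elim (auto simp: H_def indicator_times set_integrable_def)
qed

lemma slab_AE:
  assumes "AE z in (lborel :: (real \<times> (real ^ 'd)) measure). P z"
  shows "AE t in lborel. AE x in lborel. P (t, x)"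
  using lborel_pair.AE_pair assms unfolding lborel_prod by blast

lemma set_integrable_inner_bounded:
  fixes V h :: "'a \<Rightarrow> 'b::euclidean_space"
  assumes V: "set_integrable M S V" and h: "h \<in> borel_measurable M"
    and B: "\<And>z. z \<in> S \<Longrightarrow> norm (h z) \<le> B"
  shows "set_integrable M S (\<lambda>z. V z \<bullet> h z)"
  unfolding set_integrable_def
proof (rule Bochner_Integration.integrable_bound)
  have V': "integrable M (\<lambda>z. indicator S z *\<^sub>R V z)" using V by (simp add: set_integrable_def)
  show "integrable M (\<lambda>z. B * norm (indicator S z *\<^sub>R V z))"
    by (intro integrable_mult_right integrable_norm V')
  have "(\<lambda>z. (indicator S z *\<^sub>R V z) \<bullet> h z) \<in> borel_measurable M"
    by (intro borel_measurable_inner borel_measurable_integrable[OF V'] h)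
  then show "(\<lambda>z. indicator S z *\<^sub>R (V z \<bullet> h z)) \<in> borel_measurable M" by simp
  show "AE z in M. norm (indicator S z *\<^sub>R (V z \<bullet> h z)) \<le> norm (B * norm (indicator S z *\<^sub>R V z))"
  proof (rule AE_I2)
    fix z
    show "norm (indicator S z *\<^sub>R (V z \<bullet> h z)) \<le> norm (B * norm (indicator S z *\<^sub>R V z))"
    proof (cases "z \<in> S")
      case True
      have "\<bar>V z \<bullet> h z\<bar> \<le> norm (V z) * B"
        by (rule order_trans[OF Cauchy_Schwarz_ineq2]) (intro mult_left_mono B True norm_ge_zero)
      then show ?thesis using True order_trans[OF norm_ge_zero B[OF True]] by (simp add: abs_mult mult.commute)
    qed simp
  qed
qed

text \<open>The counterpart of \<open>C1_on_torus\<close> with the derivatives named as functions,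
  so that computed expressions such as \<open>Pt\<close> and \<open>Px\<close> can take the place of
  \<open>dTw\<close> and \<open>dX\<close>.\<close>

definition C1_with :: "real \<Rightarrow> (real \<Rightarrow> real ^ 'd \<Rightarrow> 'b::real_normed_vector) \<Rightarrow> (real \<Rightarrow> real ^ 'd \<Rightarrow> 'b)
    \<Rightarrow> ('d \<Rightarrow> real \<Rightarrow> real ^ 'd \<Rightarrow> 'b) \<Rightarrow> bool" where
  "C1_with T f ft fx \<longleftrightarrow> periodic_x f
     \<and> continuous_on ({0..T} \<times> UNIV) (\<lambda>z. f (fst z) (snd z))
     \<and> continuous_on ({0..T} \<times> UNIV) (\<lambda>z. ft (fst z) (snd z))
     \<and> (\<forall>j. continuous_on ({0..T} \<times> UNIV) (\<lambda>z. fx j (fst z) (snd z)))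
     \<and> (\<forall>t\<in>{0..T}. \<forall>x. ((\<lambda>s. f s x) has_vector_derivative ft t x) (at t within {0..T}))
     \<and> (\<forall>t\<in>{0..T}. \<forall>x j. ((\<lambda>h. f t (x + h *\<^sub>R axis j 1)) has_vector_derivative fx j t x) (at 0))"

lemma integral_Ioo_eq_FTC:
  fixes F f :: "real \<Rightarrow> real"
  assumes "t \<le> T" and f: "continuous_on {t..T} f"
    and F: "\<And>s. s \<in> {t..T} \<Longrightarrow> (F has_vector_derivative f s) (at s within {t..T})"
  shows "(LINT s:{t<..<T}|lborel. f s) = F T - F t"
proof -
  have i: "set_integrable lborel {t<..<T} f"
    by (rule set_integrable_subset[OF borel_integrable_compact[of "{t..T}", folded set_integrable_def]])
      (auto intro: continuous_on_subset[OF f])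
  have "(LINT s:{t<..<T}|lborel. f s) = integral {t..T} f"
    using set_borel_integral_eq_integral(2)[OF i] by (simp add: integral_open_interval_real)
  also have "\<dots> = F T - F t"
    by (intro integral_unique fundamental_theorem_of_calculus assms(1) F)
  finally show ?thesis .
qed

text \<open>Composition with \<open>clip T\<close> extends a function given on [0,T] to all times,
  constant in time outside, which keeps it continuous and thus globally measurable.\<close>

definition clip :: "real \<Rightarrow> real \<Rightarrow> real" where
  "clip T t = max 0 (min T t)"

lemma continuous_clip:
  assumes "0 < T" "continuous_on ({0..T} \<times> UNIV) (\<lambda>z. f (fst z) (snd z))"
  shows "continuous_on UNIV (\<lambda>z. f (clip T (fst z)) (snd z))"
proof -
  have c: "continuous_on UNIV (\<lambda>z. (clip T (fst z), snd z))"
    unfolding clip_def by (intro continuous_intros)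
  have "(\<lambda>z. (clip T (fst z), snd z)) ` UNIV \<subseteq> {0..T} \<times> UNIV"
    using assms(1) by (auto simp: clip_def)
  from continuous_on_compose2[OF assms(2) c this] show ?thesis by simp
qed

lemma clip_eq: "t \<in> {0..T} \<Longrightarrow> clip T t = t" by (simp add: clip_def)
lemma clip_mem: "0 < T \<Longrightarrow> clip T t \<in> {0..T}" by (simp add: clip_def)

lemma C1_with_periodic_deriv:
  assumes "C1_with T f ft fx" "t \<in> {0..T}"
  shows "fx j t (x + axis k 1) = fx j t x"
proof -
  have f: "f t (y + axis k 1) = f t y" for y using assms by (simp add: C1_with_def periodic_x_def)
  have "((\<lambda>h. f t (x + axis k 1 + h *\<^sub>R axis j 1)) has_vector_derivative fx j t (x + axis k 1)) (at 0)"
    using assms by (simp add: C1_with_def)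
  then have "((\<lambda>h. f t (x + h *\<^sub>R axis j 1)) has_vector_derivative fx j t (x + axis k 1)) (at 0)"
    using f[of "x + h *\<^sub>R axis j 1" for h] by (simp add: algebra_simps)
  moreover have "((\<lambda>h. f t (x + h *\<^sub>R axis j 1)) has_vector_derivative fx j t x) (at 0)"
    using assms by (simp add: C1_with_def)
  ultimately show ?thesis by (rule vector_derivative_unique_at)
qed

section \<open>Balance identities at almost every time\<close>

context weak_balance begin

lemma defect_set_integrable:
  fixes G :: "'d \<Rightarrow> real \<Rightarrow> real ^ 'd \<Rightarrow> 'b"
  assumes G: "\<And>j. continuous_on UNIV (\<lambda>z. G j (fst z) (snd z))" and per: "\<And>j. periodic_x (G j)"
  shows "set_integrable lborel {0<..<T} (\<lambda>t. defect t (\<lambda>j. G j t))"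
proof -
  have "\<exists>B. \<forall>t\<in>{0..T}. \<forall>x\<in>cell. norm (G j t x) \<le> B" for j
    using bounded_on_slab[OF continuous_on_subset[OF G[of j]], of 0 T] by (metis subset_UNIV)
  then obtain Bj where Bj: "\<And>j t x. t \<in> {0..T} \<Longrightarrow> x \<in> cell \<Longrightarrow> norm (G j t x) \<le> Bj j" by metis
  define B where "B = \<bar>Max (range Bj)\<bar>"
  have B: "norm (G j t x) \<le> B" if "t \<in> {0..T}" "x \<in> cell" for j t x
    unfolding B_def by (rule order_trans[OF Bj[OF that] order_trans[OF Max_ge abs_ge_self]]) auto
  obtain Bm where Bm: "AE t in lborel. t \<in> {0<..<T} \<longrightarrow> (\<forall>j. (\<integral>x. norm (\<Theta> j t x) \<partial>\<mu> t) \<le> Bm)"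
    using \<Theta>_bounded by blast
  show ?thesis
    unfolding set_integrable_def
  proof (rule Bochner_Integration.integrable_bound)
    show "integrable lborel (\<lambda>t. indicator {0<..<T} t *\<^sub>R (B * (\<Sum>j\<in>(UNIV::'d set). Bm)))"
      by (intro integrable_scaleR_left) (auto intro!: integrable_real_indicator simp: emeasure_lborel_Ioo T less_imp_le)
    show "(\<lambda>t. indicator {0<..<T} t *\<^sub>R defect t (\<lambda>j. G j t)) \<in> borel_measurable lborel"
      using defect_measurable[OF G per] by (simp add: set_borel_measurable_def)
    show "AE t in lborel. norm (indicator {0<..<T} t *\<^sub>R defect t (\<lambda>j. G j t))
        \<le> norm (indicator {0<..<T} t *\<^sub>R (B * (\<Sum>j\<in>(UNIV::'d set). Bm)))"
      using Bm
    proof eventually_elim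
      case (elim t)
      show ?case
      proof (cases "t \<in> {0<..<T}")
        case True
        then have t: "t \<in> {0..T}" by auto
        have "\<bar>defect t (\<lambda>j. G j t)\<bar> \<le> B * (\<Sum>j\<in>UNIV. \<integral>x. norm (\<Theta> j t x) \<partial>\<mu> t)"
          by (rule defect_integrable(2)[OF True continuous_slice[OF G] B[OF t]])
        also have "\<dots> \<le> B * (\<Sum>j\<in>(UNIV::'d set). Bm)"
          using elim True by (intro mult_left_mono sum_mono) (auto simp: B_def)
        also have "\<dots> \<le> \<bar>B * (\<Sum>j\<in>(UNIV::'d set). Bm)\<bar>" by (rule abs_ge_self)
        finally show ?thesis using True by simp
      qed simp
    qed
  qed
qed

lemma set_integrable_inner_C0:
  fixes h :: "real \<Rightarrow> real ^ 'd \<Rightarrow> 'c::euclidean_space"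
  assumes Y: "set_integrable lborel ({0<..<T} \<times> cell) Y"
    and h: "continuous_on ({0..T} \<times> UNIV) (\<lambda>z. h (fst z) (snd z))"
  shows "set_integrable lborel ({0<..<T} \<times> cell) (\<lambda>z. Y z \<bullet> h (fst z) (snd z))"
proof -
  obtain B where "0 \<le> B" and B: "\<And>t x. t \<in> {0..T} \<Longrightarrow> x \<in> cell \<Longrightarrow> norm (h t x) \<le> B"
    using bounded_on_slab[OF h] by metis
  have "set_integrable lborel ({0<..<T} \<times> cell) (\<lambda>z. Y z \<bullet> h (clip T (fst z)) (snd z))"
  proof (rule set_integrable_inner_bounded[OF Y])
    show "(\<lambda>z. h (clip T (fst z)) (snd z)) \<in> borel_measurable lborel"
      using borel_measurable_continuous_onI[OF continuous_clip[OF T h]] by simp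
    show "norm (h (clip T (fst z)) (snd z)) \<le> B" if "z \<in> {0<..<T} \<times> cell" for z
      using that B[OF clip_mem[OF T]] by auto
  qed
  then show ?thesis
    by (subst (asm) set_integrable_cong[OF refl refl, where f' = "\<lambda>z. Y z \<bullet> h (fst z) (snd z)"]) (auto simp: clip_eq)
qed

text \<open>Formally the time derivative of the cell integral of \<open>V\<close> tested against
  \<open>f\<close>, where \<open>ft\<close> and \<open>fx\<close> are the derivatives of
  \<open>f\<close>.\<close>

definition flux_rate :: "(real \<Rightarrow> real ^ 'd \<Rightarrow> 'b) \<Rightarrow> ('d \<Rightarrow> real \<Rightarrow> real ^ 'd \<Rightarrow> 'b) \<Rightarrow> real \<Rightarrow> real" where
  "flux_rate ft fx t = (LINT x:cell|lborel. V (t, x) \<bullet> ft t x + (\<Sum>j\<in>UNIV. W j (t, x) \<bullet> fx j t x))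
    + defect t (\<lambda>j. fx j t)"

text \<open>Testing with \<zeta>(t) f(t,x), where \<zeta> is the integral of an arbitrary admissible
  \<omega> over (t,T), and integrating by parts in time shows that the difference of the two sides
  is orthogonal to \<omega>. The fundamental lemma then gives equality at almost every time, and the
  initial datum enters through \<zeta>(0), the total integral of \<omega>.\<close>

lemma balance_AE:
  assumes f: "C1_with T f ft fx"
  shows "set_integrable lborel {0<..<T} (\<lambda>t. LINT x:cell|lborel. V (t, x) \<bullet> f t x)"
    and "set_integrable lborel {0<..<T} (flux_rate ft fx)"
    and "AE t in lborel. t \<in> {0<..<T} \<longrightarrow> (LINT x:cell|lborel. V (t, x) \<bullet> f t x)
      = (LINT x:cell|lborel. V0 x \<bullet> f 0 x) + (LINT s:{0<..<t}|lborel. flux_rate ft fx s)"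
proof -
  let ?S = "{0<..<T} \<times> (cell :: (real ^ 'd) set)"
  have mS: "?S \<in> sets borel"
    unfolding borel_prod[symmetric] by (intro pair_measureI) auto
  have per: "periodic_x f" and cf: "continuous_on ({0..T} \<times> UNIV) (\<lambda>z. f (fst z) (snd z))"
    "continuous_on ({0..T} \<times> UNIV) (\<lambda>z. ft (fst z) (snd z))"
    "\<And>j. continuous_on ({0..T} \<times> UNIV) (\<lambda>z. fx j (fst z) (snd z))"
    and df: "\<And>t x. t \<in> {0..T} \<Longrightarrow> ((\<lambda>s. f s x) has_vector_derivative ft t x) (at t within {0..T})"
      "\<And>t x j. t \<in> {0..T} \<Longrightarrow> ((\<lambda>h. f t (x + h *\<^sub>R axis j 1)) has_vector_derivative fx j t x) (at 0)"
    using f by (auto simp: C1_with_def)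
  define P where "P z = V z \<bullet> f (fst z) (snd z)" for z
  define Q where "Q z = V z \<bullet> ft (fst z) (snd z) + (\<Sum>j\<in>UNIV. W j z \<bullet> fx j (fst z) (snd z))" for z
  define a where "a t = (LINT x:cell|lborel. P (t, x))" for t
  define q where "q t = (LINT x:cell|lborel. Q (t, x))" for t
  define d where "d t = defect t (\<lambda>j. fx j t)" for t
  define b where "b t = q t + d t" for t
  define a0 where "a0 = (LINT x:cell|lborel. V0 x \<bullet> f 0 x)"
  have b_eq: "b = flux_rate ft fx" by (auto simp: b_def q_def d_def Q_def flux_rate_def)
  have P: "set_integrable lborel ?S P" unfolding P_def by (intro set_integrable_inner_C0 V cf)
  have Q: "set_integrable lborel ?S Q"
  proof -
    have "set_integrable lborel ?S (\<lambda>z. W j z \<bullet> fx j (fst z) (snd z))" for j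
      by (intro set_integrable_inner_C0 W cf)
    then have "set_integrable lborel ?S (\<lambda>z. \<Sum>j\<in>UNIV. W j z \<bullet> fx j (fst z) (snd z))"
      unfolding set_integrable_def scaleR_sum_right by (rule Bochner_Integration.integrable_sum)
    then show ?thesis
      unfolding Q_def by (intro set_integral_add set_integrable_inner_C0 V cf)
  qed
  have ia: "set_integrable lborel {0<..<T} a" unfolding a_def by (rule slab_Fubini(1)[OF P])
  have iq: "set_integrable lborel {0<..<T} q" unfolding q_def by (rule slab_Fubini(1)[OF Q])
  have "set_integrable lborel {0<..<T} (\<lambda>t. defect t (\<lambda>j. fx j (clip T t)))"
    by (rule defect_set_integrable[OF continuous_clip[OF T cf(3)]])
      (simp add: periodic_x_def C1_with_periodic_deriv[OF f clip_mem[OF T]])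
  then have id: "set_integrable lborel {0<..<T} d"
    by (subst (asm) set_integrable_cong[OF refl refl, where f' = d]) (auto simp: clip_eq d_def)
  have ib: "set_integrable lborel {0<..<T} b" unfolding b_def by (intro set_integral_add iq id)
  show "set_integrable lborel {0<..<T} (\<lambda>t. LINT x:cell|lborel. V (t, x) \<bullet> f t x)"
    using ia by (simp add: a_def[abs_def] P_def)
  show "set_integrable lborel {0<..<T} (flux_rate ft fx)" using ib by (simp add: b_eq)
  define Bf where "Bf s = (LINT t:{0<..<s}|lborel. b t)" for s
  have iB: "set_integrable lborel {0<..<T} Bf"
    using integration_by_parts_indefinite(1)[OF ib, of "\<lambda>_. 1"] by (simp add: Bf_def[abs_def])
  have ic: "set_integrable lborel {0<..<T} (\<lambda>_. a0)"
    unfolding set_integrable_def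
    by (intro integrable_scaleR_left) (auto intro!: integrable_real_indicator simp: emeasure_lborel_Ioo T less_imp_le)
  have bdd: "set_integrable lborel {0<..<T} (\<lambda>t. w t * y t)"
    if w: "continuous_on UNIV w" and y: "set_integrable lborel {0<..<T} y" for w y :: "real \<Rightarrow> real"
  proof -
    have "compact (w ` {0..T})" by (intro compact_continuous_image continuous_on_subset[OF w]) auto
    then obtain B where "\<And>t. t \<in> {0..T} \<Longrightarrow> norm (w t) \<le> B"
      by (metis compact_imp_bounded bounded_iff imageI)
    then have "set_integrable lborel {0<..<T} (\<lambda>t. y t \<bullet> w t)"
      by (intro set_integrable_inner_bounded[OF y, where B = B]) (auto intro!: borel_measurable_continuous_onI w)
    then show ?thesis by (simp add: mult.commute)
  qed
  have bddS: "set_integrable lborel ?S (\<lambda>z. w (fst z) * Y z)"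
    if w: "continuous_on UNIV w" and Y: "set_integrable lborel ?S Y" for w :: "real \<Rightarrow> real" and Y
  proof -
    have "continuous_on ({0..T} \<times> UNIV) (\<lambda>z::real \<times> (real ^ 'd). w (fst z))"
      by (intro continuous_on_compose2[OF w] continuous_intros) auto
    from set_integrable_inner_C0[OF Y this] show ?thesis by (simp add: mult.commute)
  qed
  have FubS: "(LINT z:?S|lborel. w (fst z) * Y z) = (LINT t:{0<..<T}|lborel. w t * (LINT x:cell|lborel. Y (t, x)))"
    if w: "continuous_on UNIV w" and Y: "set_integrable lborel ?S Y" for w :: "real \<Rightarrow> real" and Y
    using slab_Fubini(2)[OF bddS[OF w Y]] by simp
  have "AE t in lborel. t \<in> {0<..<T} \<longrightarrow> a t - a0 - Bf t = 0"
  proof (rule AE_zero_if_test_integrals_zero)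
    show "set_integrable lborel {0<..<T} (\<lambda>t. a t - a0 - Bf t)"
      by (intro set_integral_diff ia ic iB)
    fix \<omega> :: "real \<Rightarrow> real" and \<delta> :: real
    assume \<omega>: "continuous_on UNIV \<omega>" and \<delta>: "0 < \<delta>" and van: "\<And>t. T - \<delta> \<le> t \<Longrightarrow> \<omega> t = 0"
    obtain \<Omega> where \<Omega>: "\<And>t. (\<Omega> has_real_derivative \<omega> t) (at t)"
    proof -
      have "\<exists>F. \<forall>x. -\<infinity> < ereal x \<longrightarrow> ereal x < \<infinity> \<longrightarrow> (F has_vector_derivative \<omega> x) (at x)"
        using \<omega> by (intro einterval_antiderivative) (auto simp: continuous_on_eq_continuous_at)
      then show thesis using that by (auto simp: has_real_derivative_iff_has_vector_derivative)
    qed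
    \<comment> \<open>The primitive of \<open>- \<omega>\<close> that vanishes at \<open>T\<close>;
      as \<open>\<omega>\<close> vanishes near \<open>T\<close>, so does
      \<open>\<zeta>\<close>.\<close>
    define \<zeta> where "\<zeta> t = \<Omega> T - \<Omega> t" for t
    have d\<zeta>: "(\<zeta> has_real_derivative - \<omega> t) (at t)" for t
      unfolding \<zeta>_def by (rule derivative_eq_intros \<Omega> | simp)+
    have c\<zeta>: "continuous_on UNIV \<zeta>"
      using d\<zeta> by (meson DERIV_isCont continuous_at_imp_continuous_on)
    have \<zeta>0: "\<zeta> t = 0" if "T - \<delta> \<le> t" for t
    proof -
      have "\<exists>c. \<forall>s\<in>{T-\<delta>..}. \<Omega> s = c"
      proof (rule has_field_derivative_zero_constant)
        fix s assume "s \<in> {T-\<delta>..}"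
        then have "\<omega> s = 0" by (simp add: van)
        then show "(\<Omega> has_real_derivative 0) (at s within {T-\<delta>..})"
          using has_field_derivative_at_within[OF \<Omega>[of s]] by metis
      qed simp
      then have "\<Omega> T = \<Omega> t" using that \<delta> by auto
      then show ?thesis by (simp add: \<zeta>_def)
    qed
    have \<zeta>int: "(LINT s:{t<..<T}|lborel. \<omega> s) = \<zeta> t" if "t \<le> T" for t
      unfolding \<zeta>_def
    proof (rule integral_Ioo_eq_FTC[OF that])
      show "continuous_on {t..T} \<omega>" using \<omega> by (rule continuous_on_subset) simp
      show "(\<Omega> has_vector_derivative \<omega> s) (at s within {t..T})" for s
        using \<Omega> by (simp add: has_real_derivative_iff_has_vector_derivative has_vector_derivative_at_within)
    qed
    \<comment> \<open>Clipping may leave kinks in time at 0 and at \<open>T\<close>. The kink at 0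
      lies outside the positive times at which \<open>weak_C1\<close> asks for a derivative, and the
      one at \<open>T\<close> is hidden by the vanishing of \<open>\<zeta>\<close> there.\<close>
    define g where "g t x = \<zeta> t *\<^sub>R f (clip T t) x" for t x
    define gt where "gt t x = (- \<omega> t) *\<^sub>R f (clip T t) x + \<zeta> t *\<^sub>R ft (clip T t) x" for t x
    define gx where "gx j t x = \<zeta> t *\<^sub>R fx j (clip T t) x" for j t x
    have cz: "continuous_on UNIV (\<lambda>z::real \<times> (real ^ 'd). \<zeta> (fst z))" "continuous_on UNIV (\<lambda>z::real \<times> (real ^ 'd). \<omega> (fst z))"
      by (intro continuous_on_compose2[OF c\<zeta>] continuous_on_compose2[OF \<omega>] continuous_intros; simp)+
    have main: "(LINT z : ?S | lborel.
          V z \<bullet> gt (fst z) (snd z) + (\<Sum>j\<in>UNIV. W j z \<bullet> gx j (fst z) (snd z)))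
        + (LINT t : {0<..<T} | lborel. defect t (\<lambda>j. gx j t))
        = - (LINT x : cell | lborel. V0 x \<bullet> g 0 x)"
    proof (rule weak_C1)
      show "periodic_x g" using per by (simp add: periodic_x_def g_def)
      show "continuous_on UNIV (\<lambda>z. g (fst z) (snd z))" unfolding g_def
        by (intro continuous_on_scaleR cz continuous_clip[OF T cf(1)])
      show "continuous_on UNIV (\<lambda>z. gt (fst z) (snd z))" unfolding gt_def
        by (intro continuous_on_add continuous_on_scaleR continuous_on_minus cz continuous_clip[OF T cf(1)] continuous_clip[OF T cf(2)])
      show "continuous_on UNIV (\<lambda>z. gx j (fst z) (snd z))" for j unfolding gx_def
        by (intro continuous_on_scaleR cz continuous_clip[OF T cf(3)])
      show "((\<lambda>s. g s x) has_vector_derivative gt t x) (at t)" if "0 < t" for t x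
      proof (cases "t < T")
        case True
        have at: "at t within {0..T} = at t" using True that by (intro at_within_interior) auto
        have "((\<lambda>s. \<zeta> s *\<^sub>R f s x) has_vector_derivative (\<zeta> t *\<^sub>R ft t x + (- \<omega> t) *\<^sub>R f t x)) (at t)"
          using has_vector_derivative_scaleR[OF d\<zeta> df(1)[of t x, unfolded at]] True that by simp
        then have "((\<lambda>s. \<zeta> s *\<^sub>R f s x) has_vector_derivative gt t x) (at t)"
          using True that by (simp add: gt_def clip_eq add.commute)
        then show ?thesis
          by (rule has_vector_derivative_transform_within_open[of _ _ _ "{0<..<T}"])
            (use True that in \<open>auto simp: g_def clip_eq\<close>)
      next
        case False
        then have "gt t x = 0" using \<delta> by (simp add: gt_def van \<zeta>0)
        then have "((\<lambda>s. 0) has_vector_derivative gt t x) (at t)" by simp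
        then show ?thesis
          by (rule has_vector_derivative_transform_within_open[of _ _ _ "{T-\<delta><..}"])
            (use False \<delta> in \<open>auto simp: g_def \<zeta>0\<close>)
      qed
      show "((\<lambda>h. g t (x + h *\<^sub>R axis j 1)) has_vector_derivative gx j t x) (at 0)" for t x j
        unfolding g_def gx_def
        using has_vector_derivative_scaleR[OF DERIV_const df(2)[OF clip_mem[OF T]]] by simp
      show "0 < \<delta>" by (rule \<delta>)
      show "g t x = 0" if "T - \<delta> \<le> t" for t x using that by (simp add: g_def \<zeta>0)
    qed
    have "(LINT z:?S|lborel. V z \<bullet> gt (fst z) (snd z) + (\<Sum>j\<in>UNIV. W j z \<bullet> gx j (fst z) (snd z)))
      = (LINT z:?S|lborel. \<zeta> (fst z) * Q z - \<omega> (fst z) * P z)"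
      by (rule set_lebesgue_integral_cong)
        (auto simp: mS gt_def gx_def P_def Q_def clip_eq inner_add_right algebra_simps sum_distrib_left)
    also have "\<dots> = (LINT z:?S|lborel. \<zeta> (fst z) * Q z) - (LINT z:?S|lborel. \<omega> (fst z) * P z)"
      by (rule set_integral_diff(2)[OF bddS[OF c\<zeta> Q] bddS[OF \<omega> P]])
    also have "\<dots> = (LINT t:{0<..<T}|lborel. \<zeta> t * q t) - (LINT t:{0<..<T}|lborel. \<omega> t * a t)"
      unfolding FubS[OF c\<zeta> Q] FubS[OF \<omega> P] a_def q_def ..
    finally have e1: "(LINT z:?S|lborel. V z \<bullet> gt (fst z) (snd z) + (\<Sum>j\<in>UNIV. W j z \<bullet> gx j (fst z) (snd z)))
      = (LINT t:{0<..<T}|lborel. \<zeta> t * q t) - (LINT t:{0<..<T}|lborel. \<omega> t * a t)" .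
    have e2: "(LINT t : {0<..<T} | lborel. defect t (\<lambda>j. gx j t)) = (LINT t:{0<..<T}|lborel. \<zeta> t * d t)"
    proof (rule set_lebesgue_integral_cong)
      show "\<forall>t. t \<in> {0<..<T} \<longrightarrow> defect t (\<lambda>j. gx j t) = \<zeta> t * d t"
        by (auto simp: gx_def d_def defect_def clip_eq sum_distrib_left[symmetric])
    qed simp
    have e3: "(LINT x : cell | lborel. V0 x \<bullet> g 0 x) = \<zeta> 0 * a0"
      using T by (simp add: g_def a0_def clip_eq)
    have e4: "(LINT t:{0<..<T}|lborel. \<zeta> t * q t) + (LINT t:{0<..<T}|lborel. \<zeta> t * d t) = (LINT t:{0<..<T}|lborel. \<omega> t * Bf t)"
    proof -
      have "(LINT t:{0<..<T}|lborel. \<zeta> t * q t) + (LINT t:{0<..<T}|lborel. \<zeta> t * d t) = (LINT t:{0<..<T}|lborel. \<zeta> t * b t)"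
        by (subst set_integral_add(2)[symmetric]) (auto simp: b_def distrib_left intro!: bdd c\<zeta> iq id)
      also have "\<dots> = (LINT t:{0<..<T}|lborel. (LINT s:{t<..<T}|lborel. \<omega> s) * b t)"
        by (rule set_lebesgue_integral_cong) (auto simp: \<zeta>int)
      also have "\<dots> = (LINT t:{0<..<T}|lborel. \<omega> t * Bf t)"
        unfolding Bf_def by (rule integration_by_parts_indefinite(2)[OF ib \<omega>])
      finally show ?thesis .
    qed
    have "(LINT t:{0<..<T}|lborel. \<omega> t * (a t - a0 - Bf t)) = (LINT t:{0<..<T}|lborel. \<omega> t * a t - \<omega> t * a0 - \<omega> t * Bf t)"
      by (simp add: algebra_simps)
    also have "\<dots> = (LINT t:{0<..<T}|lborel. \<omega> t * a t) - (LINT t:{0<..<T}|lborel. \<omega> t * a0) - (LINT t:{0<..<T}|lborel. \<omega> t * Bf t)"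
      by (simp add: set_integral_diff bdd[OF \<omega>] ia ic iB)
    also have "(LINT t:{0<..<T}|lborel. \<omega> t * a0) = \<zeta> 0 * a0"
      using \<zeta>int[of 0] T by simp
    finally show "(LINT t:{0<..<T}|lborel. \<omega> t * (a t - a0 - Bf t)) = 0"
      using main e1 e2 e3 e4 by simp
  qed
  then show "AE t in lborel. t \<in> {0<..<T} \<longrightarrow> (LINT x:cell|lborel. V (t, x) \<bullet> f t x)
      = (LINT x:cell|lborel. V0 x \<bullet> f 0 x) + (LINT s:{0<..<t}|lborel. flux_rate ft fx s)"
    by eventually_elim (auto simp: a_def P_def a0_def Bf_def b_eq)
qed

end

section \<open>Calculus on the torus\<close>

lemma slab_swap:
  fixes F :: "real \<times> (real ^ 'd) \<Rightarrow> 'b::{banach, second_countable_topology}"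
  assumes F: "set_integrable lborel ({0<..<T} \<times> cell) F"
  shows "(LINT t:{0<..<T}|lborel. LINT x:cell|lborel. F (t, x)) = (LINT x:cell|lborel. LINT t:{0<..<T}|lborel. F (t, x))"
proof -
  define H where "H t x = indicator {0<..<T} t *\<^sub>R indicator cell x *\<^sub>R F (t, x)" for t and x :: "real ^ 'd"
  have "case_prod H = (\<lambda>z. indicator ({0<..<T} \<times> cell) z *\<^sub>R F z)"
    by (auto simp: H_def indicator_times)
  then have H: "integrable (lborel \<Otimes>\<^sub>M lborel) (case_prod H)"
    using F unfolding set_integrable_def lborel_prod by simp
  have 1: "(\<integral>x. H t x \<partial>lborel) = indicator {0<..<T} t *\<^sub>R (LINT x:cell|lborel. F (t, x))" for t
    by (cases "t \<in> {0<..<T}") (simp_all add: H_def set_lebesgue_integral_def)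
  have 2: "(\<integral>t. H t x \<partial>lborel) = indicator cell x *\<^sub>R (LINT t:{0<..<T}|lborel. F (t, x))" for x
    by (cases "x \<in> cell") (simp_all add: H_def set_lebesgue_integral_def)
  show ?thesis
    using lborel_pair.Fubini_integral[OF H] unfolding 1 2 by (simp add: set_lebesgue_integral_def)
qed

lemma slab_integrable_continuous:
  fixes F :: "real \<times> (real ^ 'd) \<Rightarrow> 'b::{banach, second_countable_topology}"
  assumes "continuous_on ({0..T} \<times> UNIV) F"
  shows "set_integrable lborel ({0<..<T} \<times> cell) F"
proof -
  have mS: "{0<..<T} \<times> (cell :: (real ^ 'd) set) \<in> sets borel"
    unfolding borel_prod[symmetric] by (intro pair_measureI) auto
  have "set_integrable lborel ({0..T} \<times> cbox 0 (\<Sum>i\<in>UNIV. axis i 1)) F"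
    unfolding set_integrable_def
    by (intro borel_integrable_compact compact_Times continuous_on_subset[OF assms]) auto
  then show ?thesis
    by (rule set_integrable_subset)
      (use mS in \<open>auto simp: cell_def mem_box_cart axis_def less_imp_le\<close>)
qed

lemma cell_integrable_continuous:
  fixes f :: "real ^ 'd \<Rightarrow> 'b::{banach, second_countable_topology}"
  assumes "continuous_on UNIV f"
  shows "set_integrable lborel cell f"
proof -
  have "set_integrable lborel (cbox 0 (\<Sum>i\<in>UNIV. axis i 1)) f"
    unfolding set_integrable_def
    by (intro borel_integrable_compact continuous_on_subset[OF assms]) auto
  then show ?thesis
    by (rule set_integrable_subset) (auto simp: cell_def mem_box_cart axis_def less_imp_le)
qed

lemma integral_lborel_translate:
  fixes g :: "'a::euclidean_space \<Rightarrow> real"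
  assumes "g \<in> borel_measurable borel"
  shows "(\<integral>x. g (c + x) \<partial>lborel) = (\<integral>x. g x \<partial>lborel)"
  using integral_distr[of "(+) c" lborel borel g] assms by (simp add: lborel_distr_plus)

text \<open>The shifted cell consists of the overlap \<open>A1\<close> with the cell and the
  protruding strip \<open>A2\<close>. A shift of the strip by one period fills the missing part
  \<open>A3\<close>, and periodicity leaves the integrand unchanged.\<close>

lemma cell_integral_translate:
  fixes f :: "real ^ 'd \<Rightarrow> real"
  assumes f: "continuous_on UNIV f" and per: "\<And>x. f (x + axis j 1) = f x" and h: "0 \<le> h" "h \<le> 1"
  shows "(LINT x:cell|lborel. f (x + h *\<^sub>R axis j 1)) = (LINT x:cell|lborel. f x)"
proof -
  define u :: "real ^ 'd" where "u = axis j 1"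
  have [measurable]: "f \<in> borel_measurable borel" using f by (rule borel_measurable_continuous_onI)
  define A1 where "A1 = {x \<in> cell. h \<le> x $ j}"
  define A2 where "A2 = {x :: real ^ 'd. x - h *\<^sub>R u \<in> cell \<and> 1 \<le> x $ j}"
  define A3 where "A3 = {x \<in> cell. x $ j < h}"
  have mj [measurable]: "(\<lambda>x :: real ^ 'd. x $ j) \<in> borel_measurable borel"
    by (intro borel_measurable_continuous_onI continuous_intros)
  have m [measurable]: "A1 \<in> sets borel" "A2 \<in> sets borel" "A3 \<in> sets borel"
    unfolding A1_def A2_def A3_def by measurable
  have c: "x - h *\<^sub>R u \<in> cell \<longleftrightarrow> (0 \<le> x $ j - h \<and> x $ j - h < 1) \<and> (\<forall>i. i \<noteq> j \<longrightarrow> 0 \<le> x $ i \<and> x $ i < 1)" for x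
    unfolding cell_def u_def by (auto simp: axis_def)
  have c0: "x \<in> cell \<longleftrightarrow> (0 \<le> x $ j \<and> x $ j < 1) \<and> (\<forall>i. i \<noteq> j \<longrightarrow> 0 \<le> x $ i \<and> x $ i < 1)" for x :: "real ^ 'd"
    unfolding cell_def by auto
  have i1: "indicator cell (x - h *\<^sub>R u) = indicator A1 x + (indicator A2 x :: real)" for x
    using h by (auto simp: A1_def A2_def c c0[of x] split: split_indicator)
  have i2: "indicator A2 (u + x) = (indicator A3 x :: real)" for x
    using h by (auto simp: A2_def A3_def c c0 u_def axis_def split: split_indicator)
  have i3: "indicator cell x = indicator A1 x + (indicator A3 x :: real)" for x
    by (auto simp: A1_def A3_def split: split_indicator)
  have "set_integrable lborel cell f" by (rule cell_integrable_continuous[OF f])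
  then have s13: "set_integrable lborel A1 f" "set_integrable lborel A3 f"
    by (auto elim!: set_integrable_subset simp: A1_def A3_def)
  have int1: "integrable lborel (\<lambda>x. indicator A1 x * f x)" "integrable lborel (\<lambda>x. indicator A3 x * f x)"
    using s13 by (simp_all add: set_integrable_def)
  have f2: "f (u + x) = f x" for x using per[of x] by (simp add: u_def add.commute)
  have "integrable (distr lborel borel ((+) u)) (\<lambda>x. indicator A2 x * f x)"
    by (subst integrable_distr_eq) (simp_all add: i2 f2 int1)
  then have int2: "integrable lborel (\<lambda>x. indicator A2 x * f x)" by (simp add: lborel_distr_plus)
  have "(LINT x:cell|lborel. f (x + h *\<^sub>R u)) = (\<integral>x. indicator cell ((h *\<^sub>R u + x) - h *\<^sub>R u) * f (h *\<^sub>R u + x) \<partial>lborel)"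
    by (simp add: set_lebesgue_integral_def add.commute)
  also have "\<dots> = (\<integral>x. indicator cell (x - h *\<^sub>R u) * f x \<partial>lborel)"
    by (rule integral_lborel_translate) measurable
  also have "\<dots> = (\<integral>x. indicator A1 x * f x \<partial>lborel) + (\<integral>x. indicator A2 x * f x \<partial>lborel)"
    by (simp add: i1 distrib_right int1 int2)
  also have "(\<integral>x. indicator A2 x * f x \<partial>lborel) = (\<integral>x. indicator A2 (u + x) * f (u + x) \<partial>lborel)"
    by (rule integral_lborel_translate[symmetric]) measurable
  also have "\<dots> = (\<integral>x. indicator A3 x * f x \<partial>lborel)" by (simp add: i2 f2)
  also have "(\<integral>x. indicator A1 x * f x \<partial>lborel) + \<dots> = (LINT x:cell|lborel. f x)"
    by (simp add: set_lebesgue_integral_def i3 distrib_right int1)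
  finally show ?thesis by (simp add: u_def)
qed

text \<open>All translates of \<open>f'\<close> in direction \<open>j\<close> have the same cell
  integral, so it equals its average over shifts \<open>s\<close> in (0,1). Interchanging the
  integrals, the average along each line is f(x + e_j) - f(x) = 0. This avoids slicing the cell
  along a coordinate.\<close>

lemma cell_integral_derivative_zero:
  fixes f f' :: "real ^ 'd \<Rightarrow> real"
  assumes f': "continuous_on UNIV f'" and per: "\<And>x. f (x + axis j 1) = f x" "\<And>x. f' (x + axis j 1) = f' x"
    and der: "\<And>x. ((\<lambda>h. f (x + h *\<^sub>R axis j 1)) has_vector_derivative f' x) (at 0)"
  shows "(LINT x:cell|lborel. f' x) = 0"
proof -
  define F where "F z = f' (snd z + fst z *\<^sub>R axis j 1)" for z
  have cF: "continuous_on S F" for S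
    unfolding F_def by (intro continuous_on_compose2[OF f'] continuous_intros) auto
  have F: "set_integrable lborel ({0<..<1} \<times> cell) F"
    by (rule slab_integrable_continuous[OF cF])
  have "(LINT s:{0<..<1}|lborel. F (s, x)) = 0" for x
  proof -
    have "(LINT s:{0<..<1}|lborel. F (s, x)) = f (x + 1 *\<^sub>R axis j 1) - f (x + 0 *\<^sub>R axis j 1)"
    proof (rule integral_Ioo_eq_FTC)
      show "continuous_on {0..1} (\<lambda>s. F (s, x))"
        by (intro continuous_on_compose2[OF cF[of UNIV]] continuous_intros) auto
      fix s :: real
      have "((\<lambda>h. f (x + (s + h) *\<^sub>R axis j 1)) has_vector_derivative F (s, x)) (at 0)"
        using der[of "x + s *\<^sub>R axis j 1"] by (simp add: F_def algebra_simps)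
      then have "((\<lambda>h. f (x + h *\<^sub>R axis j 1)) has_vector_derivative F (s, x)) (at s)"
        using has_vector_derivative_at_0_shift[of "\<lambda>h. f (x + h *\<^sub>R axis j 1)"] by simp
      then show "((\<lambda>h. f (x + h *\<^sub>R axis j 1)) has_vector_derivative F (s, x)) (at s within {0..1})"
        by (rule has_vector_derivative_at_within)
    qed simp
    then show ?thesis by (simp add: per)
  qed
  then have "0 = (LINT x:cell|lborel. LINT s:{0<..<1}|lborel. F (s, x))"
    by (simp add: set_lebesgue_integral_def)
  also have "\<dots> = (LINT s:{0<..<1}|lborel. LINT x:cell|lborel. F (s, x))"
    by (rule slab_swap[OF F, symmetric])
  also have "\<dots> = (LINT s:{0<..<1::real}|lborel. LINT x:cell|lborel. f' x)"
    by (rule set_lebesgue_integral_cong)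
      (auto simp: F_def intro!: cell_integral_translate f' per(2))
  also have "\<dots> = (LINT x:cell|lborel. f' x)" by (simp add: set_lebesgue_integral_def)
  finally show ?thesis by simp
qed

lemma cell_integral_time_FTC:
  fixes f ft :: "real \<Rightarrow> real ^ 'd \<Rightarrow> real"
  assumes f: "continuous_on ({0..T} \<times> UNIV) (\<lambda>z. f (fst z) (snd z))"
    and ft: "continuous_on ({0..T} \<times> UNIV) (\<lambda>z. ft (fst z) (snd z))"
    and der: "\<And>t x. t \<in> {0..T} \<Longrightarrow> ((\<lambda>s. f s x) has_vector_derivative ft t x) (at t within {0..T})"
    and t: "t \<in> {0<..<T}"
  shows "(LINT x:cell|lborel. f t x) = (LINT x:cell|lborel. f 0 x) + (LINT s:{0<..<t}|lborel. LINT x:cell|lborel. ft s x)"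
proof -
  have sub: "{0..t} \<times> UNIV \<subseteq> {0..T} \<times> (UNIV :: (real ^ 'd) set)" using t by auto
  have slice: "set_integrable lborel cell (f s)" if "s \<in> {0..T}" for s
    by (intro cell_integrable_continuous continuous_on_compose2[OF f, of _ "\<lambda>x. (s, x)", simplified])
      (use that in \<open>auto intro!: continuous_intros\<close>)
  have "(LINT s:{0<..<t}|lborel. LINT x:cell|lborel. ft s x) = (LINT x:cell|lborel. LINT s:{0<..<t}|lborel. ft s x)"
    using slab_swap[OF slab_integrable_continuous[OF continuous_on_subset[OF ft sub]]] by simp
  also have "\<dots> = (LINT x:cell|lborel. f t x - f 0 x)"
  proof (rule set_lebesgue_integral_cong)
    have "(LINT s:{0<..<t}|lborel. ft s x) = f t x - f 0 x" for x
    proof (rule integral_Ioo_eq_FTC)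
      show "continuous_on {0..t} (\<lambda>s. ft s x)"
      proof -
        have "(\<lambda>s. (s, x)) ` {0..t} \<subseteq> {0..T} \<times> UNIV" using t by auto
        then show ?thesis
          using continuous_on_compose2[OF ft, of "{0..t}" "\<lambda>s. (s, x)"] by (simp add: continuous_on_Pair continuous_on_id)
      qed
      show "((\<lambda>s. f s x) has_vector_derivative ft s x) (at s within {0..t})" if "s \<in> {0..t}" for s
        using that t by (intro has_vector_derivative_within_subset[OF der[of s x]]) auto
    qed (use t in auto)
    then show "\<forall>x. x \<in> cell \<longrightarrow> (LINT s:{0<..<t}|lborel. ft s x) = f t x - f 0 x" by blast
  qed simp
  also have "\<dots> = (LINT x:cell|lborel. f t x) - (LINT x:cell|lborel. f 0 x)"
    using t by (intro set_integral_diff slice) auto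
  finally show ?thesis by simp
qed

text \<open>The integral \<open>H\<close> of \<open>e\<close> is continuous but need not be C^1. Its
  majorant \<open>Y\<close>, the integral of the right-hand side, is C^1 because \<open>H\<close> is
  continuous, and the usual differential argument is carried out for \<open>Y\<close>.\<close>

lemma Gronwall_AE:
  fixes e :: "real \<Rightarrow> real"
  assumes e: "set_integrable lborel {0<..<T} e" and K: "0 \<le> K"
    and ineq: "AE t in lborel. t \<in> {0<..<T} \<longrightarrow> e t \<le> e0 + K * (LINT s:{0<..<t}|lborel. e s)"
  shows "AE t in lborel. t \<in> {0<..<T} \<longrightarrow> e t \<le> exp (K * t) * e0"
proof -
  define H where "H t = integral {0..t} e" for t
  have e_on: "set_integrable lborel {0<..<t} e" if "t \<le> T" for t
    by (rule set_integrable_subset[OF e]) (use that in auto)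
  have eq: "(LINT s:{0<..<t}|lborel. e s) = H t" if "t \<le> T" for t
    using set_borel_integral_eq_integral(2)[OF e_on[OF that]] by (simp add: H_def integral_open_interval_real)
  have "e integrable_on {0..T}"
    using set_borel_integral_eq_integral(1)[OF e] integrable_on_open_interval_real by blast
  then have cH: "continuous_on {0..T} H"
    unfolding H_def by (rule indefinite_integral_continuous_1)
  define Y where "Y t = integral {0..t} (\<lambda>s. e0 + K * H s)" for t
  have cont: "continuous_on {0..T} (\<lambda>s. e0 + K * H s)" by (intro continuous_intros cH)
  have dY: "(Y has_vector_derivative (e0 + K * H t)) (at t within {0..T})" if "t \<in> {0..T}" for t
    unfolding Y_def by (rule integral_has_vector_derivative[OF cont that])
  have HY: "H t \<le> Y t" if t: "t \<in> {0..T}" for t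
  proof -
    have c: "continuous_on {0..t} (\<lambda>s. e0 + K * H s)" by (rule continuous_on_subset[OF cont]) (use t in auto)
    have i: "set_integrable lborel {0<..<t} (\<lambda>s. e0 + K * H s)"
      by (rule set_integrable_subset[OF borel_integrable_compact[OF compact_Icc c, folded set_integrable_def]]) auto
    have "H t = (LINT s:{0<..<t}|lborel. e s)" using eq t by simp
    also have "\<dots> \<le> (LINT s:{0<..<t}|lborel. e0 + K * H s)"
    proof (rule set_integral_mono_AE)
      show "set_integrable lborel {0<..<t} e" using e_on t by simp
      show "AE s\<in>{0<..<t} in lborel. e s \<le> e0 + K * H s"
        using ineq by eventually_elim (use t in \<open>auto simp: eq\<close>)
    qed (rule i)
    also have "\<dots> = Y t"
      using set_borel_integral_eq_integral(2)[OF i] by (simp add: Y_def integral_open_interval_real)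
    finally show ?thesis .
  qed
  \<comment> \<open>The majorant with its integrating factor: the derivative is K^2 (H - Y) exp(-K
    t), which is nonpositive by \<open>HY\<close>.\<close>
  define Z where "Z t = (e0 + K * Y t) * exp (- (K * t))" for t
  have dZ: "(Z has_real_derivative (K * (e0 + K * H t) - K * (e0 + K * Y t)) * exp (- (K * t))) (at t within {0..T})"
    if "t \<in> {0..T}" for t
    unfolding Z_def
    by (rule derivative_eq_intros dY[OF that, folded has_real_derivative_iff_has_vector_derivative] refl | simp add: algebra_simps)+
  have Zle: "Z t \<le> Z 0" if t: "t \<in> {0..T}" for t
  proof (rule DERIV_nonpos_imp_decreasing_open[where f = Z and a = 0 and b = t])
    show "continuous_on {0..t} Z"
      by (rule continuous_on_subset[OF DERIV_continuous_on[OF dZ]]) (use t in auto)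
    fix s assume s: "0 < s" "s < t"
    then have "at s within {0..T} = at s" using t by (intro at_within_interior) auto
    moreover have "s \<in> {0..T}" using s t by auto
    moreover have "(K * (e0 + K * H s) - K * (e0 + K * Y s)) * exp (- (K * s)) \<le> 0"
      using HY[of s] s t K by (intro mult_nonpos_nonneg) (auto intro!: mult_left_mono)
    ultimately show "\<exists>y. (Z has_real_derivative y) (at s) \<and> y \<le> 0" using dZ[of s] by metis
  qed (use t in auto)
  have Z0: "Z 0 = e0" by (simp add: Z_def Y_def)
  show ?thesis
    using ineq
  proof eventually_elim
    case (elim t)
    show ?case
    proof
      assume t: "t \<in> {0<..<T}"
      then have "e t \<le> e0 + K * H t" using elim eq[of t] by simp
      also have "\<dots> \<le> e0 + K * Y t" using HY[of t] t K by (simp add: mult_left_mono)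
      also have "\<dots> = exp (K * t) * Z t" by (simp add: Z_def exp_minus)
      also have "\<dots> \<le> exp (K * t) * e0" using Zle[of t] t Z0 by simp
      finally show "e t \<le> exp (K * t) * e0" .
    qed
  qed
qed

section \<open>Classical solutions and the relative energy density\<close>

text \<open>Convexity of the power, read off from its second derivative on the open half-line; the
  vacuum state, at the boundary of that half-line, is computed directly.\<close>

lemma powr_above_tangent:
  fixes \<gamma> \<rho> r :: real
  assumes "1 < \<gamma>" "0 \<le> \<rho>" "0 < r"
  shows "0 \<le> \<rho> powr \<gamma> - r powr \<gamma> - \<gamma> * r powr (\<gamma> - 1) * (\<rho> - r)"
proof (cases "\<rho> = 0")
  case True
  have "r powr \<gamma> = r powr (\<gamma> - 1) * r" using assms(3) powr_add[of r "\<gamma> - 1" 1] by simp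
  moreover have "r powr (\<gamma> - 1) * r \<le> \<gamma> * (r powr (\<gamma> - 1) * r)"
    using assms by simp
  ultimately show ?thesis using True by simp
next
  case False
  have "\<gamma> * r powr (\<gamma> - 1) * (\<rho> - r) \<le> \<rho> powr \<gamma> - r powr \<gamma>"
  proof (rule f''_imp_f'[where C = "{0<..}" and f'' = "\<lambda>x. \<gamma> * ((\<gamma> - 1) * x powr (\<gamma> - 1 - 1))"])
    show "DERIV (\<lambda>x. x powr \<gamma>) x :> \<gamma> * x powr (\<gamma> - 1)" if "x \<in> {0<..}" for x
      using that by (intro has_real_derivative_powr) auto
    show "DERIV (\<lambda>x. \<gamma> * x powr (\<gamma> - 1)) x :> \<gamma> * ((\<gamma> - 1) * x powr (\<gamma> - 1 - 1))" if "x \<in> {0<..}" for x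
      using that by (intro DERIV_cmult has_real_derivative_powr) auto
  qed (use assms False in auto)
  then show ?thesis by simp
qed

lemma frob_eq_inner: "frob A B = A \<bullet> B"
  by (simp add: frob_def inner_vec_def)

lemma norm_tensor_self: "norm (tensor w w) = (norm w)\<^sup>2"
proof -
  have "(norm (tensor w w))\<^sup>2 = (\<Sum>i\<in>UNIV. \<Sum>j\<in>UNIV. (w $ i * w $ i) * (w $ j * w $ j))"
    unfolding power2_norm_eq_inner by (simp add: inner_vec_def tensor_def algebra_simps)
  also have "\<dots> = ((norm w)\<^sup>2)\<^sup>2"
    unfolding power2_norm_eq_inner[of w] by (simp add: inner_vec_def power2_eq_square sum_product)
  finally show ?thesis by (rule power2_eq_imp_eq) simp_all
qed

lemma trace_le_norm: "\<bar>\<Sum>j\<in>UNIV. (G :: real ^ 'd ^ 'd) $ j $ j\<bar> \<le> real CARD('d) * norm G"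
proof -
  have "\<bar>\<Sum>j\<in>UNIV. G $ j $ j\<bar> \<le> (\<Sum>j\<in>(UNIV :: 'd set). norm G)"
    by (intro order_trans[OF sum_abs] sum_mono order_trans[OF component_le_norm_cart Finite_Cartesian_Product.norm_nth_le])
  then show ?thesis by simp
qed

text \<open>The integrand of the relative energy balance, with \<open>c\<close> standing for \<open>\<gamma> r\<^bsup>\<gamma>-2\<^esup>\<close>,
  \<open>s\<close> for \<open>\<rho>\<^bsup>\<gamma>\<^esup>\<close> and \<open>R\<close> for \<open>r\<^bsup>\<gamma>\<^esup>\<close>.\<close>

lemma relative_energy_identity:
  fixes U Ut u :: "real ^ 'd" and Ux :: "'d \<Rightarrow> real ^ 'd" and rx :: "'d \<Rightarrow> real"
  assumes cont: "rt + (\<Sum>j\<in>UNIV. rx j * U $ j + r * Ux j $ j) = 0"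
    and mom: "\<And>i. Ut $ i + (\<Sum>j\<in>UNIV. U $ j * Ux j $ i) + c * rx i = 0"
  shows "- (\<rho> *\<^sub>R u) \<bullet> Ut - frob (\<rho> *\<^sub>R tensor u u) (\<chi> i j. Ux j $ i) - s * (\<Sum>j\<in>UNIV. Ux j $ j)
      + \<rho> * (U \<bullet> Ut - c * rt) + (\<Sum>j\<in>UNIV. (\<rho> *\<^sub>R u) $ j * (U \<bullet> Ux j - c * rx j)) + c * r * rt
    = - \<rho> * frob (tensor (u - U) (u - U)) (\<chi> i j. Ux j $ i)
      - (\<Sum>j\<in>UNIV. Ux j $ j) * (s - R - c * r * (\<rho> - r))
      - (\<Sum>j\<in>UNIV. c * r * rx j * U $ j + R * Ux j $ j)"
proof -
  \<comment> \<open>\<open>A\<close> and \<open>E\<close> are the derivatives of the velocity field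
    along \<open>U\<close> and along \<open>u\<close>, \<open>g\<close> is the gradient of
    \<open>r\<close> and \<open>dv\<close> the divergence of \<open>U\<close>. Once the two
    equations eliminate \<open>Ut\<close> and \<open>rt\<close>, both sides are polynomials in
    scalars and inner products of these vectors.\<close>
  define A where "A = (\<Sum>j\<in>UNIV. U $ j *\<^sub>R Ux j)"
  define E where "E = (\<Sum>j\<in>UNIV. u $ j *\<^sub>R Ux j)"
  define g where "g = (\<chi> j. rx j)"
  define dv where "dv = (\<Sum>j\<in>UNIV. Ux j $ j)"
  have Ut: "Ut = - A - c *\<^sub>R g"
    using mom by (simp add: vec_eq_iff A_def g_def eq_neg_iff_add_eq_0 algebra_simps)
  have rt: "rt = - (g \<bullet> U) - r * dv"
    using cont by (simp add: g_def dv_def inner_vec_def sum.distrib sum_distrib_left)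
  have f: "frob (tensor v w) (\<chi> i j. Ux j $ i) = v \<bullet> (\<Sum>j\<in>UNIV. w $ j *\<^sub>R Ux j)" for v w :: "real ^ 'd"
    by (simp add: frob_def tensor_def inner_vec_def sum_distrib_left mult.assoc)
  have f1: "frob (\<rho> *\<^sub>R tensor u u) (\<chi> i j. Ux j $ i) = \<rho> * (u \<bullet> E)"
    using f[of u u] by (simp add: frob_eq_inner E_def)
  have EA: "(\<Sum>j\<in>UNIV. (u - U) $ j *\<^sub>R Ux j) = E - A"
    by (simp add: E_def A_def scaleR_diff_left sum_subtractf)
  have f2: "frob (tensor (u - U) (u - U)) (\<chi> i j. Ux j $ i) = (u - U) \<bullet> (E - A)"
    unfolding f EA ..
  have s1: "(\<Sum>j\<in>UNIV. (\<rho> *\<^sub>R u) $ j * (U \<bullet> Ux j - c * rx j)) = \<rho> * (U \<bullet> E - c * (g \<bullet> u))"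
    by (simp add: E_def g_def inner_sum_right inner_vec_def[of _ u] sum_distrib_left sum_subtractf algebra_simps)
  have s2: "(\<Sum>j\<in>UNIV. c * r * rx j * U $ j + R * Ux j $ j) = c * r * (g \<bullet> U) + R * dv"
    by (simp add: g_def dv_def inner_vec_def sum.distrib sum_distrib_left mult.assoc)
  show ?thesis
    unfolding f1 f2 s1 s2 dv_def[symmetric] Ut rt
    by (simp add: inner_diff_left inner_diff_right inner_commute algebra_simps)
qed

lemma rel_density_split:
  "rel_density \<gamma> \<rho> u r U = 1/2 * \<rho> * (norm (u - U))\<^sup>2
    + 1 / (\<gamma> - 1) * (\<rho> powr \<gamma> - r powr \<gamma> - \<gamma> * r powr (\<gamma> - 1) * (\<rho> - r))"
  by (simp add: rel_density_def right_diff_distrib)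

lemma rel_density_nonneg:
  assumes "1 < \<gamma>" "0 \<le> \<rho>" "0 < r"
  shows "0 \<le> rel_density \<gamma> \<rho> u r U"
  unfolding rel_density_split using assms powr_above_tangent[OF assms]
  by (intro add_nonneg_nonneg mult_nonneg_nonneg) auto

text \<open>The state enters only through \<rho>, \<rho> u, \<rho> |u|^2 and the power of \<rho>,
  with coefficients that are constant for an integration over states. The pressure terms in
  \<open>r\<close> alone combine to one power because \<gamma>/(\<gamma>-1) - 1/(\<gamma>-1) =
  1.\<close>

lemma rel_density_expand:
  assumes "1 < \<gamma>" "0 < r"
  shows "rel_density \<gamma> \<rho> u r U = 1/2 * (\<rho> * (norm u)\<^sup>2) + 1 / (\<gamma> - 1) * \<rho> powr \<gamma>
    - (\<rho> *\<^sub>R u) \<bullet> U + \<rho> * (1/2 * (U \<bullet> U) - \<gamma> / (\<gamma> - 1) * r powr (\<gamma> - 1)) + r powr \<gamma>"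
proof -
  have 1: "r powr \<gamma> = r powr (\<gamma> - 1) * r" using assms(2) powr_add[of r "\<gamma> - 1" 1] by simp
  have 2: "(norm (u - U))\<^sup>2 = (norm u)\<^sup>2 - 2 * (u \<bullet> U) + U \<bullet> U"
    by (simp add: power2_norm_eq_inner inner_diff_left inner_diff_right inner_commute)
  define b where "b = 1 / (\<gamma> - 1)"
  have 3: "\<gamma> / (\<gamma> - 1) = 1 + b" "1 / (\<gamma> - 1) = b" using assms by (auto simp: b_def field_simps)
  show ?thesis
    unfolding rel_density_def 3 2 1 by (simp add: algebra_simps)
qed

text \<open>The kinetic factor \<open>k\<close> is at most twice the relative energy density, which
  accounts for 2. The relative pressure \<open>p\<close> is at most \<gamma> - 1 times that density,
  and the trace of \<open>G\<close> costs a factor of the dimension, which accounts for the other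
  summand.\<close>

lemma relative_energy_production_bound:
  fixes U u :: "real ^ 'd" and G :: "real ^ 'd ^ 'd"
  assumes "1 < \<gamma>" "0 \<le> \<rho>" "0 < r" "norm G \<le> \<Lambda>"
  shows "- \<rho> * frob (tensor (u - U) (u - U)) G
      - (\<Sum>j\<in>UNIV. G $ j $ j) * (\<rho> powr \<gamma> - r powr \<gamma> - \<gamma> * r powr (\<gamma> - 1) * (\<rho> - r))
    \<le> \<Lambda> * (2 + real CARD('d) * (\<gamma> - 1)) * rel_density \<gamma> \<rho> u r U"
proof -
  define k where "k = \<rho> * (norm (u - U))\<^sup>2"
  define p where "p = \<rho> powr \<gamma> - r powr \<gamma> - \<gamma> * r powr (\<gamma> - 1) * (\<rho> - r)"
  have p: "0 \<le> p" unfolding p_def by (rule powr_above_tangent[OF assms(1-3)])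
  have k: "0 \<le> k" using assms(2) by (simp add: k_def)
  have \<Lambda>: "0 \<le> \<Lambda>" using assms(4) norm_ge_zero order_trans by blast
  have "\<bar>frob (tensor (u - U) (u - U)) G\<bar> \<le> (norm (u - U))\<^sup>2 * \<Lambda>"
    unfolding frob_eq_inner
    by (rule order_trans[OF Cauchy_Schwarz_ineq2]) (simp add: norm_tensor_self mult_left_mono assms(4))
  then have "- frob (tensor (u - U) (u - U)) G \<le> (norm (u - U))\<^sup>2 * \<Lambda>" by linarith
  from mult_left_mono[OF this assms(2)] have 1: "- \<rho> * frob (tensor (u - U) (u - U)) G \<le> k * \<Lambda>"
    by (simp add: k_def mult.assoc)
  have "\<bar>\<Sum>j\<in>UNIV. G $ j $ j\<bar> \<le> real CARD('d) * \<Lambda>"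
    by (rule order_trans[OF trace_le_norm]) (simp add: mult_left_mono assms(4))
  then have "- (\<Sum>j\<in>UNIV. G $ j $ j) \<le> real CARD('d) * \<Lambda>" by linarith
  from mult_right_mono[OF this p] have 2: "- (\<Sum>j\<in>UNIV. G $ j $ j) * p \<le> real CARD('d) * \<Lambda> * p" .
  have rel: "rel_density \<gamma> \<rho> u r U = 1/2 * k + 1 / (\<gamma> - 1) * p"
    by (simp add: rel_density_split k_def p_def)
  have "\<Lambda> * (2 + real CARD('d) * (\<gamma> - 1)) * rel_density \<gamma> \<rho> u r U
    = k * \<Lambda> + real CARD('d) * \<Lambda> * p + (\<Lambda> * (real CARD('d) * (\<gamma> - 1)) * (1/2 * k) + \<Lambda> * 2 * (1 / (\<gamma> - 1) * p))"
    using assms(1) unfolding rel by (simp add: field_simps)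
  moreover have "0 \<le> \<Lambda> * (real CARD('d) * (\<gamma> - 1)) * (1/2 * k) + \<Lambda> * 2 * (1 / (\<gamma> - 1) * p)"
    using assms(1) k p \<Lambda> by (intro add_nonneg_nonneg mult_nonneg_nonneg) auto
  ultimately show ?thesis using 1 2 unfolding p_def[symmetric] by linarith
qed

section \<open>Nonconservative equations and derivatives for the classical solution\<close>

lemma C1_on_torus_with:
  assumes "C1_on_torus T f"
  shows "C1_with T f (dTw {0..T} f) (\<lambda>j. dX j f)"
  using assms unfolding C1_on_torus_def C1_with_def dTw_def dX_def
  by (auto simp: vector_derivative_works)

lemma C1_withD:
  assumes "C1_with T f ft fx"
  shows "periodic_x f" "continuous_on ({0..T} \<times> UNIV) (\<lambda>z. f (fst z) (snd z))"
    "continuous_on ({0..T} \<times> UNIV) (\<lambda>z. ft (fst z) (snd z))"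
    "continuous_on ({0..T} \<times> UNIV) (\<lambda>z. fx j (fst z) (snd z))"
    "t \<in> {0..T} \<Longrightarrow> ((\<lambda>s. f s x) has_vector_derivative ft t x) (at t within {0..T})"
    "t \<in> {0..T} \<Longrightarrow> ((\<lambda>h. f t (x + h *\<^sub>R axis j 1)) has_vector_derivative fx j t x) (at 0)"
  using assms by (auto simp: C1_with_def)

locale classical_flow =
  fixes \<gamma> T :: real and r :: "real \<Rightarrow> real ^ 'd \<Rightarrow> real" and U :: "real \<Rightarrow> real ^ 'd \<Rightarrow> real ^ 'd"
  assumes \<gamma>: "1 < \<gamma>" and T: "0 < T" and cs: "classical_solution \<gamma> T r U"
begin

abbreviation "rt \<equiv> dTw {0..T} r"
abbreviation "rx j \<equiv> dX j r"
abbreviation "Ut \<equiv> dTw {0..T} U"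
abbreviation "Ux j \<equiv> dX j U"

lemma r_pos: "0 < r t x" using cs by (simp add: classical_solution_def)

lemma r_C1: "C1_with T r rt rx" and U_C1: "C1_with T U Ut Ux"
  using cs by (simp_all add: classical_solution_def C1_on_torus_with)

lemma r_dt: "t \<in> {0..T} \<Longrightarrow> ((\<lambda>s. r s x) has_real_derivative rt t x) (at t within {0..T})"
  and r_dx: "t \<in> {0..T} \<Longrightarrow> ((\<lambda>h. r t (x + h *\<^sub>R axis j 1)) has_real_derivative rx j t x) (at 0)"
  using C1_withD(5,6)[OF r_C1] by (simp_all add: has_real_derivative_iff_has_vector_derivative)

lemma U_dt: "t \<in> {0..T} \<Longrightarrow> ((\<lambda>s. U s x $ i) has_real_derivative Ut t x $ i) (at t within {0..T})"
  and U_dx: "t \<in> {0..T} \<Longrightarrow> ((\<lambda>h. U t (x + h *\<^sub>R axis j 1) $ i) has_real_derivative Ux j t x $ i) (at 0)"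
  using bounded_linear.has_vector_derivative[OF bounded_linear_vec_nth C1_withD(5)[OF U_C1]]
    bounded_linear.has_vector_derivative[OF bounded_linear_vec_nth C1_withD(6)[OF U_C1]]
  by (simp_all add: has_real_derivative_iff_has_vector_derivative)

lemma powr_dt:
  assumes "t \<in> {0..T}"
  shows "((\<lambda>s. r s x powr a) has_real_derivative a * r t x powr (a - 1) * rt t x) (at t within {0..T})"
  by (rule DERIV_chain2[OF has_real_derivative_powr[OF r_pos] r_dt[OF assms]])

lemma powr_dx:
  assumes "t \<in> {0..T}"
  shows "((\<lambda>h. r t (x + h *\<^sub>R axis j 1) powr a) has_real_derivative a * r t x powr (a - 1) * rx j t x) (at 0)"
  using DERIV_chain2[OF has_real_derivative_powr[OF r_pos] r_dx[OF assms], of x j a] by simp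

lemma dX_eqI:
  assumes "((\<lambda>h. f t (x + h *\<^sub>R axis j 1)) has_real_derivative D) (at 0)"
  shows "dX j f t x = D"
  unfolding dX_def using assms
  by (intro vector_derivative_at) (simp add: has_real_derivative_iff_has_vector_derivative)

lemma continuity_equation:
  assumes t: "t \<in> {0..T}"
  shows "rt t x + (\<Sum>j\<in>UNIV. rx j t x * U t x $ j + r t x * Ux j t x $ j) = 0"
proof -
  have *: "dX j (\<lambda>s y. r s y * U s y $ j) t x = rx j t x * U t x $ j + r t x * Ux j t x $ j" for j
    by (rule dX_eqI) (use DERIV_mult[OF r_dx[OF t, of x j] U_dx[OF t, of x j j]] in \<open>simp add: algebra_simps\<close>)
  show ?thesis using cs t unfolding classical_solution_def *[symmetric] by blast
qed

text \<open>The momentum equation minus \<open>U\<close> times the continuity equation is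
  \<open>r\<close> times this expression, and \<open>r\<close> is positive. The exponent \<gamma> -
  2 results from this division.\<close>

lemma velocity_equation:
  assumes t: "t \<in> {0..T}"
  shows "Ut t x $ i + (\<Sum>j\<in>UNIV. U t x $ j * Ux j t x $ i) + \<gamma> * r t x powr (\<gamma> - 2) * rx i t x = 0"
proof -
  have 1: "dTw {0..T} (\<lambda>s y. r s y * U s y $ i) t x = rt t x * U t x $ i + r t x * Ut t x $ i"
    unfolding dTw_def
  \<comment> \<open>On an interval of positive length the derivative within it is unique also at the
    end points, so the value of \<open>dTw\<close> can be read off from the product rule.\<close>
  proof (rule vector_derivative_within_closed_interval[OF T])
    show "t \<in> {0..T}" by (rule t)
    show "((\<lambda>s. r s x * U s x $ i) has_vector_derivative
        vector_derivative (\<lambda>s. r s x) (at t within {0..T}) * U t x $ i + r t x * vector_derivative (\<lambda>s. U s x) (at t within {0..T}) $ i) (at t within {0..T})"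
      using DERIV_mult[OF r_dt[OF t, of x] U_dt[OF t, of x i]]
      by (simp add: has_real_derivative_iff_has_vector_derivative dTw_def algebra_simps)
  qed
  have 2: "dX j (\<lambda>s y. r s y * U s y $ i * U s y $ j) t x =
    (rx j t x * U t x $ i + r t x * Ux j t x $ i) * U t x $ j + r t x * U t x $ i * Ux j t x $ j" for j
    by (rule dX_eqI)
      (use DERIV_mult[OF DERIV_mult[OF r_dx[OF t, of x j] U_dx[OF t, of x j i]] U_dx[OF t, of x j j]] in \<open>simp add: algebra_simps\<close>)
  have 3: "dX i (\<lambda>s y. r s y powr \<gamma>) t x = \<gamma> * r t x powr (\<gamma> - 1) * rx i t x"
    by (rule dX_eqI) (rule powr_dx[OF t])
  have 4: "r t x powr (\<gamma> - 1) = r t x * r t x powr (\<gamma> - 2)"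
    using powr_add[of "r t x" 1 "\<gamma> - 2"] r_pos[of t x] by simp
  have m: "rt t x * U t x $ i + r t x * Ut t x $ i
     + (\<Sum>j\<in>UNIV. (rx j t x * U t x $ i + r t x * Ux j t x $ i) * U t x $ j + r t x * U t x $ i * Ux j t x $ j)
     + \<gamma> * r t x powr (\<gamma> - 1) * rx i t x = 0"
    using cs t unfolding classical_solution_def 1[symmetric] 2[symmetric] 3[symmetric] by blast
  have "(\<Sum>j\<in>UNIV. (rx j t x * U t x $ i + r t x * Ux j t x $ i) * U t x $ j + r t x * U t x $ i * Ux j t x $ j)
    = U t x $ i * (\<Sum>j\<in>UNIV. rx j t x * U t x $ j + r t x * Ux j t x $ j) + r t x * (\<Sum>j\<in>UNIV. U t x $ j * Ux j t x $ i)"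
    by (simp add: sum_distrib_left sum.distrib[symmetric] algebra_simps)
  moreover have "(\<Sum>j\<in>UNIV. rx j t x * U t x $ j + r t x * Ux j t x $ j) = - rt t x"
    using continuity_equation[OF t, of x] by linarith
  ultimately have "r t x * (Ut t x $ i + (\<Sum>j\<in>UNIV. U t x $ j * Ux j t x $ i) + \<gamma> * r t x powr (\<gamma> - 2) * rx i t x) = 0"
    using m unfolding 4 by (simp add: algebra_simps)
  then show ?thesis using r_pos[of t x] by simp
qed

definition P :: "real \<Rightarrow> real ^ 'd \<Rightarrow> real" where
  "P t x = 1/2 * (U t x \<bullet> U t x) - \<gamma> / (\<gamma> - 1) * r t x powr (\<gamma> - 1)"

definition Pt :: "real \<Rightarrow> real ^ 'd \<Rightarrow> real" where
  "Pt t x = U t x \<bullet> Ut t x - \<gamma> * r t x powr (\<gamma> - 2) * rt t x"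

definition Px :: "'d \<Rightarrow> real \<Rightarrow> real ^ 'd \<Rightarrow> real" where
  "Px j t x = U t x \<bullet> Ux j t x - \<gamma> * r t x powr (\<gamma> - 2) * rx j t x"

lemma continuous_powr_r:
  "continuous_on ({0..T} \<times> UNIV) (\<lambda>z. r (fst z) (snd z) powr a)"
  by (intro continuous_on_powr C1_withD(2)[OF r_C1] continuous_on_const) (use r_pos in \<open>simp add: less_imp_neq[symmetric]\<close>)

lemma P_C1: "C1_with T P Pt Px"
  unfolding C1_with_def
proof (intro conjI allI ballI)
  have pd: "r t (x + axis j 1) = r t x" "U t (x + axis j 1) = U t x" for t x j
    using C1_withD(1)[OF r_C1] C1_withD(1)[OF U_C1] by (simp_all add: periodic_x_def)
  show "periodic_x P" by (simp add: periodic_x_def P_def pd)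
  note c = C1_withD(2-4)[OF r_C1] C1_withD(2-4)[OF U_C1] continuous_powr_r
  show "continuous_on ({0..T} \<times> UNIV) (\<lambda>z. P (fst z) (snd z))"
    unfolding P_def by (intro continuous_on_diff continuous_on_mult continuous_on_inner continuous_on_const c)
  show "continuous_on ({0..T} \<times> UNIV) (\<lambda>z. Pt (fst z) (snd z))"
    unfolding Pt_def by (intro continuous_on_diff continuous_on_mult continuous_on_inner continuous_on_const c)
  show "continuous_on ({0..T} \<times> UNIV) (\<lambda>z. Px j (fst z) (snd z))" for j
    unfolding Px_def by (intro continuous_on_diff continuous_on_mult continuous_on_inner continuous_on_const c)
  have half: "1/2 * (u \<bullet> v + v \<bullet> u) - \<gamma> / (\<gamma> - 1) * ((\<gamma> - 1) * q powr (\<gamma> - 1 - 1) * w) = u \<bullet> v - \<gamma> * q powr (\<gamma> - 2) * w"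
    for u v :: "real ^ 'd" and q w :: real
    using \<gamma> by (simp add: inner_commute[of v u])
  show "((\<lambda>s. P s x) has_vector_derivative Pt t x) (at t within {0..T})" if t: "t \<in> {0..T}" for t x
  proof -
    have "((\<lambda>s. U s x \<bullet> U s x) has_real_derivative (U t x \<bullet> Ut t x + Ut t x \<bullet> U t x)) (at t within {0..T})"
      using bounded_bilinear.has_vector_derivative[OF bounded_bilinear_inner C1_withD(5)[OF U_C1 t] C1_withD(5)[OF U_C1 t], of x x]
      by (simp add: has_real_derivative_iff_has_vector_derivative)
    from DERIV_diff[OF DERIV_cmult[OF this, of "1/2"] DERIV_cmult[OF powr_dt[OF t, of x "\<gamma> - 1"], of "\<gamma> / (\<gamma> - 1)"]]
    show ?thesis unfolding half P_def Pt_def by (simp add: has_real_derivative_iff_has_vector_derivative)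
  qed
  show "((\<lambda>h. P t (x + h *\<^sub>R axis j 1)) has_vector_derivative Px j t x) (at 0)" if t: "t \<in> {0..T}" for t x j
  proof -
    have "((\<lambda>h. U t (x + h *\<^sub>R axis j 1) \<bullet> U t (x + h *\<^sub>R axis j 1)) has_real_derivative (U t x \<bullet> Ux j t x + Ux j t x \<bullet> U t x)) (at 0)"
      using bounded_bilinear.has_vector_derivative[OF bounded_bilinear_inner C1_withD(6)[OF U_C1 t] C1_withD(6)[OF U_C1 t], of x j x j]
      by (simp add: has_real_derivative_iff_has_vector_derivative)
    from DERIV_diff[OF DERIV_cmult[OF this, of "1/2"] DERIV_cmult[OF powr_dx[OF t, of x j "\<gamma> - 1"], of "\<gamma> / (\<gamma> - 1)"]]
    show ?thesis unfolding half P_def Px_def by (simp add: has_real_derivative_iff_has_vector_derivative)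
  qed
qed

text \<open>Time derivative of the pressure of the classical solution.\<close>

definition pt :: "real \<Rightarrow> real ^ 'd \<Rightarrow> real" where
  "pt t x = \<gamma> * r t x powr (\<gamma> - 1) * rt t x"

lemma pt_continuous: "continuous_on ({0..T} \<times> UNIV) (\<lambda>z. pt (fst z) (snd z))"
  unfolding pt_def by (intro continuous_on_mult continuous_on_const continuous_powr_r C1_withD(3)[OF r_C1])

lemma pressure_FTC:
  assumes "t \<in> {0<..<T}"
  shows "(LINT x:cell|lborel. r t x powr \<gamma>) = (LINT x:cell|lborel. r 0 x powr \<gamma>) + (LINT s:{0<..<t}|lborel. LINT x:cell|lborel. pt s x)"
  by (rule cell_integral_time_FTC[OF continuous_powr_r pt_continuous _ assms])
    (simp add: pt_def powr_dt has_real_derivative_iff_has_vector_derivative[symmetric])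

text \<open>The \<open>j\<close>-th summand of the divergence of the pressure times
  \<open>U\<close>, that is, of r^\<gamma> U.\<close>

definition div_flux :: "'d \<Rightarrow> real \<Rightarrow> real ^ 'd \<Rightarrow> real" where
  "div_flux j t x = \<gamma> * r t x powr (\<gamma> - 1) * rx j t x * U t x $ j + r t x powr \<gamma> * Ux j t x $ j"

lemma slice_continuous:
  fixes f :: "real \<Rightarrow> real ^ 'd \<Rightarrow> 'z::topological_space"
  assumes "continuous_on ({0..T} \<times> UNIV) (\<lambda>z. f (fst z) (snd z))" "t \<in> {0..T}"
  shows "continuous_on UNIV (f t)"
proof -
  have a: "continuous_on UNIV (\<lambda>x :: real ^ 'd. (t, x))" by (intro continuous_intros)
  have b: "range (\<lambda>x. (t, x)) \<subseteq> {0..T} \<times> (UNIV :: (real ^ 'd) set)" using assms(2) by auto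
  show ?thesis using continuous_on_compose2[OF assms(1) a b] by simp
qed

lemma div_flux_continuous: "t \<in> {0..T} \<Longrightarrow> continuous_on UNIV (div_flux j t)"
proof (rule slice_continuous)
  have "continuous_on ({0..T} \<times> UNIV) (\<lambda>z. U (fst z) (snd z) $ j)" "continuous_on ({0..T} \<times> UNIV) (\<lambda>z. Ux j (fst z) (snd z) $ j)"
    using C1_withD(2)[OF U_C1] C1_withD(4)[OF U_C1] by (auto intro!: continuous_intros)
  then show "continuous_on ({0..T} \<times> UNIV) (\<lambda>z. div_flux j (fst z) (snd z))"
    unfolding div_flux_def
    by (intro continuous_on_add continuous_on_mult continuous_on_const continuous_powr_r C1_withD(4)[OF r_C1])
qed

lemma div_flux_integral_zero:
  assumes t: "t \<in> {0..T}"
  shows "(LINT x:cell|lborel. div_flux j t x) = 0"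
proof (rule cell_integral_derivative_zero[where j = j and f = "\<lambda>x. r t x powr \<gamma> * U t x $ j"])
  show "continuous_on UNIV (div_flux j t)" by (rule div_flux_continuous[OF t])
  have pd: "r t (x + axis j 1) = r t x" "U t (x + axis j 1) = U t x" for x
    using C1_withD(1)[OF r_C1] C1_withD(1)[OF U_C1] by (simp_all add: periodic_x_def)
  show "r t (x + axis j 1) powr \<gamma> * U t (x + axis j 1) $ j = r t x powr \<gamma> * U t x $ j" for x
    by (simp add: pd)
  show "div_flux j t (x + axis j 1) = div_flux j t x" for x
    by (simp add: div_flux_def pd C1_with_periodic_deriv[OF r_C1 t] C1_with_periodic_deriv[OF U_C1 t])
  show "((\<lambda>h. r t (x + h *\<^sub>R axis j 1) powr \<gamma> * U t (x + h *\<^sub>R axis j 1) $ j) has_vector_derivative div_flux j t x) (at 0)" for x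
    using DERIV_mult[OF powr_dx[OF t, of x j \<gamma>] U_dx[OF t, of x j j]]
    by (simp add: has_real_derivative_iff_has_vector_derivative div_flux_def algebra_simps)
qed

text \<open>A bound for each single state (\<rho>,u), before averaging over \<nu>, with
  \<open>\<gamma> * r t x powr (\<gamma> - 2)\<close> as the \<open>c\<close> of
  \<open>relative_energy_identity\<close>. The divergence has no sign and is kept, since its
  integral over the cell vanishes.\<close>

lemma production_bound:
  fixes u :: "real ^ 'd"
  assumes t: "t \<in> {0..T}" and "0 \<le> \<rho>" and \<Lambda>: "norm (grad_mat U t x) \<le> \<Lambda>"
  shows "- (\<rho> *\<^sub>R u) \<bullet> Ut t x - frob (\<rho> *\<^sub>R tensor u u) (grad_mat U t x) - \<rho> powr \<gamma> * divg U t x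
      + \<rho> * Pt t x + (\<Sum>j\<in>UNIV. (\<rho> *\<^sub>R u) $ j * Px j t x) + pt t x
    \<le> \<Lambda> * (2 + real CARD('d) * (\<gamma> - 1)) * rel_density \<gamma> \<rho> u (r t x) (U t x) - (\<Sum>j\<in>UNIV. div_flux j t x)"
proof -
  have 4: "\<gamma> * r t x powr (\<gamma> - 1) = \<gamma> * r t x powr (\<gamma> - 2) * r t x"
    using powr_add[of "r t x" 1 "\<gamma> - 2"] r_pos[of t x] by simp
  have dv: "divg U t x = (\<Sum>j\<in>UNIV. Ux j t x $ j)" by (simp add: divg_def)
  have tr: "(\<Sum>j\<in>UNIV. grad_mat U t x $ j $ j) = (\<Sum>j\<in>UNIV. Ux j t x $ j)" by (simp add: grad_mat_def)
  show ?thesis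
    using relative_energy_identity[OF continuity_equation[OF t, of x] velocity_equation[OF t, of x], where \<rho> = \<rho> and u = u and s = "\<rho> powr \<gamma>" and R = "r t x powr \<gamma>"]
      relative_energy_production_bound[OF \<gamma> assms(2) r_pos[of t x] \<Lambda>, of u "U t x"]
    unfolding tr dv Pt_def Px_def pt_def div_flux_def grad_mat_def[symmetric] 4 by linarith
qed

end

section \<open>The relative energy inequality\<close>

text \<open>Subtracting the integer part of every coordinate moves a point into the cell. Bounds on
  the cell thereby become bounds on the whole space.\<close>

lemma periodic_eq_on_cell:
  fixes g :: "real ^ 'd \<Rightarrow> 'b"
  assumes "\<And>x j. g (x + axis j 1) = g x"
  obtains y where "y \<in> cell" "g x = g y"
proof -
  have n: "g (x + real n *\<^sub>R axis j 1) = g x" for x n j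
  proof (induction n)
    case (Suc n)
    then show ?case using assms[of "x + real n *\<^sub>R axis j 1" j] by (simp add: algebra_simps)
  qed simp
  have i: "g (x + of_int k *\<^sub>R axis j 1) = g x" for x k j
  proof (cases "0 \<le> k")
    case True
    then show ?thesis using n[of x "nat k" j] by simp
  next
    case False
    then show ?thesis using n[of "x + of_int k *\<^sub>R axis j 1" "nat (- k)" j] by simp
  qed
  have s: "g (x + (\<Sum>j\<in>S. of_int (k j) *\<^sub>R axis j 1)) = g x" if "finite S" for S k
    using that
  proof (induction S)
    case (insert j S)
    then show ?case using i[of "x + (\<Sum>j\<in>S. of_int (k j) *\<^sub>R axis j 1)" "k j" j]
      by (simp add: algebra_simps)
  qed simp
  define y where "y = x + (\<Sum>j\<in>UNIV. of_int (- \<lfloor>x $ j\<rfloor>) *\<^sub>R axis j 1)"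
  have c: "(\<Sum>j\<in>UNIV. of_int (k j) *\<^sub>R axis j (1::real)) $ i = of_int (k i)" for k :: "'d \<Rightarrow> int" and i
    by (simp add: axis_def if_distrib cong: if_cong)
  have "y $ i = x $ i - of_int \<lfloor>x $ i\<rfloor>" for i
    unfolding y_def vector_add_component c by simp
  then have "y \<in> cell" by (simp add: cell_def) linarith
  moreover have "g y = g x" unfolding y_def by (rule s) simp
  ultimately show thesis using that by simp
qed

lemma set_integrable_bounded_linear_image:
  assumes "bounded_linear L" "set_integrable M S f"
  shows "set_integrable M S (\<lambda>z. L (f z))"
proof -
  interpret bounded_linear L by fact
  show ?thesis
    using integrable_bounded_linear[OF assms(1), of M "\<lambda>z. indicator S z *\<^sub>R f z"] assms(2)
    by (simp add: set_integrable_def scaleR)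
qed

lemma bounded_linear_column: "bounded_linear (\<lambda>A :: real ^ 'd ^ 'd. \<chi> i. A $ i $ j)"
  by (intro linear_conv_bounded_linear[THEN iffD1] linearI) (simp_all add: vec_eq_iff)

lemma norm_column_le_sum: "norm (\<chi> i. (A :: real ^ 'd ^ 'd) $ i $ j) \<le> real CARD('d) * norm A"
proof -
  have "norm (\<chi> i. A $ i $ j) \<le> (\<Sum>i\<in>UNIV. \<bar>A $ i $ j\<bar>)"
    using norm_le_l1_cart[of "\<chi> i. A $ i $ j"] by simp
  also have "\<dots> \<le> (\<Sum>i\<in>(UNIV :: 'd set). norm A)"
    by (intro sum_mono order_trans[OF component_le_norm_cart Finite_Cartesian_Product.norm_nth_le])
  finally show ?thesis by simp
qed

lemma frob_eq_columns: "frob A B = (\<Sum>j\<in>UNIV. (\<chi> i. A $ i $ j) \<bullet> (\<chi> i. B $ i $ j))"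
  unfolding frob_def inner_vec_def by (subst sum.swap) simp

section \<open>Moments of the measure-valued solution and its two balance laws\<close>

locale dmv_flow = classical_flow \<gamma> T r U
  for \<gamma> T and r :: "real \<Rightarrow> real ^ 'd \<Rightarrow> real" and U :: "real \<Rightarrow> real ^ 'd \<Rightarrow> real ^ 'd" +
  fixes Cm :: real and \<nu> :: "real \<Rightarrow> real ^ 'd \<Rightarrow> (real \<times> (real ^ 'd)) measure"
    and \<mu> :: "real \<Rightarrow> (real ^ 'd) measure" and \<theta> :: "real \<Rightarrow> real ^ 'd \<Rightarrow> real ^ 'd ^ 'd"
    and D :: "real \<Rightarrow> real" and \<rho>0 :: "real ^ 'd \<Rightarrow> real" and u0 :: "real ^ 'd \<Rightarrow> real ^ 'd"
  assumes Cm: "0 < Cm" and dmv: "dmv_solution \<gamma> Cm T \<nu> \<mu> \<theta> D \<rho>0 u0"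
    and ie: "integrals_exist \<gamma> T \<nu> \<rho>0 u0"
begin

abbreviation "Slab \<equiv> {0<..<T} \<times> (cell :: (real ^ 'd) set)"

text \<open>The moments are, in this order: mass, momentum, convective momentum flux, pressure, and
  twice the kinetic energy.\<close>

definition "M0 z = ypair \<nu> (fst z) (snd z) fst"
definition "M1 z = ypair \<nu> (fst z) (snd z) (\<lambda>y. fst y *\<^sub>R snd y)"
definition "M2 z = ypair \<nu> (fst z) (snd z) (\<lambda>y. fst y *\<^sub>R tensor (snd y) (snd y))"
definition "M3 z = ypair \<nu> (fst z) (snd z) (\<lambda>y. fst y powr \<gamma>)"
definition "M4 z = ypair \<nu> (fst z) (snd z) (\<lambda>y. fst y * (norm (snd y))\<^sup>2)"

lemma M_integrable:
  "set_integrable lborel Slab M0" "set_integrable lborel Slab M1" "set_integrable lborel Slab M2"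
  "set_integrable lborel Slab M3" "set_integrable lborel Slab M4"
  using ie by (simp_all add: integrals_exist_def M0_def[abs_def] M1_def[abs_def] M2_def[abs_def] M3_def[abs_def] M4_def[abs_def])

text \<open>Column \<open>j\<close> of the full momentum flux: the convective part plus pressure
  times the identity matrix.\<close>

definition "Wm j z = (\<chi> i. M2 z $ i $ j) + M3 z *\<^sub>R axis j 1"
definition "\<Theta>m j t x = (\<chi> i. \<theta> t x $ i $ j)"

lemma \<mu>_facts:
  assumes "t \<in> {0<..<T}"
  shows "sets (\<mu> t) = sets borel" "AE x in \<mu> t. x \<in> cell" "integrable (\<mu> t) (\<theta> t)"
proof -
  have mm: "matrix_measure (\<mu> t) (\<theta> t)"
    using dmv assms by (simp add: dmv_solution_def Linf_measure_family_def)
  then show s: "sets (\<mu> t) = sets borel" and "integrable (\<mu> t) (\<theta> t)" by (simp_all add: matrix_measure_def)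
  have "space (\<mu> t) = UNIV" using sets_eq_imp_space_eq[OF s] by simp
  then show "AE x in \<mu> t. x \<in> cell"
    using mm s by (intro AE_I[of _ _ "UNIV - cell"]) (auto simp: matrix_measure_def)
qed

lemma frob_grad: "frob (grad_mat \<phi> t x) (\<theta> t x) = (\<Sum>j\<in>UNIV. dX j \<phi> t x \<bullet> \<Theta>m j t x)"
  unfolding frob_eq_columns by (simp add: grad_mat_def \<Theta>m_def)

lemma Wm_sum:
  "frob (M2 z) (grad_mat \<phi> t x) + M3 z * divg \<phi> t x = (\<Sum>j\<in>UNIV. Wm j z \<bullet> dX j \<phi> t x)"
  unfolding frob_eq_columns divg_def Wm_def
  by (simp add: grad_mat_def inner_add_left sum.distrib sum_distrib_left inner_axis' )

lemma momentum_balance: "weak_balance T M1 Wm \<mu> \<Theta>m (\<lambda>x. \<rho>0 x *\<^sub>R u0 x)"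
proof
  show "0 < T" by (rule T)
  show "set_integrable lborel Slab M1" by (rule M_integrable)
  show "set_integrable lborel Slab (Wm j)" for j
    unfolding Wm_def
    by (intro set_integral_add set_integrable_bounded_linear_image[OF bounded_linear_column] M_integrable
        set_integrable_bounded_linear_image[OF bounded_linear_scaleR_left])
  show "set_integrable lborel cell (\<lambda>x. \<rho>0 x *\<^sub>R u0 x)" using ie by (simp add: integrals_exist_def)
  show "sets (\<mu> t) = sets borel" "AE x in \<mu> t. x \<in> cell" if "t \<in> {0<..<T}" for t
    using \<mu>_facts[OF that] by auto
  show int: "integrable (\<mu> t) (\<Theta>m j t)" if "t \<in> {0<..<T}" for t j
    unfolding \<Theta>m_def by (rule integrable_bounded_linear[OF bounded_linear_column \<mu>_facts(3)[OF that]])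
  obtain B where B: "AE t in lborel. t \<in> {0<..<T} \<longrightarrow> total_var (\<mu> t) (\<theta> t) \<le> B"
    using dmv unfolding dmv_solution_def Linf_measure_family_def by blast
  have "AE t in lborel. t \<in> {0<..<T} \<longrightarrow> (\<forall>j. (\<integral>x. norm (\<Theta>m j t x) \<partial>\<mu> t) \<le> real CARD('d) * B)"
    using B
  proof (eventually_elim, intro impI allI)
    fix t j assume "t \<in> {0<..<T} \<longrightarrow> total_var (\<mu> t) (\<theta> t) \<le> B" and t: "t \<in> {0<..<T}"
    then have tv: "(\<integral>x. norm (\<theta> t x) \<partial>\<mu> t) \<le> B" by (simp add: total_var_def)
    have "(\<integral>x. norm (\<Theta>m j t x) \<partial>\<mu> t) \<le> (\<integral>x. real CARD('d) * norm (\<theta> t x) \<partial>\<mu> t)"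
      by (intro integral_mono integrable_norm int[OF t] integrable_mult_right \<mu>_facts(3)[OF t])
        (simp add: \<Theta>m_def norm_column_le_sum)
    also have "\<dots> \<le> real CARD('d) * B" using tv by (simp add: mult_left_mono)
    finally show "(\<integral>x. norm (\<Theta>m j t x) \<partial>\<mu> t) \<le> real CARD('d) * B" .
  qed
  then show "\<exists>B. AE t in lborel. t \<in> {0<..<T} \<longrightarrow> (\<forall>j. (\<integral>x. norm (\<Theta>m j t x) \<partial>\<mu> t) \<le> B)" by blast
  show "set_borel_measurable lborel {0<..<T} (\<lambda>t. \<integral>x. (\<Sum>j\<in>UNIV. G j x \<bullet> \<Theta>m j t x) \<partial>\<mu> t)"
    if G: "\<And>j. continuous_on UNIV (G j)" "\<And>j x k. G j (x + axis k 1) = G j x" for G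
  proof -
    \<comment> \<open>\<open>Linf_measure_family\<close> speaks of matrix fields, so the columns
      \<open>G j\<close> are assembled into one matrix.\<close>
    have "continuous_on UNIV (\<lambda>x. (\<chi> i j. G j x $ i) :: real ^ 'd ^ 'd)"
      using G(1) by (intro continuous_on_vec_lambda continuous_on_component)
    moreover have "\<forall>x k. ((\<chi> i j. G j (x + axis k 1) $ i) :: real ^ 'd ^ 'd) = (\<chi> i j. G j x $ i)"
      by (simp add: G(2))
    ultimately have "set_borel_measurable lborel {0<..<T} (\<lambda>t. mpair (\<mu> t) (\<theta> t) (\<lambda>x. \<chi> i j. G j x $ i))"
      using dmv unfolding dmv_solution_def Linf_measure_family_def by blast
    moreover have "frob (\<chi> i j. G j x $ i) (\<theta> t x) = (\<Sum>j\<in>UNIV. G j x \<bullet> \<Theta>m j t x)" for t x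
      unfolding frob_eq_columns by (simp add: \<Theta>m_def)
    ultimately show ?thesis by (simp add: mpair_def)
  qed
  show "(LINT z : Slab | lborel. M1 z \<bullet> dT \<phi> (fst z) (snd z) + (\<Sum>j\<in>UNIV. Wm j z \<bullet> dX j \<phi> (fst z) (snd z)))
      + (LINT t : {0<..<T} | lborel. \<integral>x. (\<Sum>j\<in>UNIV. dX j \<phi> t x \<bullet> \<Theta>m j t x) \<partial>\<mu> t)
      = - (LINT x : cell | lborel. (\<rho>0 x *\<^sub>R u0 x) \<bullet> \<phi> 0 x)" if "test_fun T \<phi>" for \<phi>
  proof -
    have "(LINT z : Slab | lborel. M1 z \<bullet> dT \<phi> (fst z) (snd z) + frob (M2 z) (grad_mat \<phi> (fst z) (snd z))
          + M3 z * divg \<phi> (fst z) (snd z))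
        + (LINT t : {0<..<T} | lborel. mpair (\<mu> t) (\<theta> t) (grad_mat \<phi> t))
        = - (LINT x : cell | lborel. (\<rho>0 x *\<^sub>R u0 x) \<bullet> \<phi> 0 x)"
      using dmv that unfolding dmv_solution_def M1_def M2_def M3_def by blast
    then show ?thesis unfolding mpair_def frob_grad add.assoc Wm_sum .
  qed
qed

lemma mass_balance: "weak_balance T M0 (\<lambda>j z. M1 z $ j) \<mu> (\<lambda>j t x. 0) \<rho>0"
proof
  show "0 < T" by (rule T)
  show "set_integrable lborel Slab M0" by (rule M_integrable)
  show "set_integrable lborel Slab (\<lambda>z. M1 z $ j)" for j
    by (rule set_integrable_bounded_linear_image[OF bounded_linear_vec_nth M_integrable(2)])
  show "set_integrable lborel cell \<rho>0" using ie by (simp add: integrals_exist_def)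
  show "sets (\<mu> t) = sets borel" "AE x in \<mu> t. x \<in> cell" if "t \<in> {0<..<T}" for t
    using \<mu>_facts[OF that] by auto
  show "\<exists>B. AE t in lborel. t \<in> {0<..<T} \<longrightarrow> (\<forall>j::'d. (\<integral>x. norm (0::real) \<partial>\<mu> t) \<le> B)"
    by (intro exI[of _ 0]) simp
  show "(LINT z : Slab | lborel. M0 z \<bullet> dT \<phi> (fst z) (snd z) + (\<Sum>j\<in>UNIV. M1 z $ j \<bullet> dX j \<phi> (fst z) (snd z)))
      + (LINT t : {0<..<T} | lborel. \<integral>x. (\<Sum>j\<in>UNIV. dX j \<phi> t x \<bullet> 0) \<partial>\<mu> t)
      = - (LINT x : cell | lborel. \<rho>0 x \<bullet> \<phi> 0 x)" if "test_fun T \<phi>" for \<phi>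
  proof -
    have "(LINT z : Slab | lborel. M0 z * dT \<phi> (fst z) (snd z) + M1 z \<bullet> grad_s \<phi> (fst z) (snd z))
        = - (LINT x : cell | lborel. \<rho>0 x * \<phi> 0 x)"
      using dmv that unfolding dmv_solution_def M0_def M1_def by blast
    then show ?thesis by (simp add: grad_s_def inner_vec_def set_lebesgue_integral_def)
  qed
qed (simp_all add: set_borel_measurable_def)

definition "\<Lambda> = grad_sup T U"

text \<open>\<open>\<Lambda>\<close> is a supremum over an unbounded set of points; it bounds the
  gradient only once this set of norms is known to be bounded above, which follows from periodicity
  and compactness.\<close>

lemma grad_le: assumes t: "t \<in> {0..T}" shows "norm (grad_mat U t x) \<le> \<Lambda>"
proof -
  have "continuous_on ({0..T} \<times> UNIV) (\<lambda>z. grad_mat U (fst z) (snd z))"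
    unfolding grad_mat_def
    by (intro continuous_on_vec_lambda continuous_on_component C1_withD(4)[OF U_C1])
  then obtain B where B: "\<And>t x. t \<in> {0..T} \<Longrightarrow> x \<in> cell \<Longrightarrow> norm (grad_mat U t x) \<le> B"
    using bounded_on_slab[of 0 T "grad_mat U"] by metis
  have "norm (grad_mat U (fst z) (snd z)) \<le> B" if z: "z \<in> {0..T} \<times> UNIV" for z
  proof -
    have t: "fst z \<in> {0..T}" using z by auto
    have "grad_mat U (fst z) (x + axis k 1) = grad_mat U (fst z) x" for x k
      by (simp add: grad_mat_def C1_with_periodic_deriv[OF U_C1 t])
    then obtain y where "y \<in> cell" "grad_mat U (fst z) (snd z) = grad_mat U (fst z) y"
      by (rule periodic_eq_on_cell)
    then show ?thesis using B[OF t] by simp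
  qed
  then have bdd: "bdd_above ((\<lambda>z. norm (grad_mat U (fst z) (snd z))) ` ({0..T} \<times> UNIV))"
    by (intro bdd_aboveI2)
  show ?thesis
    unfolding \<Lambda>_def grad_sup_def using cSUP_upper[OF _ bdd, of "(t, x)"] t by simp
qed

lemma \<Lambda>_nonneg: "0 \<le> \<Lambda>"
  using order_trans[OF norm_ge_zero grad_le[of 0]] T by simp

text \<open>\<open>S\<close> is \<open>rel_density_expand\<close> with the moments of \<nu>
  inserted; as a combination of integrable functions it is integrable on the slab. \<open>Q\<close>
  below is the corresponding integrand of the rate, without the defect.\<close>

definition "S z = 1/2 * M4 z + 1 / (\<gamma> - 1) * M3 z - M1 z \<bullet> U (fst z) (snd z) + M0 z * P (fst z) (snd z) + r (fst z) (snd z) powr \<gamma>"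
definition "Q z = - (M1 z \<bullet> Ut (fst z) (snd z) + (\<Sum>j\<in>UNIV. Wm j z \<bullet> Ux j (fst z) (snd z)))
   + (M0 z * Pt (fst z) (snd z) + (\<Sum>j\<in>UNIV. M1 z $ j * Px j (fst z) (snd z))) + pt (fst z) (snd z)"
definition "C' = 2 + real CARD('d) * (\<gamma> - 1)"

text \<open>Both \<open>S\<close> and \<open>Q\<close> are affine in the moments, so identities and
  inequalities for single states integrate against the probability measure. The inequalities require
  a nonnegative density, which holds almost surely because the measure is concentrated on
  \<open>Xstate\<close>.\<close>

lemma moments_pointwise:
  assumes t: "t \<in> {0<..<T}" and x: "x \<in> cell"
    and i: "integrable (\<nu> t x) fst" "integrable (\<nu> t x) (\<lambda>y. fst y *\<^sub>R snd y)"
      "integrable (\<nu> t x) (\<lambda>y. fst y *\<^sub>R tensor (snd y) (snd y))"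
      "integrable (\<nu> t x) (\<lambda>y. fst y * (norm (snd y))\<^sup>2)" "integrable (\<nu> t x) (\<lambda>y. fst y powr \<gamma>)"
  shows "ypair \<nu> t x (\<lambda>y. rel_density \<gamma> (fst y) (snd y) (r t x) (U t x)) = S (t, x)"
    and "0 \<le> S (t, x)"
    and "Q (t, x) \<le> \<Lambda> * C' * S (t, x) - (\<Sum>j\<in>UNIV. div_flux j t x)"
proof -
  let ?N = "\<nu> t x"
  have N: "emeasure ?N UNIV = 1" "sets ?N = sets borel" "emeasure ?N (UNIV - Xstate) = 0"
    using dmv t x by (simp_all add: dmv_solution_def young_measure_def)
  have sp: "space ?N = UNIV" using sets_eq_imp_space_eq[OF N(2)] by simp
  interpret finite_measure ?N by standard (simp add: sp N(1))
  have "closed (Xstate :: (real \<times> (real ^ 'd)) set)"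
    unfolding Xstate_def by (intro closed_Collect_le continuous_intros)
  then have "UNIV - Xstate \<in> sets ?N" unfolding N(2) by (intro borel_open) (simp add: open_Diff)
  then have AEN: "AE y in ?N. y \<in> Xstate"
    using N(3) by (intro AE_I[of _ _ "UNIV - Xstate"]) (auto simp: sp)
  have h0: "has_bochner_integral ?N fst (M0 (t, x))"
    and h1: "has_bochner_integral ?N (\<lambda>y. fst y *\<^sub>R snd y) (M1 (t, x))"
    and h2: "has_bochner_integral ?N (\<lambda>y. fst y *\<^sub>R tensor (snd y) (snd y)) (M2 (t, x))"
    and h3: "has_bochner_integral ?N (\<lambda>y. fst y powr \<gamma>) (M3 (t, x))"
    and h4: "has_bochner_integral ?N (\<lambda>y. fst y * (norm (snd y))\<^sup>2) (M4 (t, x))"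
    using i by (simp_all add: M0_def M1_def M2_def M3_def M4_def ypair_def has_bochner_integral_iff)
  have hc: "has_bochner_integral ?N (\<lambda>y. c) c" for c :: real
    by (simp add: has_bochner_integral_iff sp measure_def N(1))
  have hS: "has_bochner_integral ?N (\<lambda>y. rel_density \<gamma> (fst y) (snd y) (r t x) (U t x)) (S (t, x))"
    unfolding rel_density_expand[OF \<gamma> r_pos] S_def P_def[symmetric] fst_conv snd_conv
    by (intro has_bochner_integral_add has_bochner_integral_diff has_bochner_integral_mult_right
        has_bochner_integral_mult_left has_bochner_integral_inner_left h0 h1 h3 h4 hc)
  then show rel: "ypair \<nu> t x (\<lambda>y. rel_density \<gamma> (fst y) (snd y) (r t x) (U t x)) = S (t, x)"
    unfolding ypair_def by (rule has_bochner_integral_integral_eq)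
  have "AE y in ?N. 0 \<le> rel_density \<gamma> (fst y) (snd y) (r t x) (U t x)"
    using AEN by eventually_elim (simp add: Xstate_def rel_density_nonneg \<gamma> r_pos)
  then show "0 \<le> S (t, x)"
    unfolding rel[symmetric] ypair_def by (rule integral_nonneg_AE)
  let ?q = "\<lambda>y. - ((fst y *\<^sub>R snd y) \<bullet> Ut t x) - (fst y *\<^sub>R tensor (snd y) (snd y)) \<bullet> grad_mat U t x
      - fst y powr \<gamma> * divg U t x + fst y * Pt t x + (fst y *\<^sub>R snd y) \<bullet> (\<chi> j. Px j t x) + pt t x"
  have Qeq: "Q (t, x) = - (M1 (t, x) \<bullet> Ut t x) - M2 (t, x) \<bullet> grad_mat U t x - M3 (t, x) * divg U t x
      + M0 (t, x) * Pt t x + M1 (t, x) \<bullet> (\<chi> j. Px j t x) + pt t x"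
    unfolding Q_def fst_conv snd_conv Wm_sum[symmetric] by (simp add: frob_eq_inner inner_vec_def[of "M1 (t, x)" "\<chi> j. Px j t x"])
  have hq: "has_bochner_integral ?N ?q (Q (t, x))"
    unfolding Qeq
    by (intro has_bochner_integral_add has_bochner_integral_diff has_bochner_integral_minus
        has_bochner_integral_mult_left has_bochner_integral_inner_left h0 h1 h2 h3 hc)
  have hR: "has_bochner_integral ?N (\<lambda>y. \<Lambda> * C' * rel_density \<gamma> (fst y) (snd y) (r t x) (U t x) - (\<Sum>j\<in>UNIV. div_flux j t x))
      (\<Lambda> * C' * S (t, x) - (\<Sum>j\<in>UNIV. div_flux j t x))"
    by (intro has_bochner_integral_diff has_bochner_integral_mult_right hS hc)
  have t': "t \<in> {0..T}" using t by auto
  have "AE y in ?N. ?q y \<le> \<Lambda> * C' * rel_density \<gamma> (fst y) (snd y) (r t x) (U t x) - (\<Sum>j\<in>UNIV. div_flux j t x)"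
    using AEN
  proof eventually_elim
    case (elim y)
    then have "0 \<le> fst y" by (simp add: Xstate_def)
    from production_bound[OF t' this grad_le[OF t'], of "snd y"] show ?case
      by (simp add: C'_def frob_eq_inner inner_vec_def[of _ "\<chi> j. Px j t x"])
  qed
  from integral_mono_AE[OF _ _ this] show "Q (t, x) \<le> \<Lambda> * C' * S (t, x) - (\<Sum>j\<in>UNIV. div_flux j t x)"
    using hq hR by (simp add: has_bochner_integral_iff)
qed

end

section \<open>Integration over the cell and closing of the estimate\<close>

context dmv_flow begin

lemma AE_moments:
  "AE t in lborel. t \<in> {0<..<T} \<longrightarrow> (AE x in lborel. x \<in> cell \<longrightarrow>
      ypair \<nu> t x (\<lambda>y. rel_density \<gamma> (fst y) (snd y) (r t x) (U t x)) = S (t, x)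
    \<and> 0 \<le> S (t, x) \<and> Q (t, x) \<le> \<Lambda> * C' * S (t, x) - (\<Sum>j\<in>UNIV. div_flux j t x))"
proof -
  have "AE z in lborel. z \<in> Slab \<longrightarrow>
        integrable (\<nu> (fst z) (snd z)) fst
      \<and> integrable (\<nu> (fst z) (snd z)) (\<lambda>y. fst y *\<^sub>R snd y)
      \<and> integrable (\<nu> (fst z) (snd z)) (\<lambda>y. fst y *\<^sub>R tensor (snd y) (snd y))
      \<and> integrable (\<nu> (fst z) (snd z)) (\<lambda>y. fst y * (norm (snd y))\<^sup>2)
      \<and> integrable (\<nu> (fst z) (snd z)) (\<lambda>y. fst y powr \<gamma>)"
    using ie unfolding integrals_exist_def by blast
  then have "AE z in lborel. z \<in> Slab \<longrightarrow>
      ypair \<nu> (fst z) (snd z) (\<lambda>y. rel_density \<gamma> (fst y) (snd y) (r (fst z) (snd z)) (U (fst z) (snd z))) = S z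
    \<and> 0 \<le> S z \<and> Q z \<le> \<Lambda> * C' * S z - (\<Sum>j\<in>UNIV. div_flux j (fst z) (snd z))"
  proof eventually_elim
    case (elim z)
    show ?case
    proof
      assume z: "z \<in> Slab"
      then have "fst z \<in> {0<..<T}" "snd z \<in> cell" by auto
      from moments_pointwise[OF this] elim z
      show "ypair \<nu> (fst z) (snd z) (\<lambda>y. rel_density \<gamma> (fst y) (snd y) (r (fst z) (snd z)) (U (fst z) (snd z))) = S z
        \<and> 0 \<le> S z \<and> Q z \<le> \<Lambda> * C' * S z - (\<Sum>j\<in>UNIV. div_flux j (fst z) (snd z))"
        by simp
    qed
  qed
  from slab_AE[OF this] show ?thesis
  proof eventually_elim
    case (elim t)
    show ?case
    proof
      assume t: "t \<in> {0<..<T}"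
      from elim show "AE x in lborel. x \<in> cell \<longrightarrow>
          ypair \<nu> t x (\<lambda>y. rel_density \<gamma> (fst y) (snd y) (r t x) (U t x)) = S (t, x)
        \<and> 0 \<le> S (t, x) \<and> Q (t, x) \<le> \<Lambda> * C' * S (t, x) - (\<Sum>j\<in>UNIV. div_flux j t x)"
        by eventually_elim (use t in auto)
    qed
  qed
qed

text \<open>Index 1 belongs to momentum tested with \<open>U\<close>, index 2 to mass tested with
  \<open>P\<close>. The letter \<open>a\<close> marks the tested quantities and \<open>b\<close> the
  integrands of their rates, in case 1 without the defect.\<close>

definition "a1 z = M1 z \<bullet> U (fst z) (snd z)"
definition "a2 z = M0 z * P (fst z) (snd z)"
definition "b1 z = M1 z \<bullet> Ut (fst z) (snd z) + (\<Sum>j\<in>UNIV. Wm j z \<bullet> Ux j (fst z) (snd z))"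
definition "b2 z = M0 z * Pt (fst z) (snd z) + (\<Sum>j\<in>UNIV. M1 z $ j * Px j (fst z) (snd z))"
definition "kin z = 1/2 * M4 z + 1 / (\<gamma> - 1) * M3 z"

lemma slab_integrable:
  "set_integrable lborel Slab a1" "set_integrable lborel Slab a2"
  "set_integrable lborel Slab b1" "set_integrable lborel Slab b2"
  "set_integrable lborel Slab kin" "set_integrable lborel Slab (\<lambda>z. r (fst z) (snd z) powr \<gamma>)"
  "set_integrable lborel Slab (\<lambda>z. pt (fst z) (snd z))"
proof -
  interpret mom: weak_balance T M1 Wm \<mu> \<Theta>m "\<lambda>x. \<rho>0 x *\<^sub>R u0 x" by (rule momentum_balance)
  interpret mas: weak_balance T M0 "\<lambda>j z. M1 z $ j" \<mu> "\<lambda>j t x. 0" \<rho>0 by (rule mass_balance)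
  have sum_int: "set_integrable lborel Slab (\<lambda>z. \<Sum>j\<in>(UNIV::'d set). f j z)"
    if "\<And>j. set_integrable lborel Slab (f j)" for f :: "'d \<Rightarrow> real \<times> (real ^ 'd) \<Rightarrow> real"
    using that unfolding set_integrable_def scaleR_sum_right by (rule Bochner_Integration.integrable_sum)
  show "set_integrable lborel Slab a1" unfolding a1_def
    by (rule mom.set_integrable_inner_C0[OF mom.V C1_withD(2)[OF U_C1]])
  show "set_integrable lborel Slab a2" unfolding a2_def
    using mas.set_integrable_inner_C0[OF mas.V C1_withD(2)[OF P_C1]] by simp
  show "set_integrable lborel Slab b1" unfolding b1_def
    by (intro set_integral_add sum_int mom.set_integrable_inner_C0[OF mom.V C1_withD(3)[OF U_C1]]
        mom.set_integrable_inner_C0[OF mom.W C1_withD(4)[OF U_C1]])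
  have "set_integrable lborel Slab (\<lambda>z. M0 z \<bullet> Pt (fst z) (snd z) + (\<Sum>j\<in>UNIV. M1 z $ j \<bullet> Px j (fst z) (snd z)))"
    by (intro set_integral_add sum_int mas.set_integrable_inner_C0[OF mas.V C1_withD(3)[OF P_C1]]
        mas.set_integrable_inner_C0[OF mas.W C1_withD(4)[OF P_C1]])
  then show "set_integrable lborel Slab b2" unfolding b2_def by simp
  show "set_integrable lborel Slab kin" unfolding kin_def
    by (intro set_integral_add set_integrable_mult_right M_integrable)
  show "set_integrable lborel Slab (\<lambda>z. r (fst z) (snd z) powr \<gamma>)" "set_integrable lborel Slab (\<lambda>z. pt (fst z) (snd z))"
    by (intro slab_integrable_continuous continuous_powr_r pt_continuous)+
qed

lemma S_eq: "S z = kin z - a1 z + a2 z + r (fst z) (snd z) powr \<gamma>"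
  by (simp add: S_def kin_def a1_def a2_def)

lemma Q_eq: "Q z = - b1 z + b2 z + pt (fst z) (snd z)"
  by (simp add: Q_def b1_def b2_def)

lemma S_integrable: "set_integrable lborel Slab S"
  unfolding S_eq[abs_def] by (intro set_integral_add set_integral_diff slab_integrable)

text \<open>Being built from the moments, \<open>srel\<close> is integrable in time by Fubini. The
  estimate is therefore run for \<open>e\<close>, which majorizes \<open>E_rel\<close> at almost
  every time.\<close>

definition "srel t = (LINT x:cell|lborel. S (t, x))"
definition "e t = srel t + D t"

lemma AE_srel_split:
  "AE t in lborel. t \<in> {0<..<T} \<longrightarrow> srel t = (LINT x:cell|lborel. kin (t, x)) - (LINT x:cell|lborel. a1 (t, x))
    + (LINT x:cell|lborel. a2 (t, x)) + (LINT x:cell|lborel. r t x powr \<gamma>)"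
  using slab_Fubini(3)[OF slab_integrable(1)] slab_Fubini(3)[OF slab_integrable(2)]
    slab_Fubini(3)[OF slab_integrable(5)] slab_Fubini(3)[OF slab_integrable(6)]
  by eventually_elim (auto simp: srel_def S_eq)

lemma AE_E_rel_le: "AE t in lborel. t \<in> {0<..<T} \<longrightarrow> E_rel \<gamma> \<nu> D r U t \<le> e t"
  using AE_moments slab_Fubini(3)[OF S_integrable]
proof eventually_elim
  case (elim t)
  show ?case
  proof
    assume t: "t \<in> {0<..<T}"
    let ?f = "\<lambda>x. ypair \<nu> t x (\<lambda>y. rel_density \<gamma> (fst y) (snd y) (r t x) (U t x))"
    have AEt: "AE x in lborel. x \<in> cell \<longrightarrow> ?f x = S (t, x) \<and> 0 \<le> S (t, x)"
      using elim(1) t by (auto elim: eventually_mono)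
    have iS: "integrable lborel (\<lambda>x. indicator cell x *\<^sub>R S (t, x))"
      using elim(2) t by (simp add: set_integrable_def)
    have "(LINT x:cell|lborel. ?f x) \<le> srel t"
    proof (cases "set_integrable lborel cell ?f")
      case True
      then have "(LINT x:cell|lborel. ?f x) = srel t"
        unfolding srel_def set_lebesgue_integral_def set_integrable_def
        using iS AEt by (intro integral_cong_AE) (auto split: split_indicator elim: eventually_mono)
      then show ?thesis by simp
    next
      text \<open>The integrand need not be measurable on the exceptional null set; its integral is then
        \<open>0\<close> by convention.\<close>
      case False
      then have "(LINT x:cell|lborel. ?f x) = 0"
        by (simp add: set_integrable_def set_lebesgue_integral_def not_integrable_integral_eq)
      moreover have "0 \<le> srel t"
        unfolding srel_def set_lebesgue_integral_def
        using AEt by (intro integral_nonneg_AE) (auto split: split_indicator elim: eventually_mono)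
      ultimately show ?thesis by simp
    qed
    then show "E_rel \<gamma> \<nu> D r U t \<le> e t" by (simp add: E_rel_def e_def)
  qed
qed

lemma D_facts:
  "set_integrable lborel {0<..<T} D" "AE t in lborel. t \<in> {0<..<T} \<longrightarrow> 0 \<le> D t"
  "AE t in lborel. t \<in> {0<..<T} \<longrightarrow> total_var (\<mu> t) (\<theta> t) \<le> Cm * D t"
proof -
  obtain B where B: "AE t in lborel. t \<in> {0<..<T} \<longrightarrow> \<bar>D t\<bar> \<le> B" and m: "set_borel_measurable lborel {0<..<T} D"
    using dmv unfolding dmv_solution_def by blast
  show "set_integrable lborel {0<..<T} D"
    unfolding set_integrable_def
  proof (rule Bochner_Integration.integrable_bound)
    show "integrable lborel (\<lambda>t. indicator {0<..<T} t *\<^sub>R B)"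
      by (intro integrable_scaleR_left) (auto intro!: integrable_real_indicator simp: emeasure_lborel_Ioo T less_imp_le)
    show "(\<lambda>t. indicator {0<..<T} t *\<^sub>R D t) \<in> borel_measurable lborel" using m by (simp add: set_borel_measurable_def)
    show "AE t in lborel. norm (indicator {0<..<T} t *\<^sub>R D t) \<le> norm (indicator {0<..<T} t *\<^sub>R B)"
      using B by eventually_elim (auto split: split_indicator)
  qed
  show "AE t in lborel. t \<in> {0<..<T} \<longrightarrow> 0 \<le> D t" "AE t in lborel. t \<in> {0<..<T} \<longrightarrow> total_var (\<mu> t) (\<theta> t) \<le> Cm * D t"
    using dmv unfolding dmv_solution_def by blast+
qed

lemma e_integrable: "set_integrable lborel {0<..<T} e"
  unfolding e_def srel_def by (intro set_integral_add slab_Fubini(1)[OF S_integrable] D_facts)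

definition "defect_rate t = (\<integral>x. (\<Sum>j\<in>UNIV. Ux j t x \<bullet> \<Theta>m j t x) \<partial>\<mu> t)"
text \<open>Only the tested terms and the pressure contribute; the energy itself enters through its
  inequality. The momentum part carries a minus sign, as it does in the relative energy.\<close>

definition "rate t = - ((LINT x:cell|lborel. b1 (t, x)) + defect_rate t) + (LINT x:cell|lborel. b2 (t, x)) + (LINT x:cell|lborel. pt t x)"

text \<open>The same splitting as at later times, so that the initial terms of the energy
  inequality, of the two balances and of the pressure identity add up to exactly
  \<open>E_rel0\<close>.\<close>

lemma initial_energy:
  "E_rel0 \<gamma> \<rho>0 u0 r U = (LINT x:cell|lborel. 1/2 * \<rho>0 x * (norm (u0 x))\<^sup>2 + 1 / (\<gamma> - 1) * \<rho>0 x powr \<gamma>)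
    - (LINT x:cell|lborel. (\<rho>0 x *\<^sub>R u0 x) \<bullet> U 0 x) + (LINT x:cell|lborel. \<rho>0 x * P 0 x) + (LINT x:cell|lborel. r 0 x powr \<gamma>)"
proof -
  have t0: "0 \<in> {0..T}" using T by simp
  have bd: "\<exists>B. \<forall>x\<in>cell. norm (h 0 x) \<le> B"
    if "continuous_on ({0..T} \<times> UNIV) (\<lambda>z. h (fst z) (snd z))" for h :: "real \<Rightarrow> real ^ 'd \<Rightarrow> 'z::euclidean_space"
    using bounded_on_slab[OF that] t0 by metis
  have m: "h 0 \<in> borel_measurable lborel"
    if "continuous_on ({0..T} \<times> UNIV) (\<lambda>z. h (fst z) (snd z))" for h :: "real \<Rightarrow> real ^ 'd \<Rightarrow> 'z::euclidean_space"
    using borel_measurable_continuous_onI[OF slice_continuous[OF that t0]] by simp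
  have i1: "set_integrable lborel cell (\<lambda>x. (\<rho>0 x *\<^sub>R u0 x) \<bullet> U 0 x)"
    using set_integrable_inner_bounded[OF _ m[OF C1_withD(2)[OF U_C1]], of cell "\<lambda>x. \<rho>0 x *\<^sub>R u0 x"]
      bd[OF C1_withD(2)[OF U_C1]] ie unfolding integrals_exist_def by blast
  have "set_integrable lborel cell (\<lambda>x. \<rho>0 x \<bullet> P 0 x)"
    using set_integrable_inner_bounded[OF _ m[OF C1_withD(2)[OF P_C1]], of cell \<rho>0]
      bd[OF C1_withD(2)[OF P_C1]] ie unfolding integrals_exist_def by blast
  then have i2: "set_integrable lborel cell (\<lambda>x. \<rho>0 x * P 0 x)" by simp
  have "set_integrable lborel cell (\<lambda>x. 1/2 * (\<rho>0 x * (norm (u0 x))\<^sup>2) + 1 / (\<gamma> - 1) * \<rho>0 x powr \<gamma>)"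
    using ie unfolding integrals_exist_def by (intro set_integral_add set_integrable_mult_right) blast+
  then have i3: "set_integrable lborel cell (\<lambda>x. 1/2 * \<rho>0 x * (norm (u0 x))\<^sup>2 + 1 / (\<gamma> - 1) * \<rho>0 x powr \<gamma>)"
    by (simp add: mult.assoc)
  have i4: "set_integrable lborel cell (\<lambda>x. r 0 x powr \<gamma>)"
    by (rule cell_integrable_continuous[OF slice_continuous[OF continuous_powr_r t0]])
  have "E_rel0 \<gamma> \<rho>0 u0 r U = (LINT x:cell|lborel. (1/2 * \<rho>0 x * (norm (u0 x))\<^sup>2 + 1 / (\<gamma> - 1) * \<rho>0 x powr \<gamma>)
    - (\<rho>0 x *\<^sub>R u0 x) \<bullet> U 0 x + \<rho>0 x * P 0 x + r 0 x powr \<gamma>)"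
    unfolding E_rel0_def rel_density_expand[OF \<gamma> r_pos] P_def[symmetric] by (simp only: mult.assoc)
  then show ?thesis by (simp only: set_integral_add set_integral_diff i1 i2 i3 i4)
qed

lemma E_rel0_nonneg: "0 \<le> E_rel0 \<gamma> \<rho>0 u0 r U"
proof -
  have "\<forall>x\<in>cell. 0 \<le> \<rho>0 x" using ie by (simp add: integrals_exist_def)
  then show ?thesis
    unfolding E_rel0_def set_lebesgue_integral_def
    by (intro Bochner_Integration.integral_nonneg) (auto simp: rel_density_nonneg \<gamma> r_pos split: split_indicator)
qed

text \<open>Momentum, mass and pressure satisfy exact identities at almost every time; the energy
  inequality, whose left-hand side contains \<open>D\<close>, is the sole source of the inequality
  sign.\<close>

lemma energy_balance:
  shows "set_integrable lborel {0<..<T} rate"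
    and "AE t in lborel. t \<in> {0<..<T} \<longrightarrow> e t \<le> E_rel0 \<gamma> \<rho>0 u0 r U + (LINT s:{0<..<t}|lborel. rate s)"
proof -
  interpret mom: weak_balance T M1 Wm \<mu> \<Theta>m "\<lambda>x. \<rho>0 x *\<^sub>R u0 x" by (rule momentum_balance)
  interpret mas: weak_balance T M0 "\<lambda>j z. M1 z $ j" \<mu> "\<lambda>j t x. 0" \<rho>0 by (rule mass_balance)
  have f1: "mom.flux_rate Ut (\<lambda>j. Ux j) = (\<lambda>t. (LINT x:cell|lborel. b1 (t, x)) + defect_rate t)"
    by (simp add: mom.flux_rate_def mom.defect_def b1_def defect_rate_def fun_eq_iff)
  have f2: "mas.flux_rate Pt Px = (\<lambda>t. (LINT x:cell|lborel. b2 (t, x)))"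
    by (simp add: mas.flux_rate_def mas.defect_def b2_def fun_eq_iff)
  define p where "p t = (LINT x:cell|lborel. pt t x)" for t
  have i1: "set_integrable lborel {0<..<T} (\<lambda>t. (LINT x:cell|lborel. b1 (t, x)) + defect_rate t)"
    using mom.balance_AE(2)[OF U_C1] unfolding f1 .
  have i2: "set_integrable lborel {0<..<T} (\<lambda>t. (LINT x:cell|lborel. b2 (t, x)))"
    using mas.balance_AE(2)[OF P_C1] unfolding f2 .
  have i3: "set_integrable lborel {0<..<T} p"
    using slab_Fubini(1)[OF slab_integrable(7)] by (simp add: p_def[abs_def])
  have rate_eq: "rate = (\<lambda>t. (LINT x:cell|lborel. b2 (t, x)) - ((LINT x:cell|lborel. b1 (t, x)) + defect_rate t) + p t)"
    by (simp add: rate_def p_def fun_eq_iff)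
  show "set_integrable lborel {0<..<T} rate"
    unfolding rate_eq by (intro set_integral_add set_integral_diff i1 i2 i3)
  have en: "AE t in lborel. t \<in> {0<..<T} \<longrightarrow> (LINT x:cell|lborel. kin (t, x)) + D t
      \<le> (LINT x:cell|lborel. 1/2 * \<rho>0 x * (norm (u0 x))\<^sup>2 + 1 / (\<gamma> - 1) * \<rho>0 x powr \<gamma>)"
    using dmv unfolding dmv_solution_def kin_def M3_def M4_def fst_conv snd_conv by blast
  show "AE t in lborel. t \<in> {0<..<T} \<longrightarrow> e t \<le> E_rel0 \<gamma> \<rho>0 u0 r U + (LINT s:{0<..<t}|lborel. rate s)"
    using en AE_srel_split mom.balance_AE(3)[OF U_C1, unfolded f1] mas.balance_AE(3)[OF P_C1, unfolded f2]
  proof eventually_elim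
    case (elim t)
    show ?case
    proof
      assume t: "t \<in> {0<..<T}"
      have sub: "set_integrable lborel {0<..<t} f" if "set_integrable lborel {0<..<T} f" for f :: "real \<Rightarrow> real"
        by (rule set_integrable_subset[OF that]) (use t in auto)
      have R: "(LINT s:{0<..<t}|lborel. rate s) = (LINT s:{0<..<t}|lborel. (LINT x:cell|lborel. b2 (s, x)))
        - (LINT s:{0<..<t}|lborel. (LINT x:cell|lborel. b1 (s, x)) + defect_rate s) + (LINT s:{0<..<t}|lborel. p s)"
        unfolding rate_eq by (simp only: set_integral_add set_integral_diff sub[OF i1] sub[OF i2] sub[OF i3])
      have A1: "(LINT x:cell|lborel. a1 (t, x)) = (LINT x:cell|lborel. (\<rho>0 x *\<^sub>R u0 x) \<bullet> U 0 x)
        + (LINT s:{0<..<t}|lborel. (LINT x:cell|lborel. b1 (s, x)) + defect_rate s)"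
        using elim(3) t by (simp add: a1_def)
      have A2: "(LINT x:cell|lborel. a2 (t, x)) = (LINT x:cell|lborel. \<rho>0 x * P 0 x)
        + (LINT s:{0<..<t}|lborel. (LINT x:cell|lborel. b2 (s, x)))"
        using elim(4) t by (simp add: a2_def)
      have A3: "(LINT x:cell|lborel. r t x powr \<gamma>) = (LINT x:cell|lborel. r 0 x powr \<gamma>) + (LINT s:{0<..<t}|lborel. p s)"
        using pressure_FTC[OF t] by (simp add: p_def)
      have "e t = ((LINT x:cell|lborel. kin (t, x)) + D t) - (LINT x:cell|lborel. a1 (t, x))
        + (LINT x:cell|lborel. a2 (t, x)) + (LINT x:cell|lborel. r t x powr \<gamma>)"
        using elim(2) t by (simp add: e_def)
      also have "\<dots> \<le> E_rel0 \<gamma> \<rho>0 u0 r U + (LINT s:{0<..<t}|lborel. rate s)"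
        using elim(1) t unfolding R A1 A2 A3 initial_energy by simp
      finally show "e t \<le> E_rel0 \<gamma> \<rho>0 u0 r U + (LINT s:{0<..<t}|lborel. rate s)" .
    qed
  qed
qed

text \<open>Integrating the pointwise bound over the cell removes the divergence. The defect
  contributes at most \<open>\<Lambda>\<close> times its total variation, which condition (iii)
  converts into \<open>\<Lambda> * Cm * D t\<close>.\<close>

lemma AE_rate_le: "AE t in lborel. t \<in> {0<..<T} \<longrightarrow> rate t \<le> \<Lambda> * (C' + Cm) * e t"
  using AE_moments slab_Fubini(3)[OF S_integrable] slab_Fubini(3)[OF slab_integrable(3)]
    slab_Fubini(3)[OF slab_integrable(4)] slab_Fubini(3)[OF slab_integrable(7)] D_facts(2,3)
proof eventually_elim
  case (elim t)
  show ?case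
  proof
    assume t: "t \<in> {0<..<T}"
    then have t': "t \<in> {0..T}" by auto
    have ib: "set_integrable lborel cell (\<lambda>x. b1 (t, x))" "set_integrable lborel cell (\<lambda>x. b2 (t, x))"
      "set_integrable lborel cell (\<lambda>x. pt t x)" and iS: "set_integrable lborel cell (\<lambda>x. S (t, x))"
      and D: "0 \<le> D t" "total_var (\<mu> t) (\<theta> t) \<le> Cm * D t"
      using elim t by auto
    have AEt: "AE x in lborel. x \<in> cell \<longrightarrow> 0 \<le> S (t, x) \<and> Q (t, x) \<le> \<Lambda> * C' * S (t, x) - (\<Sum>j\<in>UNIV. div_flux j t x)"
      using elim(1) t by (auto elim: eventually_mono)
    have iQ: "set_integrable lborel cell (\<lambda>x. Q (t, x))"
      unfolding Q_eq using ib by (intro set_integral_add) (auto simp: set_integrable_def)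
    have idf: "set_integrable lborel cell (div_flux j t)" for j
      by (rule cell_integrable_continuous[OF div_flux_continuous[OF t']])
    have isum: "set_integrable lborel cell (\<lambda>x. \<Sum>j\<in>UNIV. div_flux j t x)"
      using idf unfolding set_integrable_def scaleR_sum_right by (rule Bochner_Integration.integrable_sum)
    have zero: "(LINT x:cell|lborel. \<Sum>j\<in>UNIV. div_flux j t x) = 0"
    proof -
      have "(LINT x:cell|lborel. \<Sum>j\<in>UNIV. div_flux j t x) = (\<Sum>j\<in>UNIV. LINT x:cell|lborel. div_flux j t x)"
        using idf unfolding set_integrable_def set_lebesgue_integral_def scaleR_sum_right
        by (rule Bochner_Integration.integral_sum)
      then show ?thesis by (simp add: div_flux_integral_zero[OF t'])
    qed
    have s0: "0 \<le> srel t"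
      unfolding srel_def set_lebesgue_integral_def
      using AEt by (intro integral_nonneg_AE) (auto split: split_indicator elim: eventually_mono)
    have rQ: "rate t = (LINT x:cell|lborel. Q (t, x)) - defect_rate t"
      unfolding rate_def Q_eq using ib by (simp add: set_integral_uminus)
    have iSC: "set_integrable lborel cell (\<lambda>x. \<Lambda> * C' * S (t, x))"
      by (rule set_integrable_mult_right) (rule iS)
    have "(LINT x:cell|lborel. Q (t, x)) \<le> (LINT x:cell|lborel. \<Lambda> * C' * S (t, x) - (\<Sum>j\<in>UNIV. div_flux j t x))"
    proof (rule set_integral_mono_AE[OF iQ set_integral_diff(1)[OF iSC isum]])
      show "AE x\<in>cell in lborel. Q (t, x) \<le> \<Lambda> * C' * S (t, x) - (\<Sum>j\<in>UNIV. div_flux j t x)"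
        using AEt by eventually_elim blast
    qed
    moreover have "\<dots> = \<Lambda> * C' * srel t"
      unfolding set_integral_diff(2)[OF iSC isum] zero srel_def by simp
    ultimately have 1: "rate t \<le> \<Lambda> * C' * srel t - defect_rate t" using rQ by linarith
    have "- defect_rate t \<le> \<Lambda> * total_var (\<mu> t) (\<theta> t)"
    proof -
      note \<mu>f = \<mu>_facts[OF t]
      have "\<bar>defect_rate t\<bar> \<le> (\<integral>x. norm (frob (grad_mat U t x) (\<theta> t x)) \<partial>\<mu> t)"
        unfolding defect_rate_def frob_grad[symmetric]
        using integral_norm_bound[of "\<mu> t" "\<lambda>x. frob (grad_mat U t x) (\<theta> t x)"] by simp
      also have "\<dots> \<le> (\<integral>x. \<Lambda> * norm (\<theta> t x) \<partial>\<mu> t)"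
      proof (rule integral_mono')
        show "integrable (\<mu> t) (\<lambda>x. \<Lambda> * norm (\<theta> t x))" by (intro integrable_mult_right integrable_norm \<mu>f)
        show "norm (frob (grad_mat U t x) (\<theta> t x)) \<le> \<Lambda> * norm (\<theta> t x)" for x
          unfolding frob_eq_inner real_norm_def
          by (rule order_trans[OF Cauchy_Schwarz_ineq2]) (intro mult_right_mono grad_le[OF t'] norm_ge_zero)
      qed (simp add: \<Lambda>_nonneg)
      finally show ?thesis by (simp add: total_var_def)
    qed
    also have "\<dots> \<le> \<Lambda> * (Cm * D t)" by (intro mult_left_mono D \<Lambda>_nonneg)
    finally have 2: "- defect_rate t \<le> \<Lambda> * Cm * D t" by (simp add: mult.assoc)
    \<comment> \<open>The rate is bounded by \<open>\<Lambda>\<close> times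
      \<open>C' * srel t + Cm * D t\<close>. Adding the nonnegative cross terms gives both parts of
      \<open>e\<close> the same coefficient \<open>C' + Cm\<close>.\<close>
    have "0 \<le> C'" using \<gamma> by (simp add: C'_def)
    then have "0 \<le> \<Lambda> * Cm * srel t + \<Lambda> * C' * D t"
      using Cm \<Lambda>_nonneg s0 D(1) by (intro add_nonneg_nonneg mult_nonneg_nonneg) auto
    then show "rate t \<le> \<Lambda> * (C' + Cm) * e t"
      using 1 2 by (simp add: e_def algebra_simps)
  qed
qed

lemma relative_energy_bound:
  "AE t in lborel. t \<in> {0<..<T} \<longrightarrow> E_rel \<gamma> \<nu> D r U t \<le> exp ((C' + Cm) * T * grad_sup T U) * E_rel0 \<gamma> \<rho>0 u0 r U"
proof -
  define K where "K = \<Lambda> * (C' + Cm)"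
  have K: "0 \<le> K" using \<Lambda>_nonneg Cm \<gamma> by (auto simp: K_def C'_def intro!: mult_nonneg_nonneg)
  have "AE t in lborel. t \<in> {0<..<T} \<longrightarrow> e t \<le> E_rel0 \<gamma> \<rho>0 u0 r U + K * (LINT s:{0<..<t}|lborel. e s)"
    using energy_balance(2)
  proof eventually_elim
    case (elim t)
    show ?case
    proof
      assume t: "t \<in> {0<..<T}"
      have sub: "set_integrable lborel {0<..<t} f" if "set_integrable lborel {0<..<T} f" for f :: "real \<Rightarrow> real"
        by (rule set_integrable_subset[OF that]) (use t in auto)
      have "(LINT s:{0<..<t}|lborel. rate s) \<le> (LINT s:{0<..<t}|lborel. K * e s)"
      proof (rule set_integral_mono_AE)
        show "set_integrable lborel {0<..<t} rate" by (rule sub[OF energy_balance(1)])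
        show "set_integrable lborel {0<..<t} (\<lambda>s. K * e s)"
          by (intro set_integrable_mult_right sub e_integrable)
        show "AE s\<in>{0<..<t} in lborel. rate s \<le> K * e s"
          using AE_rate_le by eventually_elim (use t in \<open>auto simp: K_def\<close>)
      qed
      then show "e t \<le> E_rel0 \<gamma> \<rho>0 u0 r U + K * (LINT s:{0<..<t}|lborel. e s)"
        using elim t by simp
    qed
  qed
  from Gronwall_AE[OF e_integrable K this] AE_E_rel_le show ?thesis
  proof eventually_elim
    case (elim t)
    show ?case
    proof
      assume t: "t \<in> {0<..<T}"
      \<comment> \<open>Gronwall's lemma gives the growth factor at time \<open>t\<close>. Enlarging
        it to its value at \<open>T\<close> preserves the bound because the initial relative energy
        is nonnegative.\<close>
      have "K * t \<le> K * T" using t K by (intro mult_left_mono) auto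
      also have "\<dots> = (C' + Cm) * T * grad_sup T U" by (simp add: K_def \<Lambda>_def)
      finally have "exp (K * t) * E_rel0 \<gamma> \<rho>0 u0 r U \<le> exp ((C' + Cm) * T * grad_sup T U) * E_rel0 \<gamma> \<rho>0 u0 r U"
        by (intro mult_right_mono E_rel0_nonneg) simp
      then show "E_rel \<gamma> \<nu> D r U t \<le> exp ((C' + Cm) * T * grad_sup T U) * E_rel0 \<gamma> \<rho>0 u0 r U"
        using elim t by linarith
    qed
  qed
qed

end

theorem mainTheorem2:
  fixes \<gamma> Cm :: real
  assumes "1 < \<gamma>" and "0 < Cm"
  shows "\<exists>C>0. \<forall>(T::real)
      (\<nu> :: real \<Rightarrow> real ^ 'd \<Rightarrow> (real \<times> (real ^ 'd)) measure)
      (\<mu> :: real \<Rightarrow> (real ^ 'd) measure) (\<theta> :: real \<Rightarrow> real ^ 'd \<Rightarrow> real ^ 'd ^ 'd)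
      (D :: real \<Rightarrow> real) (\<rho>0 :: real ^ 'd \<Rightarrow> real) (u0 :: real ^ 'd \<Rightarrow> real ^ 'd)
      (r :: real \<Rightarrow> real ^ 'd \<Rightarrow> real) (U :: real \<Rightarrow> real ^ 'd \<Rightarrow> real ^ 'd).
      0 < T
      \<and> dmv_solution \<gamma> Cm T \<nu> \<mu> \<theta> D \<rho>0 u0
      \<and> integrals_exist \<gamma> T \<nu> \<rho>0 u0
      \<and> classical_solution \<gamma> T r U
      \<longrightarrow> (AE t in lborel. t \<in> {0<..<T} \<longrightarrow>
             E_rel \<gamma> \<nu> D r U t \<le> exp (C * T * grad_sup T U) * E_rel0 \<gamma> \<rho>0 u0 r U)"
\<comment> \<open>The witness adds 2 for the kinetic term, the dimension times \<gamma> - 1 for the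
  relative pressure, and \<open>Cm\<close> for the defect.\<close>
proof (intro exI[of _ "2 + real CARD('d) * (\<gamma> - 1) + Cm"] conjI allI impI)
  show "0 < 2 + real CARD('d) * (\<gamma> - 1) + Cm" using assms by (simp add: add_pos_nonneg)
  fix T :: real and \<nu> :: "real \<Rightarrow> real ^ 'd \<Rightarrow> (real \<times> (real ^ 'd)) measure"
    and \<mu> :: "real \<Rightarrow> (real ^ 'd) measure" and \<theta> :: "real \<Rightarrow> real ^ 'd \<Rightarrow> real ^ 'd ^ 'd"
    and D :: "real \<Rightarrow> real" and \<rho>0 :: "real ^ 'd \<Rightarrow> real" and u0 :: "real ^ 'd \<Rightarrow> real ^ 'd"
    and r :: "real \<Rightarrow> real ^ 'd \<Rightarrow> real" and U :: "real \<Rightarrow> real ^ 'd \<Rightarrow> real ^ 'd"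
  assume "0 < T \<and> dmv_solution \<gamma> Cm T \<nu> \<mu> \<theta> D \<rho>0 u0 \<and> integrals_exist \<gamma> T \<nu> \<rho>0 u0
      \<and> classical_solution \<gamma> T r U"
  then interpret dmv_flow \<gamma> T r U Cm \<nu> \<mu> \<theta> D \<rho>0 u0
    using assms by unfold_locales auto
  show "AE t in lborel. t \<in> {0<..<T} \<longrightarrow>
      E_rel \<gamma> \<nu> D r U t \<le> exp ((2 + real CARD('d) * (\<gamma> - 1) + Cm) * T * grad_sup T U) * E_rel0 \<gamma> \<rho>0 u0 r U"
    by (rule relative_energy_bound[unfolded C'_def])
qed

end
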